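(* The algebra $\mathcal{T}$ is an $\mathfrak{sl}_2$-algebra with respect to the action of $\mathfrak{sl}_2$ on $\mathcal{T}$ given by the derivations $D,W,\mathfrak{d}$ defined below. Moreover, the $q$-bracket $\mathcal{T}\to\widetilde{M}$ is an equivariant map of $\mathfrak{sl}_2$-algebras, i.e., for $f\in\mathcal{T}$ one has \[D\langle f\rangle_q=\langle Df\rangle_q,\quad W\langle f\rangle_q=\langle Wf\rangle_q,\quad \mathfrak{d}\langle f\rangle_q=\langle \mathfrak{d}f\rangle_q.\]
   Context: $\mathscr{P}$ is the set of partitions, $r_m(\lambda)$ the number of parts of $\lambda$ equal to $m$, and $\langle f\rangle_q=\sum_\lambda f(\lambda)q^{|\lambda|}/\sum_\lambda q^{|\lambda|}$. The Faulhaber polynomial $F_l$ is the polynomial with zero constant term with $F_l(n)=\sum_{i=1}^n i^{l-1}$ for $n\ge1$. For $k\ge0,l\ge1$, $k+l$ even, $T_{k,l}(\lambda)=-\frac{B_{k+l}}{2(k+l)}(\delta_{l,1}+\delta_{k,0})+\sum_{m\ge1}m^kF_l(r_m(\lambda))$; by convention $T_{0,0}\equiv T_{-1,1}\equiv-1$ and $T_{k,l}\equiv0$ for other $(k,l)$ with $k<0$ or $l<1$. $\mathcal{T}$ is the algebra generated by the $T_{k,l}$ under pointwise product; the elements $T_{k_1,l_1}\odot\cdots\odot T_{k_n,l_n}$ form a basis of it, where $\odot$ is the induced product ($\langle f\odot g\rangle_{\vec u}=\langle f\rangle_{\vec u}\langle g\rangle_{\vec u}$ with $\langle f\rangle_{\vec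 u}=\sum_\lambda f(\lambda)u_{\lambda_1}u_{\lambda_2}\cdots/\sum_\lambda u_{\lambda_1}u_{\lambda_2}\cdots$), and $\langle f\odot g\rangle_q=\langle f\rangle_q\langle g\rangle_q$. On $\mathcal{T}$ define derivations by $D\,T_{k,l}=T_{k+1,l+1}$, $W\,T_{k,l}=(k+l)T_{k,l}$, $\mathfrak{d}\,T_{k,l}=k(l-1)T_{k-1,l-1}-\tfrac12\delta_{k+l-2}$ (where $\delta_{k+l-2}$ is $1$ if $k+l=2$ and $0$ otherwise); these satisfy $[W,D]=2D$, $[W,\mathfrak{d}]=-2\mathfrak{d}$, $[\mathfrak{d},D]=W$. On the algebra $\widetilde{M}$ of quasimodular forms, $D=q\,\frac{d}{dq}$, $W$ multiplies by the weight, and $\mathfrak{d}$ is the derivation annihilating modular forms with $\mathfrak{d}G_2=-\tfrac12$ (equivalently $\phi\mapsto 2\pi i\phi_1$ in the quasimodular transformation law). An $\mathfrak{g}$-algebra is an algebra with a Lie homomorphism $\mathfrak{g}\to\mathrm{Der}(A)$. *)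

theory Defs
  imports "HOL-Library.Multiset" "HOL-Computational_Algebra.Formal_Power_Series" Complex_Main
begin

section \<open>Bernoulli numbers (convention B_1 = -1/2; only even indices are used)\<close>

fun bernoulli :: "nat \<Rightarrow> rat" where
  "bernoulli n = (if n = 0 then 1
     else - (\<Sum>j<n. of_nat (Suc n choose j) * bernoulli j) / of_nat (Suc n))"

typedef partition = "{lam :: nat multiset. 0 \<notin># lam}"
  by (rule exI[of _ "{#}"]) simp

definition mult :: "nat \<Rightarrow> partition \<Rightarrow> nat" where
  "mult m lam = count (Rep_partition lam) m"

definition psize :: "partition \<Rightarrow> nat" where
  "psize lam = sum_mset (Rep_partition lam)"

definition faulhaber :: "nat \<Rightarrow> nat \<Rightarrow> complex" where
  "faulhaber l n = (\<Sum>i=1..n. of_nat i ^ (l - 1))"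

text \<open>T_{k,l} with the stated conventions.  The sum over m >= 1 is written as a sum over
  the (finitely many) part sizes occurring in lambda; the omitted terms vanish since F_l(0) = 0.\<close>
definition Tkl :: "int \<Rightarrow> int \<Rightarrow> partition \<Rightarrow> complex" where
  "Tkl k l lam =
     (if (k = 0 \<and> l = 0) \<or> (k = -1 \<and> l = 1) then -1
      else if k < 0 \<or> l < 1 then 0
      else - of_rat (bernoulli (nat (k + l))) / (2 * of_int (k + l))
               * ((if l = 1 then 1 else 0) + (if k = 0 then 1 else 0))
           + (\<Sum>m\<in>set_mset (Rep_partition lam).
                of_nat m ^ nat k * faulhaber (nat l) (mult m lam)))"

inductive_set Talg :: "(partition \<Rightarrow> complex) set" where
  gen: "k \<ge> 0 \<Longrightarrow> l \<ge> 1 \<Longrightarrow> even (k + l) \<Longrightarrow> Tkl k l \<in> Talg"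
| const: "(\<lambda>_. c) \<in> Talg"
| add: "f \<in> Talg \<Longrightarrow> g \<in> Talg \<Longrightarrow> (\<lambda>x. f x + g x) \<in> Talg"
| mul: "f \<in> Talg \<Longrightarrow> g \<in> Talg \<Longrightarrow> (\<lambda>x. f x * g x) \<in> Talg"

text \<open>Formal power series in u_1, u_2, ... : the coefficient of the monomial
  u_{lambda_1} u_{lambda_2} ... is indexed by the partition lambda; the product is
  the Cauchy product over splittings of the multiset of parts.\<close>
definition pconv :: "(partition \<Rightarrow> complex) \<Rightarrow> (partition \<Rightarrow> complex) \<Rightarrow> partition \<Rightarrow> complex" where
  "pconv F G lam = (\<Sum>a\<in>{a. a \<subseteq># Rep_partition lam}.
       F (Abs_partition a) * G (Abs_partition (Rep_partition lam - a)))"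

definition uZ :: "partition \<Rightarrow> complex" where "uZ = (\<lambda>_. 1)"

text \<open>u-bracket: <f>_u = (sum_lambda f(lambda) u_lambda) / Z.\<close>
definition ubracket :: "(partition \<Rightarrow> complex) \<Rightarrow> partition \<Rightarrow> complex" where
  "ubracket f = (THE h. pconv uZ h = f)"

definition odot :: "(partition \<Rightarrow> complex) \<Rightarrow> (partition \<Rightarrow> complex) \<Rightarrow> partition \<Rightarrow> complex" where
  "odot f g = (THE h. ubracket h = pconv (ubracket f) (ubracket g))"

definition qnum :: "(partition \<Rightarrow> complex) \<Rightarrow> complex fps" where
  "qnum f = Abs_fps (\<lambda>n. \<Sum>lam\<in>{lam. psize lam = n}. f lam)"

definition qbracket :: "(partition \<Rightarrow> complex) \<Rightarrow> complex fps" where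
  "qbracket f = qnum f / qnum (\<lambda>_. 1)"

definition odot_derivation_on_T :: "((partition \<Rightarrow> complex) \<Rightarrow> partition \<Rightarrow> complex) \<Rightarrow> bool" where
  "odot_derivation_on_T X \<longleftrightarrow>
     (\<forall>f\<in>Talg. X f \<in> Talg) \<and>
     (\<forall>f\<in>Talg. \<forall>g\<in>Talg. X (\<lambda>x. f x + g x) = (\<lambda>x. X f x + X g x)) \<and>
     (\<forall>f\<in>Talg. \<forall>c. X (\<lambda>x. c * f x) = (\<lambda>x. c * X f x)) \<and>
     (\<forall>f\<in>Talg. \<forall>g\<in>Talg. X (odot f g) = (\<lambda>x. odot (X f) g x + odot f (X g) x))"

definition T_operators :: "((partition \<Rightarrow> complex) \<Rightarrow> partition \<Rightarrow> complex) \<Rightarrow>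
    ((partition \<Rightarrow> complex) \<Rightarrow> partition \<Rightarrow> complex) \<Rightarrow>
    ((partition \<Rightarrow> complex) \<Rightarrow> partition \<Rightarrow> complex) \<Rightarrow> bool" where
  "T_operators D W d \<longleftrightarrow>
     odot_derivation_on_T D \<and> odot_derivation_on_T W \<and> odot_derivation_on_T d \<and>
     (\<forall>k l. k \<ge> 0 \<longrightarrow> l \<ge> 1 \<longrightarrow> even (k + l) \<longrightarrow>
        D (Tkl k l) = Tkl (k + 1) (l + 1) \<and>
        W (Tkl k l) = (\<lambda>x. of_int (k + l) * Tkl k l x) \<and>
        d (Tkl k l) = (\<lambda>x. of_int (k * (l - 1)) * Tkl (k - 1) (l - 1) x
                            - (if k + l = 2 then 1/2 else 0)))"

section \<open>Quasimodular forms via q-expansions\<close>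

definition eisenstein :: "nat \<Rightarrow> complex fps" where
  "eisenstein k = Abs_fps (\<lambda>n. if n = 0 then - of_rat (bernoulli k) / (2 * of_nat k)
       else (\<Sum>d\<in>{d\<in>{1..n}. d dvd n}. of_nat d ^ (k - 1)))"

text \<open>Quasimodular forms (for SL_2(Z)): the algebra C[G_2, G_4, G_6].\<close>
inductive_set QMF :: "complex fps set" where
  G2: "eisenstein 2 \<in> QMF"
| G4: "eisenstein 4 \<in> QMF"
| G6: "eisenstein 6 \<in> QMF"
| const: "fps_const c \<in> QMF"
| add: "\<phi> \<in> QMF \<Longrightarrow> \<psi> \<in> QMF \<Longrightarrow> \<phi> + \<psi> \<in> QMF"
| mul: "\<phi> \<in> QMF \<Longrightarrow> \<psi> \<in> QMF \<Longrightarrow> \<phi> * \<psi> \<in> QMF"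

inductive_set MF :: "complex fps set" where
  G4: "eisenstein 4 \<in> MF"
| G6: "eisenstein 6 \<in> MF"
| const: "fps_const c \<in> MF"
| add: "\<phi> \<in> MF \<Longrightarrow> \<psi> \<in> MF \<Longrightarrow> \<phi> + \<psi> \<in> MF"
| mul: "\<phi> \<in> MF \<Longrightarrow> \<psi> \<in> MF \<Longrightarrow> \<phi> * \<psi> \<in> MF"

inductive_set QMF_wt :: "nat \<Rightarrow> complex fps set" for k :: nat where
  zero: "0 \<in> QMF_wt k"
| mono: "2 * a + 4 * b + 6 * c = k \<Longrightarrow>
           eisenstein 2 ^ a * eisenstein 4 ^ b * eisenstein 6 ^ c \<in> QMF_wt k"
| smult: "\<phi> \<in> QMF_wt k \<Longrightarrow> fps_const z * \<phi> \<in> QMF_wt k"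
| add: "\<phi> \<in> QMF_wt k \<Longrightarrow> \<psi> \<in> QMF_wt k \<Longrightarrow> \<phi> + \<psi> \<in> QMF_wt k"

definition is_weight_operator :: "(complex fps \<Rightarrow> complex fps) \<Rightarrow> bool" where
  "is_weight_operator W \<longleftrightarrow>
     (\<forall>\<phi>\<in>QMF. \<forall>\<psi>\<in>QMF. W (\<phi> + \<psi>) = W \<phi> + W \<psi>) \<and>
     (\<forall>k. \<forall>\<phi>\<in>QMF_wt k. W \<phi> = fps_const (of_nat k) * \<phi>)"

definition is_frak_d_operator :: "(complex fps \<Rightarrow> complex fps) \<Rightarrow> bool" where
  "is_frak_d_operator d \<longleftrightarrow>
     (\<forall>\<phi>\<in>QMF. \<forall>\<psi>\<in>QMF. d (\<phi> + \<psi>) = d \<phi> + d \<psi>) \<and>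
     (\<forall>\<phi>\<in>QMF. \<forall>c. d (fps_const c * \<phi>) = fps_const c * d \<phi>) \<and>
     (\<forall>\<phi>\<in>QMF. \<forall>\<psi>\<in>QMF. d (\<phi> * \<psi>) = d \<phi> * \<psi> + \<phi> * d \<psi>) \<and>
     (\<forall>\<phi>\<in>MF. d \<phi> = 0) \<and>
     d (eisenstein 2) = fps_const (- 1/2)"

definition qD :: "complex fps \<Rightarrow> complex fps" where
  "qD \<phi> = fps_X * fps_deriv \<phi>"

end

theory Submission
  imports Defs "HOL-Computational_Algebra.Polynomial"
begin

text \<open>
  Under the \<open>u\<close>-bracket, \<open>T\<^bsub>k,l\<^esub>\<close> minus its constant becomes the power series with coefficient
  \<open>m\<^sup>k i\<^bsup>l-1\<^esup>\<close> at \<open>u\<^sub>m\<^sup>i\<close> and \<open>0\<close> elsewhere.  Both multiplication by a generator and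
  its \<open>\<odot>\<close>-multiplication are sums over the part sizes \<open>m\<close> of \<open>m\<^sup>k\<close> times a linear operator
  acting on the multiplicity \<open>r\<^sub>m\<close> alone, and commutators of such sums have the same shape.  These
  one-variable operators preserve polynomials and, up to a scalar operator, commute up to sign with the
  reflection \<open>r \<mapsto> -1-r\<close>, so that they send \<open>1\<close> to a combination of Faulhaber polynomials of
  fixed parity.  Induction along commutators then shows that the pointwise and the \<open>\<odot>\<close>-algebra
  generated by the \<open>T\<^bsub>k,l\<^esub>\<close> coincide.  Looking at partitions with as many distinct parts as
  factors, the \<open>\<odot>\<close>-monomials are linearly independent, hence derivations may be prescribed on
  generators.

  The \<open>q\<close>-bracket of \<open>T\<^bsub>k,l\<^esub>\<close> is an iterated derivative of an Eisenstein series.  A Liouville type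
  summation identity gives \<open>120 G\<^sub>4\<^sup>2 = G\<^sub>8\<close> and a recursion expressing \<open>G\<^bsub>K+2\<^esub>\<close> through
  \<open>D G\<^sub>K\<close> and products of lower Eisenstein series; this contains Ramanujan's formulas for the
  derivatives of \<open>G\<^sub>2, G\<^sub>4, G\<^sub>6\<close>, shows that all \<open>G\<^sub>k\<close> with \<open>k \<ge> 4\<close> are
  polynomials in \<open>G\<^sub>4\<close> and \<open>G\<^sub>6\<close>, and yields the commutator of \<open>D\<close> with the
  derivation annihilating modular forms.
\<close>

section \<open>Bernoulli numbers\<close>

text \<open>Quasimodular forms are given as polynomials in three \<open>q\<close>-expansions, so
  neither a transformation law nor a dimension count is at hand: each relation between Eisenstein
  series has to be an explicit identity of divisor sums. On the other side, \<open>Talg\<close> is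
  generated by the pointwise product, while \<open>D\<close>, \<open>W\<close>, \<open>d\<close>
  obey Leibniz' rule for \<open>odot\<close>, and it is \<open>odot\<close> that is multiplicative
  under the \<open>q\<close>-bracket. A statement about derivations reduces to generators only once
  every element of \<open>Talg\<close> is known to arise from constants by sums and
  \<open>odot\<close>-multiplication with generators; this makes the comparison of the two products
  indispensable. After it, the sl2 relations and equivariance are checks on one generator at a time.
  The check with real content concerns \<open>d\<close>: the bracket of a generator is an iterated
  derivative of some Eisenstein series, so \<open>d\<close> has to be moved past \<open>qD\<close>.
  The arithmetic behind the formula for \<open>d\<close> is
  \<open>k * j + (k + j + 1) = (k + 1) * (j + 1)\<close>, where \<open>j = l - 1\<close> is the
  index used throughout.\<close>

unbundle fps_syntax

declare bernoulli.simps [simp del]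

definition bern :: "nat \<Rightarrow> complex" where
  "bern n = of_rat (bernoulli n)"

definition bern_egf :: "complex fps" where
  "bern_egf = Abs_fps (\<lambda>n. bern n / fact n)"

lemma bern_0 [simp]: "bern 0 = 1"
  by (simp add: bern_def bernoulli.simps)

lemma bern_rec:
  assumes "n > 0"
  shows "(\<Sum>j\<le>n. of_nat (Suc n choose j) * bern j) = 0"
proof -
  have "of_nat (Suc n) * bernoulli n = - (\<Sum>j<n. of_nat (Suc n choose j) * bernoulli j)"
    using assms by (subst bernoulli.simps) (simp del: of_nat_Suc)
  then have "(of_rat (of_nat (Suc n) * bernoulli n) :: complex)
      = of_rat (- (\<Sum>j<n. of_nat (Suc n choose j) * bernoulli j))"
    by simp
  then have "of_nat (Suc n) * bern n = - (\<Sum>j<n. of_nat (Suc n choose j) * bern j)"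
    by (simp add: bern_def of_rat_mult of_rat_sum of_rat_minus of_rat_add)
  then show ?thesis
    by (simp add: lessThan_Suc_atMost [symmetric] del: of_nat_Suc)
qed

lemma bern_egf_mult: "bern_egf * (fps_exp 1 - 1) = fps_X"
proof (rule fps_ext)
  fix n
  show "(bern_egf * (fps_exp 1 - 1)) $ n = (fps_X :: complex fps) $ n"
  proof (cases n)
    case (Suc m)
    have "(bern_egf * (fps_exp 1 - 1)) $ n
        = (\<Sum>i\<in>{..Suc m}. bern i / fact i * (if i = Suc m then 0 else 1 / fact (Suc m - i)))"
      unfolding fps_mult_nth Suc atLeast0AtMost by (rule sum.cong) (auto simp: bern_egf_def)
    also have "\<dots> = (\<Sum>i\<le>m. bern i / fact i * (1 / fact (Suc m - i)))"
      by (simp add: atMost_Suc) (rule sum.cong, auto)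
    also have "\<dots> = (\<Sum>i\<le>m. of_nat (Suc m choose i) * bern i) / fact (Suc m)"
      unfolding sum_divide_distrib
      by (rule sum.cong) (auto simp: binomial_fact field_simps simp del: fact_Suc)
    also have "\<dots> = fps_X $ n"
    proof (cases "m = 0")
      case True
      then show ?thesis by (simp add: Suc)
    next
      case False
      then show ?thesis using bern_rec [of m] by (simp add: Suc)
    qed
    finally show ?thesis .
  qed (simp add: bern_egf_def)
qed

lemma fps_exp_1_neq: "fps_exp (1::complex) - 1 \<noteq> 0"
  by simp

text \<open>Substituting \<open>- fps_X\<close> into \<open>bern_egf_mult\<close> gives
  \<open>B(-x) (e^x - 1) = x e^x\<close>, hence \<open>B(-x) = B(x) + x\<close>: apart from the
  linear term the generating function is even.\<close>

lemma bern_odd: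
  assumes "odd n" "n \<noteq> 1"
  shows "bern n = 0"
proof -
  define Bm where "Bm = bern_egf oo (- fps_X)"
  have e: "fps_exp (1::complex) oo (- fps_X) = fps_exp (- 1)"
    using fps_exp_compose_linear [of 1 "-1::complex"] by (simp flip: fps_const_neg)
  have "(bern_egf * (fps_exp 1 - 1)) oo (- fps_X) = - fps_X"
    unfolding bern_egf_mult by simp
  then have 1: "Bm * (fps_exp (- 1) - 1) = - fps_X"
    by (simp add: Bm_def fps_compose_mult_distrib fps_compose_sub_distrib e)
  have ee: "fps_exp (- 1) * fps_exp (1::complex) = 1"
    by (simp flip: fps_exp_add_mult)
  have "Bm * (fps_exp 1 - 1) = - (Bm * (fps_exp (- 1) - 1)) * fps_exp 1"
    using ee by (simp add: algebra_simps)
  also have "\<dots> = fps_X * fps_exp 1"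
    unfolding 1 by simp
  also have "\<dots> = (bern_egf + fps_X) * (fps_exp 1 - 1)"
    by (simp add: distrib_right bern_egf_mult) (simp add: algebra_simps)
  finally have "Bm = bern_egf + fps_X"
    using fps_exp_1_neq mult_cancel_right by blast
  then have "Bm $ n = bern_egf $ n"
    using assms by (cases n) auto
  moreover have "Bm $ n = - bern_egf $ n"
    using assms unfolding Bm_def by (simp add: fps_compose_uminus')
  ultimately show ?thesis by (simp add: bern_egf_def)
qed

text \<open>The geometric sum of the \<open>e^(j x)\<close> is
  \<open>(e^(d x) - 1) / (e^x - 1)\<close>, and \<open>x / (e^x - 1)\<close> is
  \<open>bern_egf\<close>; the formula is the coefficient of \<open>x^(K + 1)\<close>. The case
  \<open>K = 0\<close> relies on \<open>0 ^ 0 = 1\<close>.\<close>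

lemma faulhaber_sum:
  "(\<Sum>j<d. of_nat j ^ K)
    = (\<Sum>j\<le>K. of_nat (Suc K choose j) * bern j * of_nat d ^ (Suc K - j)) / (of_nat (Suc K) :: complex)"
proof -
  define E where "E = fps_exp (1::complex)"
  have "(E - 1) * (\<Sum>j<d. E ^ j) = E ^ d - 1"
    using power_diff_1_eq [of E d] by simp
  then have "(\<Sum>j<d. E ^ j) * fps_X = bern_egf * (E ^ d - 1)"
    by (simp flip: bern_egf_mult add: E_def mult_ac)
  then have "(\<Sum>j<d. fps_exp (of_nat j :: complex)) * fps_X = bern_egf * (fps_exp (of_nat d) - 1)"
    by (simp add: E_def fps_exp_power_mult)
  then have "((\<Sum>j<d. fps_exp (of_nat j :: complex)) * fps_X) $ Suc K
      = (bern_egf * (fps_exp (of_nat d) - 1)) $ Suc K" by simp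
  moreover have "((\<Sum>j<d. fps_exp (of_nat j :: complex)) * fps_X) $ Suc K
      = (\<Sum>j<d. of_nat j ^ K) / fact K"
    by (simp add: fps_sum_nth sum_divide_distrib)
  moreover have "(bern_egf * (fps_exp (of_nat d) - 1)) $ Suc K
      = (\<Sum>i\<in>{..Suc K}. bern i / fact i * (if i = Suc K then 0 else of_nat d ^ (Suc K - i) / fact (Suc K - i)))"
    unfolding fps_mult_nth atLeast0AtMost by (rule sum.cong) (auto simp: bern_egf_def)
  moreover have "\<dots> = (\<Sum>i\<le>K. bern i / fact i * (of_nat d ^ (Suc K - i) / fact (Suc K - i)))"
    by (simp add: atMost_Suc) (rule sum.cong, auto)
  moreover have "\<dots> = (\<Sum>j\<le>K. of_nat (Suc K choose j) * bern j * of_nat d ^ (Suc K - j)) / fact (Suc K)"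
    unfolding sum_divide_distrib
    by (rule sum.cong) (auto simp: binomial_fact field_simps simp del: fact_Suc)
  ultimately have "(\<Sum>j<d. of_nat j ^ K) / (fact K :: complex)
     = (\<Sum>j\<le>K. of_nat (Suc K choose j) * bern j * of_nat d ^ (Suc K - j)) / (of_nat (Suc K) * fact K)"
    by simp
  then show ?thesis by (simp del: of_nat_Suc add: divide_eq_eq)
qed

lemma bern_1: "bern 1 = - 1 / 2"
proof -
  have "2 * bern 1 = - 1"
    using bern_rec [of 1] by (simp add: add_eq_0_iff)
  then have "2 * bern 1 = 2 * (- 1 / 2)" by simp
  then show ?thesis by (metis mult_left_cancel zero_neq_numeral)
qed

text \<open>Euler's identity, from the differential equation \<open>x B' = B - B^2 - x B\<close>,
  which follows by differentiating \<open>B (e^x - 1) = x\<close>. In degree \<open>n\<close> the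
  term \<open>x B\<close> contributes \<open>bern (n - 1) = 0\<close>, and the end terms of
  \<open>B^2\<close> contribute \<open>2 * bern n\<close>, which turns the factor
  \<open>n - 1\<close> into \<open>n + 1\<close>.\<close>

lemma euler_bern:
  assumes "even n" "n \<ge> 4"
  shows "(of_nat n + 1) * bern n = - (\<Sum>j\<in>{j. even j \<and> 2 \<le> j \<and> j \<le> n - 2}. of_nat (n choose j) * bern j * bern (n - j))"
proof -
  define E where "E = fps_exp (1::complex)"
  have B: "bern_egf * (E - 1) = fps_X" by (simp add: E_def bern_egf_mult)
  have "fps_deriv (bern_egf * (E - 1)) = 1" by (simp add: B)
  then have d: "bern_egf * E + fps_deriv bern_egf * (E - 1) = 1"
    by (simp add: E_def)
  have "(fps_X * fps_deriv bern_egf) * (E - 1) * (E - 1)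
      = (bern_egf - bern_egf ^ 2 - fps_X * bern_egf) * (E - 1) * (E - 1)"
  proof -
    have "fps_deriv bern_egf * (E - 1) = 1 - bern_egf * E"
      using d by (simp add: eq_diff_eq add.commute)
    then have "(fps_X * fps_deriv bern_egf) * (E - 1) * (E - 1) = fps_X * (1 - bern_egf * E) * (E - 1)"
      by (metis mult.assoc)
    also have "\<dots> = fps_X * (E - 1) - fps_X * E * (bern_egf * (E - 1))"
      by (simp add: algebra_simps)
    also have "\<dots> = fps_X * (E - 1) - fps_X * fps_X * E"
      unfolding B by (simp add: mult_ac)
    also have "\<dots> = (bern_egf * (E - 1)) * (E - 1) - (bern_egf * (E - 1)) ^ 2 - fps_X * (bern_egf * (E - 1)) * (E - 1)"
      unfolding B by (simp add: algebra_simps power2_eq_square)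
    finally show ?thesis by (simp add: algebra_simps power2_eq_square)
  qed
  then have eq: "fps_X * fps_deriv bern_egf = bern_egf - bern_egf ^ 2 - fps_X * bern_egf"
    using fps_exp_1_neq unfolding E_def mult_cancel_right by blast
  have on: "odd (n - 1)" "n - 1 \<noteq> 1" using assms by auto
  then have "bern (n - 1) = 0" by (rule bern_odd)
  moreover have "(fps_X * fps_deriv bern_egf) $ n = of_nat n * (bern n / fact n)"
    using assms by (cases n) (auto simp: bern_egf_def)
  moreover have "(fps_X * bern_egf) $ n = bern (n - 1) / fact (n - 1)"
    using assms by (cases n) (auto simp: bern_egf_def)
  ultimately have "of_nat n * (bern n / fact n) = bern n / fact n - (bern_egf ^ 2) $ n"
    using arg_cong [OF eq, of "\<lambda>f. f $ n"] by (simp add: bern_egf_def)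
  moreover have "(bern_egf ^ 2) $ n = (\<Sum>i\<le>n. bern i / fact i * (bern (n - i) / fact (n - i)))"
    by (simp add: power2_eq_square fps_mult_nth atLeast0AtMost bern_egf_def)
  moreover have "\<dots> = (\<Sum>i\<le>n. of_nat (n choose i) * bern i * bern (n - i)) / fact n"
    unfolding sum_divide_distrib by (rule sum.cong) (auto simp: binomial_fact field_simps)
  ultimately have "of_nat n * bern n = bern n - (\<Sum>i\<le>n. of_nat (n choose i) * bern i * bern (n - i))"
    by (simp add: field_simps)
  moreover have "(\<Sum>i\<le>n. of_nat (n choose i) * bern i * bern (n - i))
     = (\<Sum>i\<in>{0,n} \<union> {j. even j \<and> 2 \<le> j \<and> j \<le> n - 2}. of_nat (n choose i) * bern i * bern (n - i))"
  proof (rule sum.mono_neutral_right, goal_cases)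
    case 3
    show ?case
    proof
      fix i assume i: "i \<in> {..n} - ({0, n} \<union> {j. even j \<and> 2 \<le> j \<and> j \<le> n - 2})"
      have "odd i \<and> odd (n - i) \<and> (i \<noteq> 1 \<or> n - i \<noteq> 1)"
      proof -
        have "odd i"
        proof
          assume e: "even i"
          then have "even (n - i)" using assms by simp
          have "i \<noteq> 0" "n - i \<noteq> 0" using i by auto
          then have "i \<ge> 2" "n - i \<ge> 2" using e \<open>even (n - i)\<close>
            by (auto elim!: evenE)
          then show False using i e by auto
        qed
        then show ?thesis using assms i by auto
      qed
      then show "of_nat (n choose i) * bern i * bern (n - i) = 0"
        using bern_odd by fastforce
    qed
  qed (use assms in auto)
  moreover have "\<dots> = 2 * bern n + (\<Sum>i\<in>{j. even j \<and> 2 \<le> j \<and> j \<le> n - 2}. of_nat (n choose i) * bern i * bern (n - i))"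
    by (subst sum.union_disjoint) (use assms in auto)
  ultimately show ?thesis by algebra
qed

lemma bern_2: "bern 2 = 1/6"
proof -
  have "6 * bern 2 = 1"
    using bern_rec [of 2] by (simp add: numeral_2_eq_2 bern_1 [unfolded One_nat_def] eq_neg_iff_add_eq_0)
  then show ?thesis by (simp add: eq_divide_eq mult.commute)
qed

lemma bern_4: "bern 4 = -1/30"
proof -
  have [simp]: "{j. even j \<and> 2 \<le> j \<and> j \<le> (2::nat)} = {2}" by auto
  show ?thesis
    using euler_bern [of 4] by (simp add: bern_2 field_simps binomial_fact fact_numeral eq_neg_iff_add_eq_0)
qed

lemma bern_6: "bern 6 = 1/42"
proof -
  have [simp]: "{j. even j \<and> 2 \<le> j \<and> j \<le> (4::nat)} = {2, 4}"
    unfolding set_eq_iff mem_Collect_eq insert_iff empty_iff by presburger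
  show ?thesis
    using euler_bern [of 6] by (simp add: bern_2 bern_4 field_simps binomial_fact fact_numeral eq_neg_iff_add_eq_0)
qed

lemma bern_8: "bern 8 = -1/30"
proof -
  have [simp]: "{j. even j \<and> 2 \<le> j \<and> j \<le> (6::nat)} = {2, 4, 6}"
    unfolding set_eq_iff mem_Collect_eq insert_iff empty_iff by presburger
  have "3 + bern 8 * 90 = 0"
    using euler_bern [of 8] by (simp add: bern_2 bern_4 bern_6 field_simps binomial_fact fact_numeral eq_neg_iff_add_eq_0)
  then have "3 * (30 * bern 8) = 3 * (- 1)"
    by (simp add: eq_neg_iff_add_eq_0 add.commute mult.commute)
  then have "30 * bern 8 = - 1"
    by (metis mult_left_cancel zero_neq_numeral)
  then show ?thesis by (simp add: field_simps)
qed

section \<open>Divisor-sum convolutions\<close>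

definition sols :: "nat \<Rightarrow> (nat \<times> nat \<times> nat \<times> nat) set" where
  "sols n = {(a, b, x, y). 0 < a \<and> 0 < b \<and> 0 < x \<and> 0 < y \<and> a * x + b * y = n}"

lemma finite_sols [simp]: "finite (sols n)"
proof (rule finite_subset)
  show "sols n \<subseteq> {..n} \<times> {..n} \<times> {..n} \<times> {..n}"
    unfolding sols_def
    by (auto intro: order_trans [OF _ le_add1] order_trans [OF _ le_add2])
qed simp

lemma sum_sols_swap:
  fixes p :: "nat \<Rightarrow> nat \<Rightarrow> complex"
  assumes "\<And>a b. p a b = p b a" and "\<And>a b x y. P (a, b, x, y) = Q (b, a, y, x)"
  shows "(\<Sum>(a, b, x, y) \<in> {s \<in> sols n. P s}. p a b) = (\<Sum>(a, b, x, y) \<in> {s \<in> sols n. Q s}. p a b)"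
  by (rule sum.reindex_bij_witness [where i = "\<lambda>(a, b, x, y). (b, a, y, x)" and j = "\<lambda>(a, b, x, y). (b, a, y, x)"])
    (use assms in \<open>auto simp: sols_def add.commute\<close>)

lemma sum_sols_shear:
  fixes p q :: "nat \<Rightarrow> nat \<Rightarrow> complex"
  assumes "\<And>a b. a > 0 \<Longrightarrow> b > 0 \<Longrightarrow> q (a + b) b = p a b"
  shows "(\<Sum>(a, b, x, y) \<in> {s \<in> sols n. case s of (a, b, x, y) \<Rightarrow> x < y}. p a b)
    = (\<Sum>(a, b, x, y) \<in> {s \<in> sols n. case s of (a, b, x, y) \<Rightarrow> b < a}. q a b)"
proof -
  have 1: "(a - b) * x + b * (y + x) = a * x + b * y" if "b < a" for a b x y :: nat
  proof -
    from that obtain c where "a = b + c" using less_imp_add_positive by blast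
    then show ?thesis by (simp add: algebra_simps)
  qed
  have 2: "(a + b) * x + b * (y - x) = a * x + b * y" if "x < y" for a b x y :: nat
  proof -
    from that obtain c where "y = x + c" using less_imp_add_positive by blast
    then show ?thesis by (simp add: algebra_simps)
  qed
  show ?thesis
    by (rule sum.reindex_bij_witness
        [where i = "\<lambda>(a, b, x, y). (a - b, b, x, y + x)" and j = "\<lambda>(a, b, x, y). (a + b, b, x, y - x)"])
      (use assms in \<open>auto simp: sols_def 1 2\<close>)
qed

lemma sum_trichotomy:
  fixes f :: "_ \<Rightarrow> complex" and u v :: "_ \<Rightarrow> nat"
  assumes "finite A"
  shows "(\<Sum>s\<in>A. f s) = (\<Sum>s\<in>{s \<in> A. u s < v s}. f s) + (\<Sum>s\<in>{s \<in> A. v s < u s}. f s)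
      + (\<Sum>s\<in>{s \<in> A. u s = v s}. f s)"
proof -
  have *: "A = {s \<in> A. u s < v s} \<union> {s \<in> A. v s < u s} \<union> {s \<in> A. u s = v s}" by auto
  show ?thesis
    by (subst *, subst sum.union_disjoint, use assms in force, use assms in force, force,
        subst sum.union_disjoint) (use assms in auto)
qed

text \<open>The shear \<open>(a, b, x, y) \<mapsto> (a + b, b, x, y - x)\<close> exchanges the regions \<open>x < y\<close> and
  \<open>b < a\<close>; by symmetry of \<open>p\<close> and \<open>q\<close> only the diagonals \<open>x = y\<close> and \<open>a = b\<close> survive.\<close>
lemma liouville:
  fixes p q :: "nat \<Rightarrow> nat \<Rightarrow> complex"
  assumes p: "\<And>a b. p a b = p b a" and q: "\<And>a b. q a b = q b a"
    and pq: "\<And>a b. a > 0 \<Longrightarrow> b > 0 \<Longrightarrow> q (a + b) b = p a b"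
  shows "(\<Sum>(a, b, x, y)\<in>sols n. p a b - q a b)
     = (\<Sum>(a, b, x, y)\<in>{s \<in> sols n. case s of (a, b, x, y) \<Rightarrow> x = y}. p a b)
     - (\<Sum>(a, b, x, y)\<in>{s \<in> sols n. case s of (a, b, x, y) \<Rightarrow> a = b}. q a b)"
proof -
  have "(\<Sum>(a, b, x, y)\<in>sols n. p a b)
    = 2 * (\<Sum>(a, b, x, y)\<in>{s \<in> sols n. case s of (a, b, x, y) \<Rightarrow> x < y}. p a b)
    + (\<Sum>(a, b, x, y)\<in>{s \<in> sols n. case s of (a, b, x, y) \<Rightarrow> x = y}. p a b)"
    using sum_trichotomy [of "sols n" "\<lambda>(a, b, x, y). p a b" "\<lambda>(a, b, x, y). x" "\<lambda>(a, b, x, y). y"]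
      sum_sols_swap [of p "\<lambda>(a, b, x, y). x < y" "\<lambda>(a, b, x, y). y < x" n] p
    by (simp add: case_prod_beta')
  moreover have "(\<Sum>(a, b, x, y)\<in>sols n. q a b)
    = 2 * (\<Sum>(a, b, x, y)\<in>{s \<in> sols n. case s of (a, b, x, y) \<Rightarrow> b < a}. q a b)
    + (\<Sum>(a, b, x, y)\<in>{s \<in> sols n. case s of (a, b, x, y) \<Rightarrow> a = b}. q a b)"
    using sum_trichotomy [of "sols n" "\<lambda>(a, b, x, y). q a b" "\<lambda>(a, b, x, y). a" "\<lambda>(a, b, x, y). b"]
      sum_sols_swap [of q "\<lambda>(a, b, x, y). b < a" "\<lambda>(a, b, x, y). a < b" n] q
    by (simp add: case_prod_beta')
  ultimately show ?thesis
    using sum_sols_shear [of q p n] pq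
    by (simp add: case_prod_beta' sum_subtractf)
qed

section \<open>Divisor sums and their products\<close>

definition divs :: "nat \<Rightarrow> (nat \<times> nat) set" where
  "divs n = {(m, i). 0 < m \<and> 0 < i \<and> m * i = n}"

lemma finite_divs [simp]: "finite (divs n)"
  by (rule finite_subset [of _ "{..n} \<times> {..n}"]) (auto simp: divs_def)

lemma divs_0 [simp]: "divs 0 = {}"
  by (auto simp: divs_def)

definition dsum :: "nat \<Rightarrow> nat \<Rightarrow> complex fps" where
  "dsum k j = Abs_fps (\<lambda>n. \<Sum>(m, i)\<in>divs n. of_nat m ^ k * of_nat i ^ j)"

lemma qD_nth: "qD f $ n = of_nat n * f $ n"
  by (cases n) (simp_all add: qD_def)

lemma qD_dsum: "qD (dsum k j) = dsum (Suc k) (Suc j)"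
  by (rule fps_ext)
    (auto simp: qD_nth dsum_def sum_distrib_left divs_def intro!: sum.cong)

lemma dsum_commute: "dsum k j = dsum j k"
  unfolding dsum_def
  by (rule arg_cong [of _ _ Abs_fps], rule ext)
    (rule sum.reindex_bij_witness [where i = prod.swap and j = prod.swap],
      auto simp: divs_def mult.commute)

lemma eisenstein_dsum:
  assumes "k > 0"
  shows "eisenstein k = fps_const (- bern k / (2 * of_nat k)) + dsum (k - 1) 0"
proof (rule fps_ext)
  fix n
  show "eisenstein k $ n = (fps_const (- bern k / (2 * of_nat k)) + dsum (k - 1) 0) $ n"
  proof (cases "n = 0")
    case False
    have "(\<Sum>d\<in>{d \<in> {1..n}. d dvd n}. of_nat d ^ (k - 1) :: complex)
        = (\<Sum>(m, i)\<in>divs n. of_nat m ^ (k - 1) * of_nat i ^ 0)"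
      by (rule sum.reindex_bij_witness [where i = fst and j = "\<lambda>d. (d, n div d)"])
        (use False in \<open>auto simp: divs_def dvd_imp_le intro: Nat.gr0I\<close>)
    then show ?thesis using False by (simp add: eisenstein_def dsum_def bern_def)
  qed (simp add: eisenstein_def dsum_def bern_def)
qed

lemma dsum_mult_nth:
  "(dsum i 0 * dsum j 0) $ n = (\<Sum>(a, b, x, y)\<in>sols n. of_nat a ^ i * of_nat b ^ j)"
proof -
  have "(dsum i 0 * dsum j 0) $ n
      = (\<Sum>s\<in>{0..n}. \<Sum>(u, v)\<in>divs s \<times> divs (n - s). of_nat (fst u) ^ i * of_nat (fst v) ^ j)"
    by (simp add: fps_mult_nth dsum_def sum_product case_prod_beta' sum.cartesian_product)
  also have "\<dots> = (\<Sum>(s, u, v)\<in>Sigma {0..n} (\<lambda>s. divs s \<times> divs (n - s)). of_nat (fst u) ^ i * of_nat (fst v) ^ j)"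
    by (subst sum.Sigma) auto
  also have "\<dots> = (\<Sum>(a, b, x, y)\<in>sols n. of_nat a ^ i * of_nat b ^ j)"
    by (rule sum.reindex_bij_witness
      [where i = "\<lambda>(a, b, x, y). (a * x, (a, x), (b, y))" and j = "\<lambda>(s, (a, x), (b, y)). (a, b, x, y)"])
      (auto simp: divs_def sols_def)
  finally show ?thesis .
qed

text \<open>On \<open>x = y\<close> the equation reads \<open>(a + b) * x = n\<close>: a
  factorization \<open>d * x = n\<close> together with a splitting of \<open>d\<close>.\<close>

lemma sum_sols_eq_right:
  fixes p :: "nat \<Rightarrow> nat \<Rightarrow> complex"
  shows "(\<Sum>(a, b, x, y)\<in>{s \<in> sols n. case s of (a, b, x, y) \<Rightarrow> x = y}. p a b)
    = (\<Sum>(d, x)\<in>divs n. \<Sum>a\<in>{1..<d}. p a (d - a))"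
proof -
  have "(\<Sum>(d, x)\<in>divs n. \<Sum>a\<in>{1..<d}. p a (d - a))
     = (\<Sum>((d, x), a)\<in>Sigma (divs n) (\<lambda>(d, x). {1..<d}). p a (d - a))"
    by (subst sum.Sigma [symmetric]) (auto simp: case_prod_beta')
  also have "\<dots> = (\<Sum>(a, b, x, y)\<in>{s \<in> sols n. case s of (a, b, x, y) \<Rightarrow> x = y}. p a b)"
    by (rule sum.reindex_bij_witness
      [where i = "\<lambda>(a, b, x, y). ((a + b, x), a)" and j = "\<lambda>((d, x), a). (a, d - a, x, x)"])
      (auto simp: divs_def sols_def simp flip: distrib_right)
  finally show ?thesis by simp
qed

text \<open>On \<open>a = b\<close> the equation reads \<open>a * (x + y) = n\<close>; the weight
  \<open>c - 1\<close> counts the splittings of \<open>c = x + y\<close> into two positive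
  summands.\<close>

lemma sum_sols_eq_left:
  fixes q :: "nat \<Rightarrow> nat \<Rightarrow> complex"
  shows "(\<Sum>(a, b, x, y)\<in>{s \<in> sols n. case s of (a, b, x, y) \<Rightarrow> a = b}. q a b)
    = (\<Sum>(a, c)\<in>divs n. (of_nat c - 1) * q a a)"
proof -
  have "(\<Sum>(a, c)\<in>divs n. (of_nat c - 1) * q a a) = (\<Sum>(a, c)\<in>divs n. \<Sum>x\<in>{1..<c}. q a a)"
    by (rule sum.cong) (auto simp: divs_def of_nat_diff)
  also have "\<dots> = (\<Sum>((a, c), x)\<in>Sigma (divs n) (\<lambda>(a, c). {1..<c}). q a a)"
    by (subst sum.Sigma [symmetric]) (auto simp: case_prod_beta')
  also have "\<dots> = (\<Sum>(a, b, x, y)\<in>{s \<in> sols n. case s of (a, b, x, y) \<Rightarrow> a = b}. q a b)"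
    by (rule sum.reindex_bij_witness
      [where i = "\<lambda>(a, b, x, y). ((a, x + y), x)" and j = "\<lambda>((a, c), x). (a, a, x, c - x)"])
      (auto simp: divs_def sols_def simp flip: distrib_left)
  finally show ?thesis by simp
qed

section \<open>Quadratic relations between Eisenstein series\<close>

lemma eisenstein_4_square: "120 * eisenstein 4 ^ 2 = eisenstein 8"
proof -
  have "4 * (dsum 3 0 * dsum 3 0) $ n = (dsum 7 0 $ n - dsum 3 0 $ n) / 30" for n
  proof -
    \<comment> \<open>Chosen so that \<open>q (a + b) b = p a b\<close> and
      \<open>p a b - q a b = 4 a^3 b^3\<close>; moreover \<open>q\<close> vanishes on
      \<open>a = b\<close>, so that only the diagonal \<open>x = y\<close> contributes.\<close>
    define p q :: "nat \<Rightarrow> nat \<Rightarrow> complex"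
      where "p a b = of_nat a ^ 2 * of_nat b ^ 2 * (of_nat a + of_nat b) ^ 2"
        and "q a b = of_nat a ^ 2 * of_nat b ^ 2 * (of_nat a - of_nat b) ^ 2" for a b
    have "4 * (dsum 3 0 * dsum 3 0) $ n = (\<Sum>(a, b, x, y)\<in>sols n. p a b - q a b)"
      unfolding dsum_mult_nth sum_distrib_left
      by (rule sum.cong) (auto simp: p_def q_def algebra_simps power2_eq_square power3_eq_cube)
    also have "\<dots> = (\<Sum>(d, x)\<in>divs n. \<Sum>a\<in>{1..<d}. p a (d - a))
        - (\<Sum>(a, c)\<in>divs n. (of_nat c - 1) * q a a)"
      by (subst liouville, unfold sum_sols_eq_left sum_sols_eq_right)
         (auto simp: p_def q_def algebra_simps power2_eq_square)
    also have "\<dots> = (\<Sum>(d, x)\<in>divs n. \<Sum>a\<in>{1..<d}. p a (d - a))"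
      by (simp add: q_def)
    also have "\<dots> = (\<Sum>(d, x)\<in>divs n. (of_nat d ^ 7 - of_nat d ^ 3) / 30)"
    proof (rule sum.cong [OF refl], clarify)
      fix d x assume "(d, x) \<in> divs n"
      \<comment> \<open>The summand depends on \<open>d\<close>, so the upper bound is freed to
        \<open>m\<close> for the induction. The right-hand side combines the closed forms for sums
        of squares, cubes and fourth powers.\<close>
      have g: "(\<Sum>a\<in>{1..<m}. of_nat a ^ 2 * (of_nat d - of_nat a) ^ 2 * of_nat d ^ 2 :: complex)
        = of_nat d ^ 2 * (of_nat d ^ 2 * (of_nat m * (of_nat m - 1) * (2 * of_nat m - 1) / 6)
          - 2 * of_nat d * ((of_nat m * (of_nat m - 1) / 2) ^ 2)
          + (of_nat m - 1) * of_nat m * (2 * of_nat m - 1) * (3 * (of_nat m - 1) ^ 2 + 3 * (of_nat m - 1) - 1) / 30)"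
        (is "?s m = ?r m") for m
      proof (induction m)
        case (Suc m)
        show ?case
        proof (cases "m = 0")
          case False
          then have "?s (Suc m) = ?s m + of_nat m ^ 2 * (of_nat d - of_nat m) ^ 2 * of_nat d ^ 2"
            by simp
          then show ?thesis unfolding Suc by (simp add: field_simps power2_eq_square)
        qed simp
      qed simp
      have "(\<Sum>a\<in>{1..<d}. p a (d - a)) = ?s d"
        by (rule sum.cong) (auto simp: p_def of_nat_diff)
      also have "\<dots> = (of_nat d ^ 7 - of_nat d ^ 3) / 30"
        unfolding g by (simp add: field_simps eval_nat_numeral)
      finally show "(\<Sum>a\<in>{1..<d}. p a (d - a)) = (of_nat d ^ 7 - of_nat d ^ 3) / 30" .
    qed
    also have "\<dots> = (dsum 7 0 $ n - dsum 3 0 $ n) / 30"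
      by (simp add: dsum_def case_prod_beta' sum_subtractf sum_divide_distrib diff_divide_distrib)
    finally show ?thesis .
  qed
  then have "fps_const 4 * (dsum 3 0 * dsum 3 0) = fps_const (1/30) * (dsum 7 0 - dsum 3 0)"
    by (intro fps_ext) simp
  moreover have "120 * dsum 3 0 ^ 2 = fps_const 30 * (fps_const 4 * (dsum 3 0 * dsum 3 0))"
    by (simp add: power2_eq_square numeral_fps_const flip: mult.assoc)
  ultimately have "120 * dsum 3 0 ^ 2 = fps_const 30 * (fps_const (1/30) * (dsum 7 0 - dsum 3 0))"
    by simp
  also have "\<dots> = dsum 7 0 - dsum 3 0"
    by (simp flip: mult.assoc)
  finally have *: "120 * dsum 3 0 ^ 2 = dsum 7 0 - dsum 3 0" .
  \<comment> \<open>The constant terms of \<open>G_4\<close> and \<open>G_8\<close> are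
    \<open>1/240\<close> and \<open>1/480 = 120 / 240^2\<close>; the mixed term of the square is
    exactly the \<open>dsum 3 0\<close> that cancels the one in the divisor-sum identity.\<close>
  have "120 * (fps_const (1/240) + dsum 3 0) ^ 2
    = 120 * fps_const (1/240) ^ 2 + 120 * dsum 3 0 ^ 2 + 240 * fps_const (1/240) * dsum 3 0"
    by (simp add: power2_sum distrib_left)
  also have "\<dots> = fps_const (1/480) + dsum 7 0"
    unfolding * by (simp add: numeral_fps_const power2_eq_square)
  finally show ?thesis
    by (simp add: eisenstein_dsum bern_4 bern_8)
qed

lemma odd_binomial_difference:
  fixes a b :: complex
  assumes "even K"
  shows "(a + b) ^ K - (a - b) ^ K = 2 * (\<Sum>i | odd i \<and> i < K. of_nat (K choose i) * a ^ i * b ^ (K - i))"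
proof -
  have "(a - b) ^ K = (b + - a) ^ K"
    using assms by (metis minus_diff_eq power_minus_even add.commute uminus_add_conv_diff)
  then have "(a + b) ^ K - (a - b) ^ K
      = (\<Sum>i\<le>K. of_nat (K choose i) * a ^ i * b ^ (K - i) - of_nat (K choose i) * (- a) ^ i * b ^ (K - i))"
    using binomial_ring [of a b K] binomial_ring [of "- a" b K] by (simp add: sum_subtractf add.commute)
  also have "\<dots> = (\<Sum>i | odd i \<and> i < K. 2 * (of_nat (K choose i) * a ^ i * b ^ (K - i)))"
    by (rule sum.mono_neutral_cong_right) (use assms in \<open>auto simp: power_minus_odd le_less\<close>)
  finally show ?thesis by (simp add: sum_distrib_left)
qed

lemma of_nat_plus_1_neq: "of_nat n + 1 \<noteq> (0 :: complex)"
  by (metis Suc_eq_plus1 of_nat_1 of_nat_add of_nat_eq_0_iff Zero_not_Suc)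

text \<open>For even \<open>K\<close> only \<open>bern 0\<close>, \<open>bern 1\<close> and the even
  indices survive in \<open>faulhaber_sum\<close>; \<open>bern 1 = -1/2\<close> is the source of the
  last term. The factor 2 anticipates a sum over both \<open>a\<close> and
  \<open>d - a\<close>.\<close>

lemma faulhaber_even:
  assumes "even K" "K \<ge> 2"
  shows "2 * (\<Sum>a\<in>{1..<d}. of_nat a ^ K) = (2 * of_nat d ^ (K + 1)
     + 2 * (\<Sum>j | even j \<and> 2 \<le> j \<and> j \<le> K. of_nat (K + 1 choose j) * bern j * of_nat d ^ (K + 1 - j)))
       / (of_nat K + 1) - (of_nat d ^ K :: complex)"
proof -
  have "(\<Sum>a\<in>{1..<d}. of_nat a ^ K :: complex) = (\<Sum>a<d. of_nat a ^ K)"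
    by (rule sum.mono_neutral_left) (use assms in \<open>auto simp: power_0_left Suc_le_eq\<close>)
  moreover have "(\<Sum>j\<le>K. of_nat (Suc K choose j) * bern j * of_nat d ^ (Suc K - j))
     = (\<Sum>j\<in>{0,1} \<union> {j. even j \<and> 2 \<le> j \<and> j \<le> K}. of_nat (Suc K choose j) * bern j * of_nat d ^ (Suc K - j))"
    by (rule sum.mono_neutral_right) (use assms bern_odd in \<open>auto simp: not_le less_2_cases_iff\<close>)
  moreover have "\<dots> = of_nat d ^ (K + 1) - (of_nat K + 1) * of_nat d ^ K / 2
     + (\<Sum>j | even j \<and> 2 \<le> j \<and> j \<le> K. of_nat (K + 1 choose j) * bern j * of_nat d ^ (K + 1 - j))"
    by (subst sum.union_disjoint) (use bern_1 in auto)
  ultimately have "(\<Sum>a\<in>{1..<d}. of_nat a ^ K :: complex)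
      = (of_nat d ^ (K + 1) - (of_nat K + 1) * of_nat d ^ K / 2
     + (\<Sum>j | even j \<and> 2 \<le> j \<and> j \<le> K. of_nat (K + 1 choose j) * bern j * of_nat d ^ (K + 1 - j))) / (of_nat K + 1)"
    by (simp only: faulhaber_sum of_nat_Suc add.commute)
  moreover have "2 * X = (2 * D + 2 * S) / N - Dk" if "X = (D - N * Dk / 2 + S) / N" "N \<noteq> 0" for X D S N Dk :: complex
    unfolding that(1) using that(2) by (simp add: field_simps)
  ultimately show ?thesis
    using of_nat_plus_1_neq [of K] by blast
qed

text \<open>In Liouville's identity the Bernoulli sum comes from the diagonal \<open>x = y\<close>
  through Faulhaber's formula, and \<open>dsum K 1\<close> from the weight \<open>c - 1\<close> on
  the diagonal \<open>a = b\<close>.\<close>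

lemma sigma_convolution:
  assumes "even K" "K \<ge> 2"
  shows "fps_const 2 * (\<Sum>i | odd i \<and> i < K. fps_const (of_nat (K choose i)) * (dsum i 0 * dsum (K - i) 0))
    = fps_const ((of_nat K + 3) / (of_nat K + 1)) * dsum (K + 1) 0 - fps_const 2 * dsum K 1
      + fps_const (2 / (of_nat K + 1))
        * (\<Sum>j | even j \<and> 2 \<le> j \<and> j \<le> K. fps_const (of_nat (K + 1 choose j) * bern j) * dsum (K + 1 - j) 0)"
proof (rule fps_ext)
  fix n
  \<comment> \<open>The odd part of the binomial expansion is \<open>(a + b)^K - (a - b)^K\<close>.
    Adding \<open>a^K + b^K\<close> to both terms leaves the difference unchanged and makes
    \<open>q (a + b) b = p a b\<close> hold.\<close>
  define p q :: "nat \<Rightarrow> nat \<Rightarrow> complex"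
    where "p a b = of_nat a ^ K + of_nat b ^ K + (of_nat a + of_nat b) ^ K"
      and "q a b = of_nat a ^ K + of_nat b ^ K + (of_nat a - of_nat b) ^ K" for a b
  have sw: "(x - y) ^ K = (y - x) ^ K" for x y :: complex
    using assms(1) by (metis minus_diff_eq power_minus_even)
  have "(fps_const 2 * (\<Sum>i | odd i \<and> i < K. fps_const (of_nat (K choose i)) * (dsum i 0 * dsum (K - i) 0))) $ n
    = 2 * (\<Sum>i | odd i \<and> i < K. of_nat (K choose i) * (\<Sum>(a, b, x, y)\<in>sols n. of_nat a ^ i * of_nat b ^ (K - i)))"
    by (simp add: fps_sum_nth dsum_mult_nth)
  also have "\<dots> = (\<Sum>(a, b, x, y)\<in>sols n. 2 * (\<Sum>i | odd i \<and> i < K. of_nat (K choose i) * of_nat a ^ i * of_nat b ^ (K - i)))"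
    unfolding sum_distrib_left by (subst sum.swap) (simp add: case_prod_beta' mult.assoc)
  also have "\<dots> = (\<Sum>(a, b, x, y)\<in>sols n. p a b - q a b)"
    unfolding odd_binomial_difference [OF assms(1), symmetric] by (simp add: p_def q_def)
  also have "\<dots> = (\<Sum>(d, x)\<in>divs n. \<Sum>a\<in>{1..<d}. p a (d - a))
        - (\<Sum>(a, c)\<in>divs n. (of_nat c - 1) * q a a)"
    by (subst liouville, unfold sum_sols_eq_left sum_sols_eq_right)
      (auto simp: p_def q_def sw add_ac)
  also have "\<dots> = (\<Sum>(d, x)\<in>divs n. (\<Sum>a\<in>{1..<d}. p a (d - a)) - (of_nat x - 1) * q d d)"
    by (simp add: sum_subtractf case_prod_beta')
  also have "\<dots> = (\<Sum>(d, x)\<in>divs n. (of_nat K + 3) / (of_nat K + 1) * of_nat d ^ (K + 1) - 2 * (of_nat d ^ K * of_nat x)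
      + 2 / (of_nat K + 1) * (\<Sum>j | even j \<and> 2 \<le> j \<and> j \<le> K. of_nat (K + 1 choose j) * bern j * of_nat d ^ (K + 1 - j)))"
  proof (rule sum.cong [OF refl], clarify)
    fix d x assume "(d, x) \<in> divs n"
    then have d: "d > 0" by (simp add: divs_def)
    have "(\<Sum>a\<in>{1..<d}. p a (d - a)) = (\<Sum>a\<in>{1..<d}. of_nat a ^ K) + (\<Sum>a\<in>{1..<d}. of_nat (d - a) ^ K)
        + (\<Sum>a\<in>{1..<d}. of_nat d ^ K)"
      unfolding sum.distrib [symmetric] by (rule sum.cong) (auto simp: p_def of_nat_diff)
    also have "(\<Sum>a\<in>{1..<d}. of_nat (d - a) ^ K :: complex) = (\<Sum>a\<in>{1..<d}. of_nat a ^ K)"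
      by (rule sum.reindex_bij_witness [where i = "\<lambda>a. d - a" and j = "\<lambda>a. d - a"]) auto
    also have "(\<Sum>a\<in>{1..<d}. of_nat d ^ K :: complex) = of_nat d ^ (K + 1) - of_nat d ^ K"
      using d by (simp add: of_nat_diff algebra_simps)
    finally have *: "(\<Sum>a\<in>{1..<d}. p a (d - a)) = 2 * (\<Sum>a\<in>{1..<d}. of_nat a ^ K) + (of_nat d ^ (K + 1) - of_nat d ^ K)"
      by simp
    have "q d d = 2 * of_nat d ^ K" using assms by (simp add: q_def)
    moreover have "((2 * D1 + 2 * S) / N - Dk) + (D1 - Dk) - (z - 1) * (2 * Dk)
        = (N + 2) / N * D1 - 2 * (Dk * z) + 2 / N * S" if "N \<noteq> 0" for D1 Dk S N z :: complex
      using that by (simp add: field_simps)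
    note this [OF of_nat_plus_1_neq [of K]]
    ultimately show "(\<Sum>a\<in>{1..<d}. p a (d - a)) - (of_nat x - 1) * q d d =
      (of_nat K + 3) / (of_nat K + 1) * of_nat d ^ (K + 1) - 2 * (of_nat d ^ K * of_nat x)
      + 2 / (of_nat K + 1) * (\<Sum>j | even j \<and> 2 \<le> j \<and> j \<le> K. of_nat (K + 1 choose j) * bern j * of_nat d ^ (K + 1 - j))"
      unfolding * faulhaber_even [OF assms] by (simp add: add.assoc)
  qed
  also have "\<dots> = (fps_const ((of_nat K + 3) / (of_nat K + 1)) * dsum (K + 1) 0 - fps_const 2 * dsum K 1
      + fps_const (2 / (of_nat K + 1))
        * (\<Sum>j | even j \<and> 2 \<le> j \<and> j \<le> K. fps_const (of_nat (K + 1 choose j) * bern j) * dsum (K + 1 - j) 0)) $ n"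
    by (simp add: dsum_def fps_sum_nth sum.distrib sum_subtractf case_prod_beta' sum_distrib_left mult.assoc)
      (rule sum.swap)
  finally show "(fps_const 2 * (\<Sum>i | odd i \<and> i < K. fps_const (of_nat (K choose i)) * (dsum i 0 * dsum (K - i) 0))) $ n
    = \<dots>" .
qed

definition eis_const :: "nat \<Rightarrow> complex" where
  "eis_const k = - bern k / (2 * of_nat k)"

text \<open>Euler's identity at \<open>n = K + 2\<close>, reindexed by \<open>j = i + 1\<close>; the
  binomials are matched by \<open>(K + 2) (K + 1) C(K, j - 1) = j (K + 2 - j) C(K + 2, j)\<close>.
  It accounts for the constant terms in \<open>eisenstein_convolution\<close>.\<close>

lemma euler_eis_const:
  assumes "even K" "K \<ge> 2"
  shows "2 * (\<Sum>i | odd i \<and> i < K. of_nat (K choose i) * (eis_const (i + 1) * eis_const (K + 1 - i)))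
    = (of_nat K + 3) / (of_nat K + 1) * eis_const (K + 2)"
proof -
  have "(\<Sum>i | odd i \<and> i < K. of_nat (K choose i) * (eis_const (i + 1) * eis_const (K + 1 - i)))
    = (\<Sum>j | even j \<and> 2 \<le> j \<and> j \<le> K + 2 - 2. of_nat (K choose (j - 1)) * (eis_const j * eis_const (K + 2 - j)))"
    by (rule sum.reindex_bij_witness [where i = "\<lambda>j. j - 1" and j = Suc]) (use assms in \<open>auto elim: oddE evenE\<close>)
  also have "\<dots> = (\<Sum>j | even j \<and> 2 \<le> j \<and> j \<le> K + 2 - 2. of_nat (K + 2 choose j) * bern j * bern (K + 2 - j))
      / (4 * of_nat (K + 1) * of_nat (K + 2))"
    unfolding sum_divide_distrib
  proof (rule sum.cong [OF refl], clarify)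
    fix j assume j: "even j" "2 \<le> j" "j \<le> K + 2 - 2"
    show "of_nat (K choose (j - 1)) * (eis_const j * eis_const (K + 2 - j))
      = of_nat (K + 2 choose j) * bern j * bern (K + 2 - j) / (4 * of_nat (K + 1) * of_nat (K + 2))"
    proof -
      have "Suc K * (K choose (j - 1)) = (Suc K choose j) * j"
        using Suc_times_binomial_eq [of K "j - 1"] j by simp
      moreover have "(K + 2 - j) * (K + 2 choose j) = (K + 2) * (Suc K choose j)"
        using binomial_absorb_comp [of "K + 2" j] by simp
      ultimately have "(K + 2) * (Suc K * (K choose (j - 1))) = (K + 2 - j) * (K + 2 choose j) * j"
        by (metis mult.assoc)
      then have "of_nat (K + 2) * (of_nat (K + 1) * of_nat (K choose (j - 1)))
          = of_nat (K + 2 - j) * of_nat (K + 2 choose j) * (of_nat j :: complex)"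
        by (metis Suc_eq_plus1 of_nat_mult)
      moreover have "c * (- B / (2 * u) * (- B' / (2 * v))) = e * B * B' / (4 * M * N)"
        if "N * (M * c) = v * e * u" "N \<noteq> 0" "M \<noteq> 0" "u \<noteq> 0" "v \<noteq> 0" for B B' M N c e u v :: complex
      proof -
        have c: "c = v * e * u / (N * M)" using that by (simp add: field_simps)
        show ?thesis unfolding c using that by (simp add: field_simps)
      qed
      moreover have "of_nat (K + 2) \<noteq> (0::complex)" "of_nat (K + 1) \<noteq> (0::complex)"
        "of_nat j \<noteq> (0::complex)" "of_nat (K + 2 - j) \<noteq> (0::complex)"
        using j by (simp_all only: of_nat_eq_0_iff)
      ultimately show ?thesis
        unfolding eis_const_def by blast
    qed
  qed
  also have "\<dots> = - ((of_nat (K + 2) + 1) * bern (K + 2)) / (4 * of_nat (K + 1) * of_nat (K + 2))"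
    using euler_bern [of "K + 2"] assms by simp
  finally have *: "(\<Sum>i | odd i \<and> i < K. of_nat (K choose i) * (eis_const (i + 1) * eis_const (K + 1 - i)))
    = - ((of_nat (K + 2) + 1) * bern (K + 2)) / (4 * of_nat (K + 1) * of_nat (K + 2))" .
  have "2 * (- (z * B) / (4 * M * N)) = z / M * (- B / (2 * N))"
    if "M \<noteq> 0" "N \<noteq> 0" for M N B z :: complex
    using that by (simp add: field_simps)
  moreover have "of_nat (K + 2) + 1 = (of_nat K + 3 :: complex)" "of_nat (K + 1) = (of_nat K + 1 :: complex)"
    by simp_all
  ultimately show ?thesis
    unfolding * using of_nat_neq_0 [of "Suc K"] of_nat_plus_1_neq [of K]
    by (simp only: eis_const_def add_2_eq_Suc')
qed

lemma eisenstein_eis_const: "k > 0 \<Longrightarrow> eisenstein k = fps_const (eis_const k) + dsum (k - 1) 0"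
  by (simp add: eisenstein_dsum eis_const_def)

lemma qD_add [simp]: "qD (f + g) = qD f + qD g"
  and qD_mult: "qD (f * g) = qD f * g + f * qD g"
  and qD_const [simp]: "qD (fps_const c) = 0"
  and qD_smult [simp]: "qD (fps_const c * f) = fps_const c * qD f"
  by (simp_all add: qD_def algebra_simps)

lemma sum_fps_const: "(\<Sum>i\<in>A. fps_const (f i)) = fps_const (\<Sum>i\<in>A. f i :: complex)"
  by (induction A rule: infinite_finite_induct) auto

text \<open>Each Eisenstein series is split into its constant and its divisor sum. The products of
  constants are Euler's identity; the two kinds of mixed terms agree under \<open>i -> K - i\<close>
  and together cancel the Bernoulli sum in \<open>sigma_convolution\<close>, which supplies the
  products of divisor sums.\<close>

lemma eisenstein_convolution:
  assumes "even K" "K \<ge> 2"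
  shows "fps_const 2 * (\<Sum>i | odd i \<and> i < K. fps_const (of_nat (K choose i)) * (eisenstein (i + 1) * eisenstein (K + 1 - i)))
    = fps_const ((of_nat K + 3) / (of_nat K + 1)) * eisenstein (K + 2) - fps_const 2 * qD (eisenstein K)"
proof -
  let ?I = "{i. odd i \<and> i < K}" and ?C = "\<lambda>i. fps_const (of_nat (K choose i)) :: complex fps"
    and ?c = "\<lambda>i. fps_const (eis_const i)" and ?s = "\<lambda>i. dsum i 0"
  have four: "fps_const 4 = fps_const 2 + fps_const (2 :: complex)" by simp
  have "(\<Sum>i\<in>?I. ?C i * (eisenstein (i + 1) * eisenstein (K + 1 - i)))
    = (\<Sum>i\<in>?I. ?C i * (?c (i + 1) * ?c (K + 1 - i)) + ?C i * (?c (i + 1) * ?s (K - i))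
        + ?C i * (?c (K + 1 - i) * ?s i) + ?C i * (?s i * ?s (K - i)))"
    by (rule sum.cong) (auto simp: eisenstein_eis_const algebra_simps)
  also have "\<dots> = (\<Sum>i\<in>?I. ?C i * (?c (i + 1) * ?c (K + 1 - i))) + (\<Sum>i\<in>?I. ?C i * (?c (i + 1) * ?s (K - i)))
        + (\<Sum>i\<in>?I. ?C i * (?c (K + 1 - i) * ?s i)) + (\<Sum>i\<in>?I. ?C i * (?s i * ?s (K - i)))"
    by (simp only: sum.distrib)
  also have "(\<Sum>i\<in>?I. ?C i * (?c (K + 1 - i) * ?s i)) = (\<Sum>i\<in>?I. ?C i * (?c (i + 1) * ?s (K - i)))"
    by (rule sum.reindex_bij_witness [where i = "\<lambda>i. K - i" and j = "\<lambda>i. K - i"])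
      (use assms in \<open>auto simp: binomial_symmetric [symmetric] Suc_diff_le elim: oddE\<close>)
  also have "(\<Sum>i\<in>?I. ?C i * (?c (i + 1) * ?s (K - i)))
    = (\<Sum>j | even j \<and> 2 \<le> j \<and> j \<le> K. fps_const (- 1 / (2 * (of_nat K + 1))) *
        (fps_const (of_nat (K + 1 choose j) * bern j) * ?s (K + 1 - j)))"
  proof (rule sum.reindex_bij_witness [where i = "\<lambda>j. j - 1" and j = Suc], goal_cases)
    case (5 i)
    have "of_nat (Suc K) * of_nat (K choose i) = of_nat (Suc K choose Suc i) * (of_nat (Suc i) :: complex)"
      by (metis Suc_times_binomial_eq of_nat_mult)
    moreover have "c * (- B / (2 * u)) = - 1 / (2 * M) * (e * B)"
      if "M * c = e * u" "M \<noteq> 0" "u \<noteq> 0" for B c e u M :: complex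
    proof -
      have c: "c = e * u / M" using that by (simp add: field_simps)
      show ?thesis unfolding c using that by (simp add: field_simps)
    qed
    ultimately have "of_nat (K choose i) * eis_const (i + 1)
        = - 1 / (2 * of_nat (Suc K)) * (of_nat (Suc K choose Suc i) * bern (Suc i))"
      unfolding eis_const_def Suc_eq_plus1 [symmetric] using of_nat_neq_0 by blast
    then have "fps_const (- 1 / (2 * (of_nat K + 1))) * fps_const (of_nat (K + 1 choose Suc i) * bern (Suc i))
        = ?C i * ?c (i + 1)"
      by (simp only: fps_const_mult Suc_eq_plus1 of_nat_add of_nat_1)
    then show ?case by (simp only: mult.assoc [symmetric]) simp
  qed (use assms in \<open>auto elim: evenE oddE\<close>)
  also have "\<dots> = fps_const (- 1 / (2 * (of_nat K + 1))) *
      (\<Sum>j | even j \<and> 2 \<le> j \<and> j \<le> K. fps_const (of_nat (K + 1 choose j) * bern j) * ?s (K + 1 - j))"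
    (is "_ = _ * ?R") by (simp only: sum_distrib_left)
  finally have "fps_const 2 * (\<Sum>i\<in>?I. ?C i * (eisenstein (i + 1) * eisenstein (K + 1 - i)))
    = fps_const 2 * (\<Sum>i\<in>?I. ?C i * (?c (i + 1) * ?c (K + 1 - i)))
      + fps_const 4 * fps_const (- 1 / (2 * (of_nat K + 1))) * ?R
      + fps_const 2 * (\<Sum>i\<in>?I. ?C i * (?s i * ?s (K - i)))"
    by (simp only: four distrib_left distrib_right mult.assoc add_ac)
  also have "fps_const 2 * (\<Sum>i\<in>?I. ?C i * (?c (i + 1) * ?c (K + 1 - i)))
      = fps_const (2 * (\<Sum>i\<in>?I. of_nat (K choose i) * (eis_const (i + 1) * eis_const (K + 1 - i))))"
    by (simp only: fps_const_mult sum_fps_const)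
  also have "\<dots> = fps_const ((of_nat K + 3) / (of_nat K + 1)) * ?c (K + 2)"
    unfolding euler_eis_const [OF assms] by simp
  also have "fps_const 4 * fps_const (- 1 / (2 * (of_nat K + 1))) = - fps_const (2 / (of_nat K + 1 :: complex))"
  proof -
    have "4 * (- 1 / (2 * N)) = - (2 / N)" if "N \<noteq> 0" for N :: complex
      using that by (simp add: field_simps)
    from this [OF of_nat_plus_1_neq [of K]] show ?thesis
      by (simp only: fps_const_mult fps_const_neg)
  qed
  also have "fps_const 2 * (\<Sum>i\<in>?I. ?C i * (?s i * ?s (K - i)))
      = fps_const ((of_nat K + 3) / (of_nat K + 1)) * dsum (K + 1) 0 - fps_const 2 * dsum K 1
      + fps_const (2 / (of_nat K + 1)) * ?R"
    by (rule sigma_convolution [OF assms])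
  also have "dsum K 1 = qD (eisenstein K)"
    using assms by (simp add: eisenstein_eis_const qD_dsum)
  finally show ?thesis
    by (simp add: eisenstein_eis_const [of "Suc (Suc K)"] algebra_simps del: fps_const_neg fps_const_mult)
qed

lemma fps_const_mult_left_cancel:
  "c \<noteq> 0 \<Longrightarrow> fps_const c * f = fps_const c * g \<longleftrightarrow> f = (g :: complex fps)"
  by simp

lemma qD_eisenstein_2:
  "qD (eisenstein 2) = fps_const (5 / 6) * eisenstein 4 - fps_const 2 * (eisenstein 2 * eisenstein 2)"
proof -
  have [simp]: "{i. odd i \<and> i < (2::nat)} = {1}" by (auto simp: less_2_cases_iff)
  have "fps_const 2 * qD (eisenstein 2)
      = fps_const 2 * (fps_const (5 / 6) * eisenstein 4 - fps_const 2 * (eisenstein 2 * eisenstein 2))"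
    using eisenstein_convolution [of 2] by (simp add: algebra_simps flip: numeral_2_eq_2)
  then show ?thesis by (subst (asm) fps_const_mult_left_cancel) auto
qed

lemma qD_eisenstein_4:
  "qD (eisenstein 4) = fps_const (7 / 10) * eisenstein 6 - fps_const 8 * (eisenstein 2 * eisenstein 4)"
proof -
  have [simp]: "{i. odd i \<and> i < (4::nat)} = {1, 3}"
    unfolding set_eq_iff mem_Collect_eq insert_iff empty_iff by presburger
  have "fps_const 2 * qD (eisenstein 4)
      = fps_const 2 * (fps_const (7 / 10) * eisenstein 6 - fps_const 8 * (eisenstein 2 * eisenstein 4))"
    using eisenstein_convolution [of 4] fps_const_mult [of 2 "7 / 10 :: complex"]
    by (simp add: algebra_simps binomial_fact fact_numeral flip: numeral_2_eq_2 numeral_fps_const fps_const_mult)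
  then show ?thesis by (subst (asm) fps_const_mult_left_cancel) auto
qed

text \<open>The convolution for \<open>K = 6\<close> involves \<open>G_8\<close>; replacing it by
  \<open>120 G_4^2\<close> gives the coefficient \<open>120 * 9/14 - 20 = 400/7\<close>.\<close>

lemma qD_eisenstein_6:
  "qD (eisenstein 6) = fps_const (400 / 7) * (eisenstein 4 * eisenstein 4) - fps_const 12 * (eisenstein 2 * eisenstein 6)"
proof -
  have [simp]: "{i. odd i \<and> i < (6::nat)} = {1, 3, 5}"
    unfolding set_eq_iff mem_Collect_eq insert_iff empty_iff by presburger
  have *: "120 * fps_const (9 / 7) = 2 * fps_const (400 / 7) + (40 :: complex fps)"
    by (simp add: numeral_fps_const)
  have "fps_const 2 * qD (eisenstein 6)
      = fps_const 2 * (fps_const (400 / 7) * (eisenstein 4 * eisenstein 4) - fps_const 12 * (eisenstein 2 * eisenstein 6))"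
    using eisenstein_convolution [of 6] eisenstein_4_square [symmetric]
    by (simp add: * algebra_simps binomial_fact fact_numeral power2_eq_square flip: numeral_2_eq_2 numeral_fps_const)
  then show ?thesis by (subst (asm) fps_const_mult_left_cancel) auto
qed

section \<open>Quasimodular forms\<close>

text \<open>\<open>MF\<close> carries no weight, but the correction term of the Serre derivative,
  and with it the induction for Eisenstein series, depends on it.\<close>

inductive_set MF_wt :: "nat \<Rightarrow> complex fps set" for k :: nat where
  zero: "0 \<in> MF_wt k"
| mono: "4 * b + 6 * c = k \<Longrightarrow> eisenstein 4 ^ b * eisenstein 6 ^ c \<in> MF_wt k"
| smult: "\<phi> \<in> MF_wt k \<Longrightarrow> fps_const z * \<phi> \<in> MF_wt k"
| add: "\<phi> \<in> MF_wt k \<Longrightarrow> \<psi> \<in> MF_wt k \<Longrightarrow> \<phi> + \<psi> \<in> MF_wt k"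

lemma MF_wt_cong: "\<phi> \<in> MF_wt k \<Longrightarrow> k = l \<Longrightarrow> \<phi> \<in> MF_wt l"
  by simp

lemma QMF_wt_cong: "\<phi> \<in> QMF_wt k \<Longrightarrow> k = l \<Longrightarrow> \<phi> \<in> QMF_wt l"
  by simp

lemma MF_power: "\<phi> \<in> MF \<Longrightarrow> \<phi> ^ n \<in> MF"
  using MF.const [of 1] by (induction n) (auto intro: MF.mul)

lemma QMF_power: "\<phi> \<in> QMF \<Longrightarrow> \<phi> ^ n \<in> QMF"
  using QMF.const [of 1] by (induction n) (auto intro: QMF.mul)

lemma MF_wt_imp_MF: "\<phi> \<in> MF_wt k \<Longrightarrow> \<phi> \<in> MF"
proof (induction rule: MF_wt.induct)
  case zero
  then show ?case using MF.const [of 0] by simp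
qed (auto intro: MF.intros MF_power)

lemma QMF_wt_imp_QMF: "\<phi> \<in> QMF_wt k \<Longrightarrow> \<phi> \<in> QMF"
proof (induction rule: QMF_wt.induct)
  case zero
  then show ?case using QMF.const [of 0] by simp
qed (auto intro: QMF.intros QMF_power)

lemma MF_wt_imp_QMF_wt: "\<phi> \<in> MF_wt k \<Longrightarrow> \<phi> \<in> QMF_wt k"
proof (induction rule: MF_wt.induct)
  case (mono b c)
  then show ?case using QMF_wt.mono [of 0 b c k] by simp
qed (auto intro: QMF_wt.intros)

lemma MF_wt_mult:
  assumes "\<phi> \<in> MF_wt k" "\<psi> \<in> MF_wt l"
  shows "\<phi> * \<psi> \<in> MF_wt (k + l)"
  using assms(1)
proof (induction rule: MF_wt.induct)
  case (mono b c)
  show ?case using assms(2)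
  proof (induction rule: MF_wt.induct)
    case (mono b' c')
    have "eisenstein 4 ^ (b + b') * eisenstein 6 ^ (c + c') \<in> MF_wt (k + l)"
      by (rule MF_wt.mono) (use mono \<open>4 * b + 6 * c = k\<close> in simp)
    then show ?case by (simp add: power_add mult_ac)
  qed (auto simp: distrib_left mult.left_commute [of _ "fps_const _"] intro: MF_wt.intros)
qed (auto simp: distrib_right mult.assoc intro: MF_wt.intros)

lemma QMF_wt_mult:
  assumes "\<phi> \<in> QMF_wt k" "\<psi> \<in> QMF_wt l"
  shows "\<phi> * \<psi> \<in> QMF_wt (k + l)"
  using assms(1)
proof (induction rule: QMF_wt.induct)
  case (mono a b c)
  show ?case using assms(2)
  proof (induction rule: QMF_wt.induct)
    case (mono a' b' c')
    have "eisenstein 2 ^ (a + a') * eisenstein 4 ^ (b + b') * eisenstein 6 ^ (c + c') \<in> QMF_wt (k + l)"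
      by (rule QMF_wt.mono) (use mono \<open>2 * a + 4 * b + 6 * c = k\<close> in simp)
    then show ?case by (simp add: power_add mult_ac)
  qed (auto simp: distrib_left mult.left_commute [of _ "fps_const _"] intro: QMF_wt.intros)
qed (auto simp: distrib_right mult.assoc intro: QMF_wt.intros)

lemma QMF_wt_diff: "\<phi> \<in> QMF_wt k \<Longrightarrow> \<psi> \<in> QMF_wt k \<Longrightarrow> \<phi> - \<psi> \<in> QMF_wt k"
  using QMF_wt.add [of \<phi> k "fps_const (-1) * \<psi>"] QMF_wt.smult [of \<psi> k "-1"]
  by (simp flip: fps_const_neg)

lemma MF_wt_eisenstein_4: "eisenstein 4 \<in> MF_wt 4"
  and MF_wt_eisenstein_6: "eisenstein 6 \<in> MF_wt 6"
  and MF_wt_const: "fps_const z \<in> MF_wt 0"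
  using MF_wt.mono [of 1 0] MF_wt.mono [of 0 1] MF_wt.smult [OF MF_wt.mono [of 0 0 0], of z] by simp_all

lemma QMF_wt_eisenstein_2: "eisenstein 2 \<in> QMF_wt 2"
  and QMF_wt_eisenstein_4: "eisenstein 4 \<in> QMF_wt 4"
  and QMF_wt_eisenstein_6: "eisenstein 6 \<in> QMF_wt 6"
  and QMF_wt_const: "fps_const z \<in> QMF_wt 0"
  using QMF_wt.mono [of 1 0 0] MF_wt_imp_QMF_wt [OF MF_wt_eisenstein_4]
    MF_wt_imp_QMF_wt [OF MF_wt_eisenstein_6] MF_wt_imp_QMF_wt [OF MF_wt_const] by simp_all

text \<open>Monomials are built up one generator at a time, so that a claim about a derivation needs
  Leibniz' rule only for a product with a single Eisenstein series. \<open>P\<close> takes the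
  weight as an argument because the weight changes along the way.\<close>

lemma MF_wt_induct [consumes 1, case_names zero one G4 G6 smult add]:
  assumes "\<phi> \<in> MF_wt k"
    and "P k 0" "P 0 1"
    and "\<And>k \<phi>. \<phi> \<in> MF_wt k \<Longrightarrow> P k \<phi> \<Longrightarrow> P (4 + k) (eisenstein 4 * \<phi>)"
    and "\<And>k \<phi>. \<phi> \<in> MF_wt k \<Longrightarrow> P k \<phi> \<Longrightarrow> P (6 + k) (eisenstein 6 * \<phi>)"
    and "\<And>\<phi> z. \<phi> \<in> MF_wt k \<Longrightarrow> P k \<phi> \<Longrightarrow> P k (fps_const z * \<phi>)"
    and "\<And>\<phi> \<psi>. \<phi> \<in> MF_wt k \<Longrightarrow> P k \<phi> \<Longrightarrow> \<psi> \<in> MF_wt k \<Longrightarrow> P k \<psi> \<Longrightarrow> P k (\<phi> + \<psi>)"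
  shows "P k \<phi>"
  using assms(1)
proof (induction rule: MF_wt.induct)
  case (mono b c)
  have "P (6 * c) (eisenstein 6 ^ c)" for c
  proof (induction c)
    case (Suc c)
    then show ?case using assms(5) [OF MF_wt.mono [of 0 c "6 * c"]] by simp
  qed (simp add: assms)
  then have "P (4 * b + 6 * c) (eisenstein 4 ^ b * eisenstein 6 ^ c)"
  proof (induction b)
    case (Suc b)
    then show ?case using assms(4) [OF MF_wt.mono [of b c "4 * b + 6 * c"]] by (simp add: mult.assoc add.assoc)
  qed simp
  with mono show ?case by simp
qed (use assms in auto)

lemma QMF_wt_induct [consumes 1, case_names zero one G2 G4 G6 smult add]:
  assumes "\<phi> \<in> QMF_wt k"
    and "P k 0" "P 0 1"
    and "\<And>k \<phi>. \<phi> \<in> QMF_wt k \<Longrightarrow> P k \<phi> \<Longrightarrow> P (2 + k) (eisenstein 2 * \<phi>)"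
    and "\<And>k \<phi>. \<phi> \<in> QMF_wt k \<Longrightarrow> P k \<phi> \<Longrightarrow> P (4 + k) (eisenstein 4 * \<phi>)"
    and "\<And>k \<phi>. \<phi> \<in> QMF_wt k \<Longrightarrow> P k \<phi> \<Longrightarrow> P (6 + k) (eisenstein 6 * \<phi>)"
    and "\<And>\<phi> z. \<phi> \<in> QMF_wt k \<Longrightarrow> P k \<phi> \<Longrightarrow> P k (fps_const z * \<phi>)"
    and "\<And>\<phi> \<psi>. \<phi> \<in> QMF_wt k \<Longrightarrow> P k \<phi> \<Longrightarrow> \<psi> \<in> QMF_wt k \<Longrightarrow> P k \<psi> \<Longrightarrow> P k (\<phi> + \<psi>)"
  shows "P k \<phi>"
  using assms(1)
proof (induction rule: QMF_wt.induct)
  case (mono a b c)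
  have "P (6 * c) (eisenstein 6 ^ c)" for c
  proof (induction c)
    case (Suc c)
    then show ?case using assms(6) [OF QMF_wt.mono [of 0 0 c "6 * c"]] by simp
  qed (simp add: assms)
  then have "P (4 * b + 6 * c) (eisenstein 4 ^ b * eisenstein 6 ^ c)" for b
  proof (induction b)
    case (Suc b)
    then show ?case using assms(5) [OF QMF_wt.mono [of 0 b c "4 * b + 6 * c"]] by (simp add: mult.assoc add.assoc)
  qed simp
  then have "P (2 * a + 4 * b + 6 * c) (eisenstein 2 ^ a * eisenstein 4 ^ b * eisenstein 6 ^ c)"
  proof (induction a)
    case (Suc a)
    then show ?case using assms(4) [OF QMF_wt.mono [of a b c "2 * a + 4 * b + 6 * c"]]
      by (simp add: mult.assoc add.assoc)
  qed simp
  with mono show ?case by simp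
qed (use assms in auto)

lemma QMF_wt_qD: "\<phi> \<in> QMF_wt k \<Longrightarrow> qD \<phi> \<in> QMF_wt (k + 2)"
proof (induction rule: QMF_wt_induct)
  case one
  have "qD 1 = 0" using qD_const [of 1] by simp
  then show ?case by (simp add: QMF_wt.zero)
next
  case (G2 k \<phi>)
  have "qD (eisenstein 2) \<in> QMF_wt 4"
    unfolding qD_eisenstein_2
    by (intro QMF_wt_diff QMF_wt.smult QMF_wt_eisenstein_4
      QMF_wt_cong [OF QMF_wt_mult [OF QMF_wt_eisenstein_2 QMF_wt_eisenstein_2]]) simp
  then have "qD (eisenstein 2) * \<phi> \<in> QMF_wt (2 + k + 2)" "eisenstein 2 * qD \<phi> \<in> QMF_wt (2 + k + 2)"
    using G2 QMF_wt_mult [of "qD (eisenstein 2)" 4 \<phi> k] QMF_wt_mult [OF QMF_wt_eisenstein_2, of "qD \<phi>" "k + 2"]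
    by (simp_all add: add_ac numeral_eq_Suc)
  then show ?case by (simp add: qD_mult QMF_wt.add)
next
  case (G4 k \<phi>)
  have "qD (eisenstein 4) \<in> QMF_wt 6"
    unfolding qD_eisenstein_4
    by (intro QMF_wt_diff QMF_wt.smult QMF_wt_eisenstein_6
      QMF_wt_cong [OF QMF_wt_mult [OF QMF_wt_eisenstein_2 QMF_wt_eisenstein_4]]) simp
  then have "qD (eisenstein 4) * \<phi> \<in> QMF_wt (4 + k + 2)" "eisenstein 4 * qD \<phi> \<in> QMF_wt (4 + k + 2)"
    using G4 QMF_wt_mult [of "qD (eisenstein 4)" 6 \<phi> k] QMF_wt_mult [OF QMF_wt_eisenstein_4, of "qD \<phi>" "k + 2"]
    by (simp_all add: add_ac)
  then show ?case by (simp add: qD_mult QMF_wt.add)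
next
  case (G6 k \<phi>)
  have "qD (eisenstein 6) \<in> QMF_wt 8"
    unfolding qD_eisenstein_6
    by (intro QMF_wt_diff QMF_wt.smult QMF_wt_cong [OF QMF_wt_mult [OF QMF_wt_eisenstein_4 QMF_wt_eisenstein_4]]
      QMF_wt_cong [OF QMF_wt_mult [OF QMF_wt_eisenstein_2 QMF_wt_eisenstein_6]]) simp_all
  then have "qD (eisenstein 6) * \<phi> \<in> QMF_wt (6 + k + 2)" "eisenstein 6 * qD \<phi> \<in> QMF_wt (6 + k + 2)"
    using G6 QMF_wt_mult [of "qD (eisenstein 6)" 8 \<phi> k] QMF_wt_mult [OF QMF_wt_eisenstein_6, of "qD \<phi>" "k + 2"]
    by (simp_all add: add_ac)
  then show ?case by (simp add: qD_mult QMF_wt.add)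
next
  case zero
  then show ?case by (simp add: qD_def QMF_wt.zero)
qed (simp_all add: QMF_wt.smult QMF_wt.add del: add_2_eq_Suc')

text \<open>The Serre derivative \<open>D - k/12 E_2\<close>: since \<open>G_2 = - E_2 / 24\<close>,
  the correction is \<open>2 k G_2\<close>.\<close>

definition serre_deriv :: "nat \<Rightarrow> complex fps \<Rightarrow> complex fps" where
  "serre_deriv k \<phi> = qD \<phi> + fps_const (2 * of_nat k) * (eisenstein 2 * \<phi>)"

lemma serre_deriv_mult:
  "serre_deriv (k + l) (\<phi> * \<psi>) = serre_deriv k \<phi> * \<psi> + \<phi> * serre_deriv l \<psi>"
  by (simp add: serre_deriv_def qD_mult algebra_simps flip: fps_const_add)

text \<open>The correction cancels the \<open>G_2\<close> terms in Ramanujan's formulas for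
  \<open>G_4\<close> and \<open>G_6\<close>, whose coefficients are \<open>8 = 2 * 4\<close> and
  \<open>12 = 2 * 6\<close>; Leibniz' rule does the rest.\<close>

lemma MF_wt_serre_deriv: "\<phi> \<in> MF_wt k \<Longrightarrow> serre_deriv k \<phi> \<in> MF_wt (k + 2)"
proof (induction rule: MF_wt_induct)
  case zero
  then show ?case by (simp add: serre_deriv_def qD_def MF_wt.zero)
next
  case one
  have "serre_deriv 0 1 = 0" using qD_const [of 1] by (simp add: serre_deriv_def)
  then show ?case by (simp add: MF_wt.zero)
next
  case (G4 k \<phi>)
  have "serre_deriv 4 (eisenstein 4) = fps_const (7 / 10) * eisenstein 6"
    by (simp add: serre_deriv_def qD_eisenstein_4)
  then have "serre_deriv 4 (eisenstein 4) \<in> MF_wt 6"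
    by (simp add: MF_wt.smult MF_wt_eisenstein_6)
  then have "serre_deriv 4 (eisenstein 4) * \<phi> \<in> MF_wt (4 + k + 2)" "eisenstein 4 * serre_deriv k \<phi> \<in> MF_wt (4 + k + 2)"
    using G4 MF_wt_mult [of _ 6 \<phi> k] MF_wt_mult [OF MF_wt_eisenstein_4, of "serre_deriv k \<phi>" "k + 2"]
    by (simp_all add: add_ac)
  then show ?case by (simp add: serre_deriv_mult MF_wt.add)
next
  case (G6 k \<phi>)
  have "serre_deriv 6 (eisenstein 6) = fps_const (400 / 7) * (eisenstein 4 * eisenstein 4)"
    by (simp add: serre_deriv_def qD_eisenstein_6)
  then have "serre_deriv 6 (eisenstein 6) \<in> MF_wt 8"
    using MF_wt_mult [OF MF_wt_eisenstein_4 MF_wt_eisenstein_4] by (simp add: MF_wt.smult)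
  then have "serre_deriv 6 (eisenstein 6) * \<phi> \<in> MF_wt (6 + k + 2)" "eisenstein 6 * serre_deriv k \<phi> \<in> MF_wt (6 + k + 2)"
    using G6 MF_wt_mult [of _ 8 \<phi> k] MF_wt_mult [OF MF_wt_eisenstein_6, of "serre_deriv k \<phi>" "k + 2"]
    by (simp_all add: add_ac)
  then show ?case by (simp add: serre_deriv_mult MF_wt.add)
next
  case (smult \<phi> z)
  have "serre_deriv k (fps_const z * \<phi>) = fps_const z * serre_deriv k \<phi>"
    by (simp add: serre_deriv_def distrib_left)
  with smult show ?case by (simp add: MF_wt.smult)
next
  case (add \<phi> \<psi>)
  have "serre_deriv k (\<phi> + \<psi>) = serre_deriv k \<phi> + serre_deriv k \<psi>"
    by (simp add: serre_deriv_def algebra_simps)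
  with add show ?case by (simp add: MF_wt.add)
qed

lemma MF_wt_sum: "(\<And>i. i \<in> A \<Longrightarrow> f i \<in> MF_wt k) \<Longrightarrow> (\<Sum>i\<in>A. f i) \<in> MF_wt k"
  by (induction A rule: infinite_finite_induct) (auto intro: MF_wt.zero MF_wt.add)

text \<open>In the convolution for \<open>K = k - 2\<close> exactly the terms \<open>i = 1\<close>
  and \<open>i = K - 1\<close> contain \<open>G_2\<close>. Each equals \<open>K G_2 G_K\<close>, and
  together with \<open>D G_K\<close> they form the Serre derivative of \<open>G_K\<close>; the other
  terms are products of Eisenstein series of weights between 4 and \<open>K - 2\<close>. The
  coefficient \<open>(K + 3) / (K + 1)\<close> of \<open>G_k\<close> is invertible.\<close>

lemma eisenstein_in_MF_wt:
  assumes "even k" "k \<ge> 4"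
  shows "eisenstein k \<in> MF_wt k"
  using assms
proof (induction k rule: less_induct)
  case (less k)
  have "k = 4 \<or> k = 6 \<or> k \<ge> 8" using less.prems by presburger
  then consider "k = 4" | "k = 6" | "k \<ge> 8" by blast
  then show ?case
  proof cases
    assume "k \<ge> 8"
    define K where "K = k - 2"
    have K: "even K" "K \<ge> 6" "k = K + 2" using less.prems \<open>k \<ge> 8\<close> by (auto simp: K_def)
    define F where "F i = fps_const (of_nat (K choose i)) * (eisenstein (i + 1) * eisenstein (K + 1 - i))" for i
    define J where "J = {i. odd i \<and> 3 \<le> i \<and> i \<le> K - 3}"
    have "{i. odd i \<and> i < K} = insert 1 (insert (K - 1) J)"
      using K(1,2) unfolding J_def set_eq_iff mem_Collect_eq insert_iff by presburger
    moreover have "finite J" "1 \<notin> J" "K - 1 \<notin> J" "1 \<noteq> K - 1"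
      using K by (auto simp: J_def intro: finite_subset [of _ "{..K}"])
    ultimately have "(\<Sum>i | odd i \<and> i < K. F i) = F 1 + (F (K - 1) + sum F J)"
      by simp
    also have "F 1 = fps_const (of_nat K) * (eisenstein 2 * eisenstein K)"
      by (simp add: F_def numeral_2_eq_2)
    also have "F (K - 1) = fps_const (of_nat K) * (eisenstein 2 * eisenstein K)"
      using K binomial_symmetric [of 1 K] by (simp add: F_def mult.commute numeral_2_eq_2)
    finally have "fps_const ((of_nat K + 3) / (of_nat K + 1)) * eisenstein k
        = fps_const 2 * (serre_deriv K (eisenstein K) + sum F J)"
      using eisenstein_convolution [of K, folded F_def] K
      by (simp add: serre_deriv_def algebra_simps flip: numeral_fps_const fps_const_mult)
    moreover have "serre_deriv K (eisenstein K) \<in> MF_wt k"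
      using less.IH [of K] K MF_wt_serre_deriv [of "eisenstein K" K] by simp
    moreover have "F i \<in> MF_wt k" if "i \<in> J" for i
      unfolding F_def
    proof (rule MF_wt.smult, rule MF_wt_cong [OF MF_wt_mult])
      show "eisenstein (i + 1) \<in> MF_wt (i + 1)" "eisenstein (K + 1 - i) \<in> MF_wt (K + 1 - i)"
        using that K by (auto intro!: less.IH simp: J_def)
      show "i + 1 + (K + 1 - i) = k" using that K by (auto simp: J_def)
    qed
    ultimately have "fps_const ((of_nat K + 3) / (of_nat K + 1)) * eisenstein k \<in> MF_wt k"
      by (simp add: MF_wt.smult MF_wt.add MF_wt_sum)
    then have "fps_const ((of_nat K + 1) / (of_nat K + 3)) * (fps_const ((of_nat K + 3) / (of_nat K + 1)) * eisenstein k) \<in> MF_wt k"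
      by (rule MF_wt.smult)
    moreover have "(of_nat K + 3 :: complex) \<noteq> 0"
      using of_nat_plus_1_neq [of "K + 2"] by (simp add: add.commute)
    ultimately show ?thesis
      using of_nat_plus_1_neq [of K] by (simp flip: mult.assoc)
  qed (simp_all add: MF_wt_eisenstein_4 MF_wt_eisenstein_6)
qed

section \<open>The weight operator and the lowering derivation on quasimodular forms\<close>

inductive_set QMF_graded_sums :: "complex fps set" where
  graded: "\<phi> \<in> QMF_wt k \<Longrightarrow> \<phi> \<in> QMF_graded_sums"
| add: "\<phi> \<in> QMF_graded_sums \<Longrightarrow> \<psi> \<in> QMF_graded_sums \<Longrightarrow> \<phi> + \<psi> \<in> QMF_graded_sums"

lemma QMF_graded_sums_mult:
  assumes "\<phi> \<in> QMF_graded_sums" "\<psi> \<in> QMF_graded_sums"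
  shows "\<phi> * \<psi> \<in> QMF_graded_sums"
  using assms(1)
proof (induction rule: QMF_graded_sums.induct)
  case (graded \<phi> k)
  show ?case using assms(2)
  proof (induction rule: QMF_graded_sums.induct)
    case (graded \<psi> l)
    show ?case using QMF_wt_mult [OF \<open>\<phi> \<in> QMF_wt k\<close> graded] by (rule QMF_graded_sums.graded)
  qed (simp add: distrib_left QMF_graded_sums.add)
qed (simp add: distrib_right QMF_graded_sums.add)

lemma QMF_imp_graded_sums: "\<phi> \<in> QMF \<Longrightarrow> \<phi> \<in> QMF_graded_sums"
  by (induction rule: QMF.induct)
    (auto intro: QMF_graded_sums.intros QMF_wt_eisenstein_2 QMF_wt_eisenstein_4 QMF_wt_eisenstein_6
      QMF_wt_const QMF_graded_sums_mult)

lemma QMF_graded_induct [consumes 1, case_names graded add]: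
  assumes "\<phi> \<in> QMF"
    and "\<And>\<phi> k. \<phi> \<in> QMF_wt k \<Longrightarrow> P \<phi>"
    and "\<And>\<phi> \<psi>. \<phi> \<in> QMF \<Longrightarrow> P \<phi> \<Longrightarrow> \<psi> \<in> QMF \<Longrightarrow> P \<psi> \<Longrightarrow> P (\<phi> + \<psi>)"
  shows "P \<phi>"
proof -
  have "\<phi> \<in> QMF \<and> P \<phi>"
    using QMF_imp_graded_sums [OF assms(1)]
    by (induction rule: QMF_graded_sums.induct) (auto intro: assms QMF_wt_imp_QMF QMF.add)
  then show ?thesis ..
qed

text \<open>The operator is prescribed only on homogeneous forms and by additivity. On homogeneous
  forms Leibniz' rule is the additivity of weights; sums of such forms exhaust
  \<open>QMF\<close>.\<close>

lemma weight_operator_mult: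
  assumes W: "is_weight_operator W" and "\<phi> \<in> QMF" "\<psi> \<in> QMF"
  shows "W (\<phi> * \<psi>) = W \<phi> * \<psi> + \<phi> * W \<psi>"
  using assms(2)
proof (induction rule: QMF_graded_induct)
  case (graded \<phi> k)
  show ?case using assms(3)
  proof (induction rule: QMF_graded_induct)
    case (graded \<psi> l)
    have "W (\<phi> * \<psi>) = fps_const (of_nat (k + l)) * (\<phi> * \<psi>)"
      using W QMF_wt_mult [OF \<open>\<phi> \<in> QMF_wt k\<close> graded] unfolding is_weight_operator_def by blast
    moreover have "W \<phi> = fps_const (of_nat k) * \<phi>" "W \<psi> = fps_const (of_nat l) * \<psi>"
      using W graded \<open>\<phi> \<in> QMF_wt k\<close> unfolding is_weight_operator_def by blast+
    ultimately show ?case by (simp add: algebra_simps flip: fps_const_add)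
  next
    case (add \<psi> \<psi>')
    have "W (\<phi> * (\<psi> + \<psi>')) = W (\<phi> * \<psi>) + W (\<phi> * \<psi>')" "W (\<psi> + \<psi>') = W \<psi> + W \<psi>'"
      using W add QMF.mul [OF QMF_wt_imp_QMF [OF \<open>\<phi> \<in> QMF_wt k\<close>]]
      unfolding is_weight_operator_def distrib_left by blast+
    with add show ?case by (simp add: algebra_simps)
  qed
next
  case (add \<phi> \<phi>')
  have "W ((\<phi> + \<phi>') * \<psi>) = W (\<phi> * \<psi>) + W (\<phi>' * \<psi>)" "W (\<phi> + \<phi>') = W \<phi> + W \<phi>'"
    using W add QMF.mul [OF _ assms(3)] unfolding is_weight_operator_def distrib_right by blast+
  with add show ?case by (simp add: algebra_simps)
qed

context
  fixes d :: "complex fps \<Rightarrow> complex fps"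
  assumes d: "is_frak_d_operator d"
begin

lemma frak_d_add: "\<phi> \<in> QMF \<Longrightarrow> \<psi> \<in> QMF \<Longrightarrow> d (\<phi> + \<psi>) = d \<phi> + d \<psi>"
  and frak_d_smult: "\<phi> \<in> QMF \<Longrightarrow> d (fps_const c * \<phi>) = fps_const c * d \<phi>"
  and frak_d_mult: "\<phi> \<in> QMF \<Longrightarrow> \<psi> \<in> QMF \<Longrightarrow> d (\<phi> * \<psi>) = d \<phi> * \<psi> + \<phi> * d \<psi>"
  and frak_d_MF: "\<phi> \<in> MF \<Longrightarrow> d \<phi> = 0"
  and frak_d_eisenstein_2: "d (eisenstein 2) = fps_const (- 1/2)"
  using d unfolding is_frak_d_operator_def by blast+

lemma frak_d_diff:
  assumes "\<phi> \<in> QMF" "\<psi> \<in> QMF"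
  shows "d (\<phi> - \<psi>) = d \<phi> - d \<psi>"
  using frak_d_add [OF assms(1) QMF.mul [OF QMF.const assms(2)], of "-1"] frak_d_smult [OF assms(2), of "-1"]
  by (simp flip: fps_const_neg)

text \<open>The commutator of \<open>d\<close> with \<open>qD\<close> and multiplication by the
  weight both obey Leibniz' rule, so the relation passes to products.\<close>

lemma frak_d_qD_mult:
  assumes "\<phi> \<in> QMF_wt k" "d (qD \<phi>) = qD (d \<phi>) + fps_const (of_nat k) * \<phi>"
    and "\<psi> \<in> QMF_wt l" "d (qD \<psi>) = qD (d \<psi>) + fps_const (of_nat l) * \<psi>"
  shows "d (qD (\<phi> * \<psi>)) = qD (d (\<phi> * \<psi>)) + fps_const (of_nat (k + l)) * (\<phi> * \<psi>)"
proof -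
  have Q: "\<phi> \<in> QMF" "\<psi> \<in> QMF" "qD \<phi> \<in> QMF" "qD \<psi> \<in> QMF"
    using assms QMF_wt_qD by (auto intro: QMF_wt_imp_QMF)
  have "d (qD (\<phi> * \<psi>)) = d (qD \<phi>) * \<psi> + qD \<phi> * d \<psi> + (d \<phi> * qD \<psi> + \<phi> * d (qD \<psi>))"
    using Q by (simp add: qD_mult frak_d_add frak_d_mult QMF.mul)
  then show ?thesis
    unfolding assms(2,4) frak_d_mult [OF Q(1,2)]
    by (simp add: qD_mult algebra_simps flip: fps_const_add)
qed

text \<open>Since the relation is stable under products, it suffices to verify it for
  \<open>G_2\<close>, \<open>G_4\<close>, \<open>G_6\<close>, where \<open>qD\<close> is explicit by
  Ramanujan's formulas.\<close>

lemma frak_d_qD: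
  assumes "\<phi> \<in> QMF_wt k"
  shows "d (qD \<phi>) = qD (d \<phi>) + fps_const (of_nat k) * \<phi>"
proof -
  have 0: "d 0 = 0" "d 1 = 0" using frak_d_MF [OF MF.const [of 0]] frak_d_MF [OF MF.const [of 1]] by simp_all
  have q0: "qD 0 = 0" "qD 1 = 0" using qD_const [of 0] qD_const [of 1] by simp_all
  note Q = QMF.G2 QMF.G4 QMF.G6
  note e0 = frak_d_MF [OF MF.G4] frak_d_MF [OF MF.G6]
  have eq2: "d (qD (eisenstein 2)) = qD (d (eisenstein 2)) + fps_const (of_nat 2) * eisenstein 2"
  proof -
    have "d (fps_const (5 / 6) * eisenstein 4) = 0"
      by (simp add: frak_d_smult QMF.G4 e0)
    moreover have "d (fps_const 2 * (eisenstein 2 * eisenstein 2)) = fps_const 2 * d (eisenstein 2 * eisenstein 2)"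
      by (simp add: frak_d_smult QMF.G2 QMF.mul)
    moreover have "d (eisenstein 2 * eisenstein 2) = - eisenstein 2"
      unfolding frak_d_mult [OF QMF.G2 QMF.G2] frak_d_eisenstein_2
      by (rule fps_ext) (simp only: fps_add_nth fps_mult_left_const_nth fps_mult_right_const_nth fps_neg_nth, simp)
    ultimately have "d (qD (eisenstein 2)) = fps_const 2 * eisenstein 2"
      unfolding qD_eisenstein_2 by (subst frak_d_diff) (simp_all add: Q QMF.const QMF.mul)
    then show ?thesis unfolding frak_d_eisenstein_2 qD_const by simp
  qed
  \<comment> \<open>The shape common to \<open>D G_4\<close> and \<open>D G_6\<close> is a modular
    form minus \<open>c * G_2 * \<psi>\<close>. With \<open>c = 8\<close> and \<open>c = 12\<close>
    the factor \<open>c / 2\<close> is the weight of \<open>\<psi>\<close>.\<close>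
  have G2M: "d (\<phi> - fps_const c * (eisenstein 2 * \<psi>)) = fps_const (c / 2) * \<psi>"
    if "\<phi> \<in> MF" "\<phi> \<in> QMF" "\<psi> \<in> MF" "\<psi> \<in> QMF" for \<phi> \<psi> c
  proof -
    have "d (fps_const c * (eisenstein 2 * \<psi>)) = fps_const c * d (eisenstein 2 * \<psi>)"
      using that by (simp add: frak_d_smult Q QMF.mul)
    also have "d (eisenstein 2 * \<psi>) = fps_const (- 1 / 2) * \<psi>"
      using that frak_d_MF [of \<psi>] by (simp add: frak_d_mult [OF QMF.G2] frak_d_eisenstein_2)
    finally have "d (fps_const c * (eisenstein 2 * \<psi>)) = - fps_const (c / 2) * \<psi>"
      by (simp flip: mult.assoc)
    then show ?thesis
      using that frak_d_MF [of \<phi>] by (simp add: frak_d_diff Q QMF.mul QMF.const flip: fps_const_neg)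
  qed
  have eq4: "d (qD (eisenstein 4)) = qD (d (eisenstein 4)) + fps_const (of_nat 4) * eisenstein 4"
    unfolding qD_eisenstein_4
    by (subst G2M) (auto intro: QMF.intros MF.intros simp: e0 q0)
  have eq6: "d (qD (eisenstein 6)) = qD (d (eisenstein 6)) + fps_const (of_nat 6) * eisenstein 6"
    unfolding qD_eisenstein_6
    by (subst G2M) (auto intro: QMF.intros MF.intros simp: e0 q0)
  show ?thesis using assms
  proof (induction rule: QMF_wt_induct)
    case (G2 k \<phi>)
    show ?case by (rule frak_d_qD_mult [OF QMF_wt_eisenstein_2 eq2 G2])
  next
    case (G4 k \<phi>)
    show ?case by (rule frak_d_qD_mult [OF QMF_wt_eisenstein_4 eq4 G4])
  next
    case (G6 k \<phi>)
    show ?case by (rule frak_d_qD_mult [OF QMF_wt_eisenstein_6 eq6 G6])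
  next
    case (smult \<phi> z)
    then have "\<phi> \<in> QMF" "qD \<phi> \<in> QMF" by (auto intro: QMF_wt_imp_QMF QMF_wt_qD)
    with smult show ?case by (simp add: frak_d_smult distrib_left mult.left_commute)
  next
    case (add \<phi> \<psi>)
    then have "\<phi> \<in> QMF" "qD \<phi> \<in> QMF" "\<psi> \<in> QMF" "qD \<psi> \<in> QMF" by (auto intro: QMF_wt_imp_QMF QMF_wt_qD)
    with add show ?case by (simp add: frak_d_add distrib_left)
  qed (simp_all add: 0 q0)
qed

end

text \<open>The common \<open>q\<close>-expansion of the brackets of \<open>T\<^bsub>k,j+1\<^esub>\<close>.\<close>
definition eis_gen :: "nat \<Rightarrow> nat \<Rightarrow> complex fps" where
  "eis_gen k j = fps_const (eis_const (k + j + 1) * ((if j = 0 then 1 else 0) + (if k = 0 then 1 else 0))) + dsum k j"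

lemma eis_gen_commute: "eis_gen k j = eis_gen j k"
  by (simp add: eis_gen_def dsum_commute [of k j] add.commute)

lemma eis_gen_Suc: "eis_gen (Suc k) (Suc j) = qD (eis_gen k j)"
  by (simp add: eis_gen_def qD_dsum)

lemma eis_gen_0: "k > 0 \<Longrightarrow> eis_gen k 0 = eisenstein (k + 1)"
  by (simp add: eis_gen_def eisenstein_eis_const)

text \<open>Every pair of odd sum lies on a diagonal through \<open>(i, 0)\<close> or
  \<open>(0, i)\<close> with \<open>i\<close> odd, and \<open>swap\<close> exchanges the two
  cases.\<close>

lemma eis_gen_induct [consumes 1, case_names base step swap]:
  assumes "odd (k + j)"
    and "\<And>k. odd k \<Longrightarrow> P k 0"
    and "\<And>k j. odd (k + j) \<Longrightarrow> P k j \<Longrightarrow> P (Suc k) (Suc j)"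
    and swap: "\<And>k j. odd (k + j) \<Longrightarrow> P k j \<Longrightarrow> P j k"
  shows "P k j"
proof -
  have *: "P (i + j) j" if "odd i" for i j
    using that by (induction j) (auto intro: assms)
  show ?thesis
  proof (cases "j \<le> k")
    case True
    then show ?thesis using * [of "k - j" j] assms(1) by simp
  next
    case False
    then show ?thesis using * [of "j - k" k] assms(1) swap [of j k] by (simp add: add.commute)
  qed
qed

lemma eis_gen_QMF_wt:
  assumes "odd (k + j)"
  shows "eis_gen k j \<in> QMF_wt (k + j + 1)"
  using assms
proof (induction rule: eis_gen_induct)
  case (base k)
  show ?case
  proof (cases "k = 1")
    case True
    then show ?thesis by (simp add: eis_gen_0 QMF_wt_eisenstein_2 flip: numeral_2_eq_2)
  next
    case False
    then have "k + 1 \<ge> 4" using base by presburger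
    then show ?thesis
      using base MF_wt_imp_QMF_wt [OF eisenstein_in_MF_wt [of "k + 1"]] by (simp add: eis_gen_0)
  qed
next
  case (step k j)
  then show ?case using QMF_wt_qD [of "eis_gen k j" "k + j + 1"] by (simp add: eis_gen_Suc)
qed (simp add: eis_gen_commute add.commute)

text \<open>For \<open>j = 0\<close> the series is \<open>G_2\<close> or a modular form. Along a
  diagonal, moving \<open>d\<close> past \<open>qD\<close> adds the weight \<open>k + j + 1\<close>
  to the factor \<open>k * j\<close>. The truncated subtractions are harmless, the factor being 0
  when one of them truncates.\<close>

lemma frak_d_eis_gen:
  assumes d: "is_frak_d_operator d" and "odd (k + j)"
  shows "d (eis_gen k j) = fps_const (of_nat (k * j)) * eis_gen (k - 1) (j - 1) - (if k + j = 1 then fps_const (1/2) else 0)"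
  using assms(2)
proof (induction rule: eis_gen_induct)
  case (base k)
  show ?case
  proof (cases "k = 1")
    case True
    then show ?thesis using frak_d_eisenstein_2 [OF d] by (simp add: eis_gen_0 flip: numeral_2_eq_2)
  next
    case False
    then have "k + 1 \<ge> 4" using base by presburger
    then show ?thesis
      using base frak_d_MF [OF d MF_wt_imp_MF [OF eisenstein_in_MF_wt [of "k + 1"]]] by (simp add: eis_gen_0)
  qed
next
  case (step k j)
  have "d (eis_gen (Suc k) (Suc j)) = qD (d (eis_gen k j)) + fps_const (of_nat (k + j + 1)) * eis_gen k j"
    unfolding eis_gen_Suc by (rule frak_d_qD [OF d eis_gen_QMF_wt [OF step.hyps]])
  \<comment> \<open>If \<open>k\<close> or \<open>j\<close> is 0, then \<open>d\<close> yields a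
    constant, nonzero only for \<open>G_2\<close>, which disappears under \<open>qD\<close>.\<close>
  also have "qD (d (eis_gen k j)) = fps_const (of_nat (k * j)) * eis_gen k j"
  proof (cases "k = 0 \<or> j = 0")
    case True
    then have "d (eis_gen k j) = fps_const (if k + j = 1 then - (1/2) else 0)"
      unfolding step.IH by auto
    then have "qD (d (eis_gen k j)) = 0" by (simp only: qD_const)
    then show ?thesis using True by auto
  next
    case False
    then obtain k' j' where "k = Suc k'" "j = Suc j'" by (metis not0_implies_Suc)
    then show ?thesis unfolding step.IH by (simp add: eis_gen_Suc)
  qed
  also have "fps_const (of_nat (k * j)) * eis_gen k j + fps_const (of_nat (k + j + 1)) * eis_gen k j
      = fps_const (of_nat (Suc k * Suc j)) * eis_gen k j"
    by (simp add: algebra_simps flip: fps_const_add)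
  finally show ?case by simp
qed (simp add: eis_gen_commute mult.commute add.commute)

section \<open>Operators on sequences\<close>

lemma poly_eq_of_nat:
  fixes p q :: "complex poly"
  assumes "\<And>r::nat. poly p (of_nat r) = poly q (of_nat r)"
  shows "p = q"
proof (rule ccontr)
  assume "p \<noteq> q"
  then have "finite {x. poly (p - q) x = 0}" by (intro poly_roots_finite) simp
  moreover have "range of_nat \<subseteq> {x. poly (p - q) x = 0}" using assms by auto
  ultimately have "finite (range (of_nat :: nat \<Rightarrow> complex))" by (rule rev_finite_subset)
  then show False by (metis finite_imageD inj_of_nat infinite_UNIV_nat)
qed

type_synonym seq_op = "(nat \<Rightarrow> complex) \<Rightarrow> nat \<Rightarrow> complex"

text \<open>A kernel supported on \<open>s \<le> r\<close> encodes linearity in a form that also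
  lets operators on different multiplicities be interchanged as finite double sums.\<close>

definition triangular :: "seq_op \<Rightarrow> bool" where
  "triangular U \<longleftrightarrow> (\<exists>K. \<forall>f r. U f r = (\<Sum>s\<le>r. K r s * f s))"

definition commutator :: "seq_op \<Rightarrow> seq_op \<Rightarrow> seq_op" where
  "commutator U V f r = U (V f) r - V (U f) r"

definition poly_seq :: "complex poly \<Rightarrow> nat \<Rightarrow> complex" where
  "poly_seq p r = poly p (of_nat r)"

definition reflect_m1 :: "complex poly \<Rightarrow> complex poly" where
  "reflect_m1 p = pcompose p [:- 1, - 1:]"

lemma poly_reflect_m1 [simp]: "poly (reflect_m1 p) x = poly p (- 1 - x)"
  by (simp add: reflect_m1_def poly_pcompose)

text \<open>Since \<open>- 1 - r\<close> is not a natural number, commutation with the reflection up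
  to the sign \<open>(- 1) ^ n\<close> is tested on polynomials: \<open>q\<close> represents the
  image of \<open>p\<close>, and its reflection, with the sign, represents the image of the
  reflected \<open>p\<close>.\<close>

definition reflective :: "nat \<Rightarrow> seq_op \<Rightarrow> bool" where
  "reflective n U \<longleftrightarrow> (\<forall>p. \<exists>q. (\<forall>r. U (poly_seq p) r = poly_seq q r) \<and>
     (\<forall>r. U (poly_seq (reflect_m1 p)) r = (- 1) ^ n * poly_seq (reflect_m1 q) r))"

text \<open>The scalar \<open>c\<close> accounts for \<open>F\<^sub>1(r) = r\<close>, where only \<open>r + 1/2\<close> is odd under
  \<open>r \<mapsto> -1-r\<close>; it drops out of commutators.\<close>
definition graded_op :: "nat \<Rightarrow> seq_op \<Rightarrow> bool" where
  "graded_op n U \<longleftrightarrow> triangular U \<and> (\<forall>f. U f 0 = 0) \<and> (\<exists>c. reflective n (\<lambda>f r. U f r + c * f r))"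

lemma triangular_add: "triangular U \<Longrightarrow> U (\<lambda>r. f r + g r) r = U f r + U g r"
  and triangular_scale: "triangular U \<Longrightarrow> U (\<lambda>r. c * f r) r = c * U f r"
  by (auto simp: triangular_def sum.distrib sum_distrib_left algebra_simps)

lemma triangular_sum: "triangular U \<Longrightarrow> U (\<lambda>r. \<Sum>i\<in>A. f i r) r = (\<Sum>i\<in>A. U (f i) r)"
  by (auto simp: triangular_def sum_distrib_left intro: sum.swap)

lemma triangular_comp:
  assumes "triangular U" "triangular V"
  shows "triangular (\<lambda>f. U (V f))"
proof -
  from assms obtain K L where K: "\<And>f r. U f r = (\<Sum>s\<le>r. K r s * f s)" and L: "\<And>f r. V f r = (\<Sum>s\<le>r. L r s * f s)"
    unfolding triangular_def by blast
  have "U (V f) r = (\<Sum>t\<le>r. (\<Sum>s\<in>{t..r}. K r s * L s t) * f t)" for f r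
  proof -
    have "U (V f) r = (\<Sum>s\<le>r. \<Sum>t\<le>s. K r s * L s t * f t)"
      by (simp add: K L sum_distrib_left mult.assoc)
    also have "\<dots> = (\<Sum>(s, t)\<in>Sigma {..r} (\<lambda>s. {..s}). K r s * L s t * f t)"
      by (rule sum.Sigma) auto
    also have "\<dots> = (\<Sum>(t, s)\<in>Sigma {..r} (\<lambda>t. {t..r}). K r s * L s t * f t)"
      by (rule sum.reindex_bij_witness [where i = prod.swap and j = prod.swap]) auto
    also have "\<dots> = (\<Sum>t\<le>r. \<Sum>s\<in>{t..r}. K r s * L s t * f t)"
      by (rule sum.Sigma [symmetric]) auto
    finally show ?thesis by (simp add: sum_distrib_right)
  qed
  then show ?thesis unfolding triangular_def by (intro exI [of _ "\<lambda>r t. \<Sum>s\<in>{t..r}. K r s * L s t"]) blast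
qed

lemma triangular_commutator:
  assumes "triangular U" "triangular V"
  shows "triangular (commutator U V)"
proof -
  from triangular_comp [OF assms] triangular_comp [OF assms(2,1)]
  obtain K L where K: "\<And>f r. U (V f) r = (\<Sum>s\<le>r. K r s * f s)" and L: "\<And>f r. V (U f) r = (\<Sum>s\<le>r. L r s * f s)"
    unfolding triangular_def by blast
  show ?thesis
    unfolding triangular_def
    by (rule exI [of _ "\<lambda>r s. K r s - L r s"]) (simp add: commutator_def K L left_diff_distrib sum_subtractf)
qed

lemma graded_op_commutator:
  assumes U: "graded_op m U" and V: "graded_op n V"
  shows "graded_op (m + n) (commutator U V)"
proof -
  from U V have tri: "triangular U" "triangular V" by (auto simp: graded_op_def)
  from U obtain c where c: "reflective m (\<lambda>f r. U f r + c * f r)" by (auto simp: graded_op_def)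
  from V obtain d where d: "reflective n (\<lambda>f r. V f r + d * f r)" by (auto simp: graded_op_def)
  define U' V' where "U' f r = U f r + c * f r" and "V' f r = V f r + d * f r" for f and r :: nat
  have lin: "U' (\<lambda>r. e * f r) r = e * U' f r" "V' (\<lambda>r. e * f r) r = e * V' f r" for e f r
    using tri by (simp_all add: U'_def V'_def triangular_scale algebra_simps)
  have U'V': "commutator U V f r = U' (V' f) r - V' (U' f) r" for f r
  proof -
    have "U' (V' f) r = U (V f) r + d * U f r + c * (V f r + d * f r)"
      using triangular_add [OF tri(1)] triangular_scale [OF tri(1)] unfolding U'_def V'_def by simp
    moreover have "V' (U' f) r = V (U f) r + c * V f r + d * (U f r + c * f r)"
      using triangular_add [OF tri(2)] triangular_scale [OF tri(2)] unfolding U'_def V'_def by simp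
    ultimately show ?thesis by (simp add: commutator_def algebra_simps)
  qed
  have "reflective (m + n) (\<lambda>f r. commutator U V f r + 0 * f r)"
    unfolding reflective_def
  proof
    fix p
    \<comment> \<open>\<open>s\<close> represents the image of \<open>p\<close> under
      \<open>V'\<close> and then \<open>U'\<close>, and \<open>v\<close> the one under
      \<open>U'\<close> and then \<open>V'\<close>. So \<open>s - v\<close> is the witness for the
      commutator, with the signs multiplying to \<open>(- 1) ^ (m + n)\<close>.\<close>
    from d obtain q where q: "V' (poly_seq p) = poly_seq q"
        "V' (poly_seq (reflect_m1 p)) = (\<lambda>r. (- 1) ^ n * poly_seq (reflect_m1 q) r)"
      unfolding reflective_def V'_def [abs_def] fun_eq_iff by blast
    from c obtain s where s: "U' (poly_seq q) = poly_seq s"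
        "U' (poly_seq (reflect_m1 q)) = (\<lambda>r. (- 1) ^ m * poly_seq (reflect_m1 s) r)"
      unfolding reflective_def U'_def [abs_def] fun_eq_iff by blast
    from c obtain u where u: "U' (poly_seq p) = poly_seq u"
        "U' (poly_seq (reflect_m1 p)) = (\<lambda>r. (- 1) ^ m * poly_seq (reflect_m1 u) r)"
      unfolding reflective_def U'_def [abs_def] fun_eq_iff by blast
    from d obtain v where v: "V' (poly_seq u) = poly_seq v"
        "V' (poly_seq (reflect_m1 u)) = (\<lambda>r. (- 1) ^ n * poly_seq (reflect_m1 v) r)"
      unfolding reflective_def V'_def [abs_def] fun_eq_iff by blast
    have 1: "commutator U V (poly_seq p) r = poly_seq (s - v) r" for r
      unfolding U'V' q s u v by (simp add: poly_seq_def)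
    have 2: "commutator U V (poly_seq (reflect_m1 p)) r = (- 1) ^ (m + n) * poly_seq (reflect_m1 (s - v)) r" for r
      unfolding U'V' q u lin s v by (simp add: poly_seq_def power_add algebra_simps)
    show "\<exists>q. (\<forall>r. commutator U V (poly_seq p) r + 0 * poly_seq p r = poly_seq q r) \<and>
     (\<forall>r. commutator U V (poly_seq (reflect_m1 p)) r + 0 * poly_seq (reflect_m1 p) r
         = (- 1) ^ (m + n) * poly_seq (reflect_m1 q) r)"
      using 1 2 by (intro exI [of _ "s - v"]) simp
  qed
  moreover have "commutator U V f 0 = 0" for f
    using U V by (simp add: graded_op_def commutator_def)
  ultimately show ?thesis
    using triangular_commutator [OF tri] unfolding graded_op_def by blast
qed

definition mult_op :: "(nat \<Rightarrow> complex) \<Rightarrow> seq_op" where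
  "mult_op g f r = g r * f r"

lemma graded_op_mult_op:
  assumes "g 0 = 0" and q: "\<And>r. g r + c = poly_seq q r" and par: "\<And>x. poly q (- 1 - x) = (- 1) ^ n * poly q x"
  shows "graded_op n (mult_op g)"
proof -
  have "triangular (mult_op g)"
    unfolding triangular_def
  proof (intro exI [of _ "\<lambda>r s. if s = r then g r else 0"] allI)
    fix f r
    have "(\<Sum>s\<le>r. (if s = r then g r else 0) * f s) = (\<Sum>s\<in>{r}. g r * f s)"
      by (rule sum.mono_neutral_cong_right) auto
    then show "mult_op g f r = (\<Sum>s\<le>r. (if s = r then g r else 0) * f s)"
      by (simp add: mult_op_def)
  qed
  moreover have "reflective n (\<lambda>f r. mult_op g f r + c * f r)"
    unfolding reflective_def
  proof
    fix p
    have *: "mult_op g f r + c * f r = poly_seq q r * f r" for f r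
      by (simp add: mult_op_def algebra_simps flip: q)
    show "\<exists>t. (\<forall>r. mult_op g (poly_seq p) r + c * poly_seq p r = poly_seq t r) \<and>
       (\<forall>r. mult_op g (poly_seq (reflect_m1 p)) r + c * poly_seq (reflect_m1 p) r = (- 1) ^ n * poly_seq (reflect_m1 t) r)"
      unfolding * by (intro exI [of _ "q * p"]) (simp add: poly_seq_def par flip: mult.assoc power_mult_distrib)
  qed
  ultimately show ?thesis using assms(1) by (auto simp: graded_op_def mult_op_def)
qed

text \<open>On generating functions in one variable \<open>u\<close> this is multiplication by the
  sum of \<open>i^j u^i\<close> over \<open>i \<ge> 1\<close>.\<close>

definition conv_op :: "nat \<Rightarrow> seq_op" where
  "conv_op j f r = (\<Sum>s<r. of_nat (r - s) ^ j * f s)"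

lemma exists_poly_sum: "\<exists>P. \<forall>r. poly_seq P r = (\<Sum>j<r. poly_seq p j)"
proof -
  define Q :: "nat \<Rightarrow> complex poly"
    where "Q K = (\<Sum>j\<le>K. monom (of_nat (Suc K choose j) * bern j / of_nat (Suc K)) (Suc K - j))" for K
  have Q: "poly (Q K) (of_nat r) = (\<Sum>j<r. of_nat j ^ K)" for K r
    unfolding Q_def faulhaber_sum by (simp add: poly_sum poly_monom sum_divide_distrib)
  show ?thesis
  proof (intro exI [of _ "\<Sum>K\<le>degree p. smult (coeff p K) (Q K)"] allI)
    fix r
    have "poly_seq (\<Sum>K\<le>degree p. smult (coeff p K) (Q K)) r = (\<Sum>K\<le>degree p. \<Sum>j<r. coeff p K * of_nat j ^ K)"
      by (simp add: poly_seq_def poly_sum Q sum_distrib_left)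
    also have "\<dots> = (\<Sum>j<r. \<Sum>K\<le>degree p. coeff p K * of_nat j ^ K)"
      by (rule sum.swap)
    finally show "poly_seq (\<Sum>K\<le>degree p. smult (coeff p K) (Q K)) r = (\<Sum>j<r. poly_seq p j)"
      by (simp add: poly_seq_def poly_altdef)
  qed
qed

lemma triangular_conv_op: "triangular (conv_op j)"
  unfolding triangular_def
proof (intro exI [of _ "\<lambda>r s. if s < r then of_nat (r - s) ^ j else 0"] allI)
  fix f r
  show "conv_op j f r = (\<Sum>s\<le>r. (if s < r then of_nat (r - s) ^ j else 0) * f s)"
    unfolding conv_op_def by (rule sum.mono_neutral_cong_left) auto
qed

text \<open>A polynomial \<open>P\<close> with \<open>P (1 + x) = P x + p x\<close> and
  \<open>P 0 = 0\<close> continues the sum to negative arguments. With half of \<open>f r\<close>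
  added, the reflected \<open>p\<close> yields \<open>- P (- r) + p (- 1 - r) / 2\<close>, which is
  the negative of \<open>P + p / 2\<close> at \<open>- 1 - r\<close>.\<close>

lemma graded_op_conv_op_0: "graded_op 1 (conv_op 0)"
proof -
  have "reflective 1 (\<lambda>f r. conv_op 0 f r + 1/2 * f r)"
    unfolding reflective_def
  proof
    fix p
    obtain P where P: "\<And>r. poly_seq P r = (\<Sum>j<r. poly_seq p j)"
      using exists_poly_sum by blast
    have "pcompose P [:1, 1:] = P + p"
    proof (rule poly_eq_of_nat)
      fix r
      have "poly_seq P (Suc r) = poly_seq P r + poly_seq p r" by (simp add: P)
      then show "poly (pcompose P [:1, 1:]) (of_nat r) = poly (P + p) (of_nat r)"
        by (simp add: poly_pcompose poly_seq_def)
    qed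
    then have step: "poly P (1 + x) = poly P x + poly p x" for x
      by (metis poly_add poly_pcompose poly_pCons poly_0 mult.right_neutral mult_zero_right add.right_neutral)
    have P0: "poly P 0 = 0" using P [of 0] by (simp add: poly_seq_def)
    let ?q = "P + smult (1/2) p"
    have "conv_op 0 (poly_seq (reflect_m1 p)) r + 1/2 * poly_seq (reflect_m1 p) r = - poly_seq (reflect_m1 ?q) r" for r
    proof (induction r)
      case 0
      show ?case using step [of "- 1"] P0 by (simp add: conv_op_def poly_seq_def add_eq_0_iff field_simps)
    next
      case (Suc r)
      have s: "poly P (- 1 - of_nat r) = poly P (- 1 - of_nat (Suc r)) + poly p (- 1 - of_nat (Suc r))"
        using step [of "- 1 - of_nat (Suc r)"] by simp
      show ?case
        using Suc.IH s by (simp add: conv_op_def poly_seq_def field_simps del: of_nat_Suc)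
    qed
    then show "\<exists>q. (\<forall>r. conv_op 0 (poly_seq p) r + 1/2 * poly_seq p r = poly_seq q r) \<and>
       (\<forall>r. conv_op 0 (poly_seq (reflect_m1 p)) r + 1/2 * poly_seq (reflect_m1 p) r
         = (- 1) ^ 1 * poly_seq (reflect_m1 q) r)"
      by (intro exI [of _ ?q]) (simp add: conv_op_def flip: P, simp add: poly_seq_def)
  qed
  then show ?thesis
    unfolding graded_op_def using triangular_conv_op [of 0]
    by (intro conjI allI) (blast, simp add: conv_op_def, blast)
qed

lemma graded_op_mult_of_nat: "graded_op 1 (mult_op of_nat)"
  by (rule graded_op_mult_op [where c = "1/2" and q = "[:1/2, 1:]"]) (auto simp: poly_seq_def algebra_simps)

text \<open>From \<open>(r - s)^(j + 1) = r (r - s)^j - (r - s)^j s\<close>. All convolutions thus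
  arise from \<open>conv_op 0\<close> by commutators with multiplication by \<open>r\<close>, and
  inherit their parity from these two operators.\<close>

lemma conv_op_Suc: "conv_op (Suc j) = commutator (mult_op of_nat) (conv_op j)"
proof (intro ext)
  fix f r
  show "conv_op (Suc j) f r = commutator (mult_op of_nat) (conv_op j) f r"
    unfolding conv_op_def commutator_def mult_op_def sum_distrib_left sum_subtractf [symmetric]
    by (rule sum.cong) (auto simp: of_nat_diff algebra_simps)
qed

lemma graded_op_conv_op: "graded_op (Suc j) (conv_op j)"
proof (induction j)
  case (Suc j)
  then show ?case
    using graded_op_commutator [OF graded_op_mult_of_nat Suc] by (simp add: conv_op_Suc)
qed (use graded_op_conv_op_0 in simp)

definition power_sum :: "nat \<Rightarrow> nat \<Rightarrow> complex" where
  "power_sum j r = (\<Sum>i=1..r. of_nat i ^ j)"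

lemma conv_op_one: "conv_op j (\<lambda>_. 1) r = power_sum j r"
  unfolding conv_op_def power_sum_def
  by (rule sum.reindex_bij_witness [where i = "\<lambda>i. r - i" and j = "\<lambda>s. r - s"]) auto

text \<open>The polynomial 1 is fixed by the reflection, so the polynomial representing its image
  has parity \<open>n\<close>.\<close>

lemma graded_op_one:
  assumes "graded_op n U"
  shows "\<exists>q c. (\<forall>r. U (\<lambda>_. 1) r + c = poly_seq q r) \<and> (\<forall>x. poly q (- 1 - x) = (- 1) ^ n * poly q x)"
proof -
  from assms obtain c where c: "reflective n (\<lambda>f r. U f r + c * f r)" by (auto simp: graded_op_def)
  have 1: "poly_seq 1 = (\<lambda>_. 1)" "reflect_m1 1 = 1" by (auto simp: poly_seq_def reflect_m1_def one_pCons pcompose_pCons)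
  from c [unfolded reflective_def, rule_format, of 1]
  obtain q where q: "\<forall>r. U (\<lambda>_. 1) r + c = poly_seq q r" "\<forall>r. U (\<lambda>_. 1) r + c = (- 1) ^ n * poly_seq (reflect_m1 q) r"
    unfolding 1 by auto
  have "q = smult ((- 1) ^ n) (reflect_m1 q)"
    by (rule poly_eq_of_nat) (use q in \<open>simp add: poly_seq_def\<close>)
  then have "poly q x = poly (smult ((- 1) ^ n) (reflect_m1 q)) x" for x
    by (rule arg_cong)
  then have *: "poly q x = (- 1) ^ n * poly q (- 1 - x)" for x
    unfolding poly_smult poly_reflect_m1 .
  have "poly q (- 1 - x) = (- 1) ^ n * poly q x" for x
    using * [of "- 1 - x"] by simp
  with q(1) show ?thesis by blast
qed

text \<open>The symmetry of the Faulhaber polynomial is read off from \<open>conv_op j\<close>,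
  whose value at 1 is \<open>power_sum j\<close>.\<close>

lemma graded_op_mult_power_sum: "graded_op (Suc j) (mult_op (power_sum j))"
proof -
  obtain c q where "\<And>r. conv_op j (\<lambda>_. 1) r + c = poly_seq q r" "\<And>x. poly q (- 1 - x) = (- 1) ^ Suc j * poly q x"
    using graded_op_one [OF graded_op_conv_op] by blast
  then show ?thesis by (intro graded_op_mult_op) (auto simp: conv_op_one power_sum_def)
qed

text \<open>If \<open>q\<close> has parity \<open>n\<close> under \<open>x -> -1 - x\<close>, its
  backward difference \<open>g\<close> satisfies \<open>g (- x) = - (- 1)^n g x\<close> and contains
  only monomials \<open>x^j\<close> with \<open>n + j\<close> odd. Summing \<open>g\<close> recovers
  \<open>q\<close> up to the constant fixed by \<open>U f 0 = 0\<close>.\<close>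

lemma graded_op_one_power_sums:
  assumes "graded_op n U"
  shows "\<exists>a J. finite J \<and> (\<forall>j\<in>J. odd (n + j)) \<and> (\<forall>r. U (\<lambda>_. 1) r = (\<Sum>j\<in>J. a j * power_sum j r))"
proof -
  obtain c q where q: "\<And>r. U (\<lambda>_. 1) r + c = poly_seq q r" "\<And>x. poly q (- 1 - x) = (- 1) ^ n * poly q x"
    using graded_op_one [OF assms] by blast
  define g where "g = q - pcompose q [:- 1, 1:]"
  have g: "poly g x = poly q x - poly q (x - 1)" for x
    by (simp add: g_def poly_pcompose)
  have "poly g (- x) = - ((- 1) ^ n) * poly g x" for x
  proof -
    have "poly q (- x - 1) = (- 1) ^ n * poly q x"
      using q(2) [of x] by (metis minus_diff_commute)
    then show ?thesis
      using q(2) [of "x - 1"] unfolding g by (simp add: algebra_simps)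
  qed
  then have "pcompose g [:0, - 1:] = smult (- ((- 1) ^ n)) g"
    by (intro poly_eq_of_nat) (simp add: poly_pcompose)
  then have "coeff (pcompose g [:0, - 1:]) j = - ((- 1) ^ n) * coeff g j" for j
    by simp
  then have coeff: "(- 1) ^ j * coeff g j = - ((- 1) ^ n) * coeff g j" for j
    by (simp add: coeff_pcompose_linear)
  let ?J = "{j. j \<le> degree g \<and> coeff g j \<noteq> 0}"
  have "odd (n + j)" if "j \<in> ?J" for j
  proof -
    have "(- 1) ^ j = - ((- 1 :: complex) ^ n)"
      using coeff [of j] that mult_right_cancel [of "coeff g j"] by blast
    then show ?thesis by (cases "even j"; cases "even n") auto
  qed
  moreover have "U (\<lambda>_. 1) r = (\<Sum>j\<in>?J. coeff g j * power_sum j r)" for r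
  proof -
    have "U (\<lambda>_. 1) r = poly_seq q r - poly_seq q 0"
      using q(1) [of r] q(1) [of 0] assms by (simp add: graded_op_def eq_diff_eq)
    also have "\<dots> = (\<Sum>i=1..r. poly g (of_nat i))"
      by (induction r) (auto simp: g poly_seq_def diff_eq_eq)
    also have "\<dots> = (\<Sum>i=1..r. \<Sum>j\<in>?J. coeff g j * of_nat i ^ j)"
      unfolding poly_altdef by (intro sum.cong refl sum.mono_neutral_right) auto
    also have "\<dots> = (\<Sum>j\<in>?J. coeff g j * power_sum j r)"
      unfolding power_sum_def sum_distrib_left by (rule sum.swap)
    finally show ?thesis .
  qed
  ultimately show ?thesis by (intro exI [of _ ?J] exI [of _ "coeff g"]) auto
qed

section \<open>Power series indexed by partitions\<close>

lemma zero_notin_Rep_partition [simp]: "0 \<notin># Rep_partition lam"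
  using Rep_partition [of lam] by simp

lemma Rep_Abs_partition: "0 \<notin># M \<Longrightarrow> Rep_partition (Abs_partition M) = M"
  by (simp add: Abs_partition_inverse)

text \<open>Splitting the multiset of parts becomes addition, so that the ring laws for
  \<open>pconv\<close> are reindexings of sums over \<open>a + b = lam\<close>.\<close>

instantiation partition :: cancel_comm_monoid_add
begin

definition "0 = Abs_partition {#}"
definition "a + b = Abs_partition (Rep_partition a + Rep_partition b)"
definition "a - b = Abs_partition (Rep_partition a - Rep_partition b)"

lemma Rep_partition_zero [simp]: "Rep_partition 0 = {#}"
  by (simp add: zero_partition_def Rep_Abs_partition)

lemma Rep_partition_plus [simp]: "Rep_partition (a + b) = Rep_partition a + Rep_partition b"
  by (simp add: plus_partition_def Rep_Abs_partition)

lemma Rep_partition_minus [simp]: "Rep_partition (a - b) = Rep_partition a - Rep_partition b"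
  using in_diffD by (fastforce simp: minus_partition_def intro: Rep_Abs_partition)

instance
  by standard (simp_all flip: Rep_partition_inject add: ac_simps)

end

definition parts :: "partition \<Rightarrow> nat set" where
  "parts lam = set_mset (Rep_partition lam)"

lemma finite_parts [simp]: "finite (parts lam)"
  by (simp add: parts_def)

lemma parts_pos: "m \<in> parts lam \<Longrightarrow> m > 0"
  using zero_notin_Rep_partition [of lam] by (auto simp: parts_def intro: Nat.gr0I)

lemma partition_eqI: "(\<And>m. mult m a = mult m b) \<Longrightarrow> a = b"
  by (metis Rep_partition_inject mult_def multiset_eqI)

lemma in_parts_iff: "m \<in> parts lam \<longleftrightarrow> mult m lam > 0"
  by (simp add: parts_def mult_def)

lemma mult_plus [simp]: "mult m (a + b) = mult m a + mult m b"
  and mult_0 [simp]: "mult m 0 = 0"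
  by (simp_all add: mult_def not_in_iff [symmetric])

definition upd :: "partition \<Rightarrow> nat \<Rightarrow> nat \<Rightarrow> partition" where
  "upd lam m r = Abs_partition (filter_mset (\<lambda>i. i \<noteq> m) (Rep_partition lam) + replicate_mset r m)"

lemma mult_upd: "m > 0 \<Longrightarrow> mult m' (upd lam m r) = (if m' = m then r else mult m' lam)"
  unfolding mult_def upd_def by (subst Rep_Abs_partition) (auto simp: not_in_iff [symmetric])

lemma upd_same [simp]: "m > 0 \<Longrightarrow> upd lam m (mult m lam) = lam"
  by (rule partition_eqI) (simp add: mult_upd)

lemma upd_upd [simp]: "m > 0 \<Longrightarrow> upd (upd lam m r) m s = upd lam m s"
  by (rule partition_eqI) (simp add: mult_upd)

lemma upd_commute: "m > 0 \<Longrightarrow> m' > 0 \<Longrightarrow> m \<noteq> m' \<Longrightarrow> upd (upd lam m r) m' s = upd (upd lam m' s) m r"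
  by (rule partition_eqI) (simp add: mult_upd)

lemma parts_upd: "m > 0 \<Longrightarrow> parts (upd lam m r) = (if r = 0 then parts lam - {m} else insert m (parts lam))"
  by (auto simp: in_parts_iff mult_upd split: if_splits)

lemma parts_0 [simp]: "parts 0 = {}"
  by (simp add: parts_def)

lemma psize_plus: "psize (a + b) = psize a + psize b"
  by (simp add: psize_def)

lemma psize_eq_0: "psize lam = 0 \<longleftrightarrow> lam = 0"
  by (auto simp: psize_def simp flip: Rep_partition_inject) (metis multiset_nonemptyE zero_notin_Rep_partition)

section \<open>Power series in u_1, u_2, ... as a commutative ring\<close>

definition splits :: "partition \<Rightarrow> (partition \<times> partition) set" where
  "splits lam = {(a, b). a + b = lam}"

lemma splits_iff: "(a, b) \<in> splits lam \<longleftrightarrow> a + b = lam"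
  by (simp add: splits_def)

lemma bij_splits:
  "bij_betw (\<lambda>a. (Abs_partition a, Abs_partition (Rep_partition lam - a))) {a. a \<subseteq># Rep_partition lam} (splits lam)"
proof (rule bij_betw_byWitness [where f' = "\<lambda>(a, b). Rep_partition a"])
  have *: "0 \<notin># a" "0 \<notin># Rep_partition lam - a" if "a \<subseteq># Rep_partition lam" for a
    using that by (auto dest: in_diffD mset_subset_eqD)
  show "\<forall>a\<in>{a. a \<subseteq># Rep_partition lam}.
       (case (Abs_partition a, Abs_partition (Rep_partition lam - a)) of (a, b) \<Rightarrow> Rep_partition a) = a"
    by (auto simp: * Rep_Abs_partition)
  show "\<forall>a'\<in>splits lam. (\<lambda>a. (Abs_partition a, Abs_partition (Rep_partition lam - a)))
       (case a' of (a, b) \<Rightarrow> Rep_partition a) = a'"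
    by (auto simp: splits_def Rep_partition_inverse)
  show "(\<lambda>a. (Abs_partition a, Abs_partition (Rep_partition lam - a))) ` {a. a \<subseteq># Rep_partition lam} \<subseteq> splits lam"
    by (auto simp: splits_def Rep_Abs_partition * simp flip: Rep_partition_inject)
  show "(\<lambda>(a, b). Rep_partition a) ` splits lam \<subseteq> {a. a \<subseteq># Rep_partition lam}"
    by (auto simp: splits_def)
qed

lemma finite_splits [simp]: "finite (splits lam)"
proof -
  have "{a. a \<subseteq># Rep_partition lam} \<subseteq> (\<Union>n\<le>size (Rep_partition lam). multisets_of_size (parts lam) n)"
    by (auto simp: multisets_of_size_def parts_def size_mset_mono dest: mset_subset_eqD)
  then have "finite {a. a \<subseteq># Rep_partition lam}"
    by (rule finite_subset) auto
  then show ?thesis using bij_betw_finite [OF bij_splits] by blast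
qed

lemma pconv_splits: "pconv F G lam = (\<Sum>(a, b)\<in>splits lam. F a * G b)"
  unfolding pconv_def by (simp add: sum.reindex_bij_betw [OF bij_splits, symmetric])

text \<open>A separate type, so that \<open>*\<close> can denote \<open>pconv\<close> and ring
  reasoning applies, while functions of partitions are multiplied pointwise.\<close>

typedef pser = "UNIV :: (partition \<Rightarrow> complex) set"
  morphisms coeffs Pser by simp

lemma coeffs_Pser [simp]: "coeffs (Pser f) = f"
  by (simp add: Pser_inverse)

lemma Pser_coeffs [simp]: "Pser (coeffs f) = f"
  by (simp add: coeffs_inverse)

lemma pser_eqI: "(\<And>lam. coeffs f lam = coeffs g lam) \<Longrightarrow> f = g"
  by (metis coeffs_inject ext)

instantiation pser :: comm_ring_1
begin

definition "0 = Pser (\<lambda>_. 0)"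
definition "1 = Pser (\<lambda>lam. if lam = 0 then 1 else 0)"
definition "f + g = Pser (\<lambda>lam. coeffs f lam + coeffs g lam)"
definition "f - g = Pser (\<lambda>lam. coeffs f lam - coeffs g lam)"
definition "- f = Pser (\<lambda>lam. - coeffs f lam)"
definition "f * g = Pser (pconv (coeffs f) (coeffs g))"

lemma coeffs_simps [simp]:
  "coeffs 0 lam = 0" "coeffs (f + g) lam = coeffs f lam + coeffs g lam"
  "coeffs (f - g) lam = coeffs f lam - coeffs g lam" "coeffs (- f) lam = - coeffs f lam"
  by (simp_all add: zero_pser_def plus_pser_def minus_pser_def uminus_pser_def)

lemma coeffs_1: "coeffs 1 lam = (if lam = 0 then 1 else 0)"
  by (simp add: one_pser_def)

lemma coeffs_times: "coeffs (f * g) = pconv (coeffs f) (coeffs g)"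
  by (simp add: times_pser_def)

lemma coeffs_mult: "coeffs (f * g) lam = (\<Sum>(a, b)\<in>splits lam. coeffs f a * coeffs g b)"
  by (simp add: coeffs_times pconv_splits)

instance
proof
  fix f g h :: pser
  show "f * g * h = f * (g * h)"
  proof (rule pser_eqI)
    fix lam
    have "coeffs (f * g * h) lam = (\<Sum>(ab, c)\<in>splits lam. \<Sum>(a, b)\<in>splits ab. coeffs f a * coeffs g b * coeffs h c)"
      by (simp add: coeffs_mult sum_distrib_right case_prod_beta')
    also have "\<dots> = (\<Sum>((ab, c), (a, b))\<in>Sigma (splits lam) (\<lambda>(ab, c). splits ab). coeffs f a * coeffs g b * coeffs h c)"
      by (subst sum.Sigma [symmetric]) (auto simp: case_prod_beta')
    also have "\<dots> = (\<Sum>((a, bc), (b, c))\<in>Sigma (splits lam) (\<lambda>(a, bc). splits bc). coeffs f a * (coeffs g b * coeffs h c))"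
      by (rule sum.reindex_bij_witness
          [where i = "\<lambda>((a, bc), (b, c)). ((a + b, c), (a, b))" and j = "\<lambda>((ab, c), (a, b)). ((a, b + c), (b, c))"])
        (auto simp: splits_def ac_simps)
    also have "\<dots> = (\<Sum>(a, bc)\<in>splits lam. \<Sum>(b, c)\<in>splits bc. coeffs f a * (coeffs g b * coeffs h c))"
      by (subst sum.Sigma [symmetric]) (auto simp: case_prod_beta')
    also have "\<dots> = coeffs (f * (g * h)) lam"
      by (simp add: coeffs_mult sum_distrib_left case_prod_beta')
    finally show "coeffs (f * g * h) lam = coeffs (f * (g * h)) lam" .
  qed
  show "f * g = g * f"
  proof (rule pser_eqI)
    fix lam
    show "coeffs (f * g) lam = coeffs (g * f) lam"
      unfolding coeffs_mult
      by (rule sum.reindex_bij_witness [where i = prod.swap and j = prod.swap]) (auto simp: splits_def ac_simps)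
  qed
  show "1 * f = f"
  proof (rule pser_eqI)
    fix lam
    have "coeffs (1 * f) lam = (\<Sum>(a, b)\<in>{(0 :: partition, lam)}. coeffs f b)"
      unfolding coeffs_mult by (rule sum.mono_neutral_cong_right) (auto simp: splits_iff coeffs_1 split: if_splits)
    then show "coeffs (1 * f) lam = coeffs f lam" by simp
  qed
  show "(f + g) * h = f * h + g * h"
    by (rule pser_eqI) (simp add: coeffs_mult case_prod_beta' distrib_right sum.distrib)
  show "(0 :: pser) \<noteq> 1"
  proof
    assume "(0 :: pser) = 1"
    then have "coeffs 0 0 = coeffs 1 0" by simp
    then show False by (simp add: coeffs_1)
  qed
qed (auto intro: pser_eqI)

end

definition cser :: "complex \<Rightarrow> pser" where
  "cser c = Pser (\<lambda>lam. if lam = 0 then c else 0)"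

lemma coeffs_cser_mult [simp]: "coeffs (cser c * f) lam = c * coeffs f lam"
proof -
  have "coeffs (cser c * f) lam = (\<Sum>(a, b)\<in>{(0 :: partition, lam)}. c * coeffs f b)"
    unfolding coeffs_mult by (rule sum.mono_neutral_cong_right) (auto simp: splits_iff cser_def split: if_splits)
  then show ?thesis by simp
qed

text \<open>Solves \<open>Z * zinv = 1\<close> for the term with \<open>a = 0\<close>; in the
  remaining terms \<open>a\<close> is nonzero and \<open>b\<close> has smaller size.\<close>

function zinv :: "partition \<Rightarrow> complex" where
  "zinv lam = (if lam = 0 then 1 else - (\<Sum>(a, b)\<in>splits lam - {(0, lam)}. zinv b))"
  by auto
termination
proof (relation "Wellfounded.measure psize")
  fix lam x a b
  assume "x \<in> splits lam - {(0, lam)}" "(a, b) = x"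
  then have "a + b = lam" "a \<noteq> 0" by (auto simp: splits_def)
  then show "(b, lam) \<in> Wellfounded.measure psize"
    using psize_eq_0 [of a] by (auto simp: psize_plus)
qed simp

declare zinv.simps [simp del]

definition Zser :: pser where "Zser = Pser uZ"
definition Zinv :: pser where "Zinv = Pser zinv"

lemma Zser_Zinv [simp]: "Zser * Zinv = 1"
proof (rule pser_eqI)
  fix lam
  have "coeffs (Zser * Zinv) lam = (\<Sum>(a, b)\<in>splits lam. zinv b)"
    by (simp add: coeffs_mult Zser_def Zinv_def uZ_def)
  also have "\<dots> = zinv lam + (\<Sum>(a, b)\<in>splits lam - {(0, lam)}. zinv b)"
    by (subst sum.remove [of _ "(0, lam)"]) (simp, simp add: splits_def, simp)
  also have "\<dots> = coeffs 1 lam"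
  proof (cases "lam = 0")
    case True
    have *: "splits 0 - {(0, 0)} = {}"
      by (auto simp: splits_def simp flip: Rep_partition_inject)
    show ?thesis unfolding True * by (simp add: coeffs_1 zinv.simps [of 0])
  next
    case False
    then show ?thesis by (simp add: coeffs_1) (subst zinv.simps, simp)
  qed
  finally show "coeffs (Zser * Zinv) lam = coeffs 1 lam" .
qed

section \<open>The u-bracket and the induced product\<close>

definition ub :: "(partition \<Rightarrow> complex) \<Rightarrow> pser" where
  "ub f = Zinv * Pser f"

lemma Zser_ub [simp]: "Zser * ub f = Pser f"
  unfolding ub_def by (simp flip: mult.assoc)

lemma ub_eqI: "Zser * h = Pser f \<Longrightarrow> ub f = h"
proof -
  assume "Zser * h = Pser f"
  then have "ub f = (Zser * Zinv) * h" by (simp add: ub_def mult_ac flip: \<open>Zser * h = Pser f\<close> del: Zser_Zinv)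
  then show ?thesis by simp
qed

lemma ub_inject: "ub f = ub g \<longleftrightarrow> f = g"
  by (metis Zser_ub coeffs_Pser)

lemma ubracket_eq: "ubracket f = coeffs (ub f)"
  unfolding ubracket_def
proof (rule the_equality)
  have "Pser (pconv uZ (coeffs (ub f))) = Zser * ub f" by (simp add: times_pser_def Zser_def)
  then show "pconv uZ (coeffs (ub f)) = f" by (metis Zser_ub coeffs_Pser)
  fix h assume "pconv uZ h = f"
  then have "Zser * Pser h = Pser f" by (simp add: times_pser_def Zser_def)
  then show "h = coeffs (ub f)" by (metis ub_eqI coeffs_Pser)
qed

text \<open>Invertibility of \<open>Zser\<close> makes \<open>ub\<close> a bijection, so the
  definite descriptions have exactly one solution and \<open>odot\<close> is multiplication of
  series transported along \<open>ub\<close>.\<close>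

lemma odot_eq: "odot f g = coeffs (Zser * (ub f * ub g))"
  unfolding odot_def
proof (rule the_equality)
  have *: "pconv (ubracket f) (ubracket g) = coeffs (ub f * ub g)"
    unfolding ubracket_eq coeffs_times ..
  show "ubracket (coeffs (Zser * (ub f * ub g))) = pconv (ubracket f) (ubracket g)"
    unfolding * unfolding ubracket_eq by (subst ub_eqI [of "ub f * ub g"]) simp_all
  fix h assume "ubracket h = pconv (ubracket f) (ubracket g)"
  then have "ub h = ub f * ub g" unfolding * unfolding ubracket_eq by (simp add: coeffs_inject)
  then show "h = coeffs (Zser * (ub f * ub g))" by (metis Zser_ub coeffs_Pser)
qed

lemma ub_odot: "ub (odot f g) = ub f * ub g"
  unfolding odot_eq by (rule ub_eqI) simp

lemma ub_add: "ub (\<lambda>x. f x + g x) = ub f + ub g"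
proof -
  have "Pser (\<lambda>x. f x + g x) = Pser f + Pser g" by (simp add: plus_pser_def)
  then show ?thesis by (simp add: ub_def distrib_left)
qed

lemma ub_smult: "ub (\<lambda>x. c * f x) = cser c * ub f"
proof -
  have "Pser (\<lambda>x. c * f x) = cser c * Pser f" by (rule pser_eqI) simp
  then show ?thesis by (simp add: ub_def mult.left_commute)
qed

lemma ub_const: "ub (\<lambda>_. c) = cser c"
  by (rule ub_eqI, subst mult.commute, rule pser_eqI) (simp add: Zser_def uZ_def)

section \<open>The two products on functions of partitions\<close>

text \<open>If \<open>F\<close> lives on partitions with a single distinct part, a contributing
  splitting of \<open>lam\<close> consists in removing \<open>i\<close> copies of one part
  \<open>m\<close>.\<close>

lemma conv_upd:
  assumes "\<And>a. F a \<noteq> 0 \<Longrightarrow> \<exists>m i. m > 0 \<and> i > 0 \<and> a = upd 0 m i"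
  shows "(\<Sum>(a, b)\<in>splits lam. F a * G b)
    = (\<Sum>m\<in>parts lam. \<Sum>i=1..mult m lam. F (upd 0 m i) * (G (upd lam m (mult m lam - i)) :: complex))"
proof -
  let ?S = "Sigma (parts lam) (\<lambda>m. {1..mult m lam})"
  let ?h = "\<lambda>(m, i). (upd 0 m i, upd lam m (mult m lam - i))"
  have inj: "inj_on ?h ?S"
  proof (rule inj_onI, clarify)
    fix m i m' i'
    assume mi: "m \<in> parts lam" "i \<in> {1..mult m lam}" "m' \<in> parts lam" "i' \<in> {1..mult m' lam}"
      and eq: "upd 0 m i = upd 0 m' i'"
    have "mult m (upd 0 m i) = mult m (upd 0 m' i')" "mult m' (upd 0 m i) = mult m' (upd 0 m' i')" using eq by simp_all
    then show "m = m' \<and> i = i'"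
      using mi parts_pos [of m lam] parts_pos [of m' lam] by (auto simp: mult_upd split: if_splits)
  qed
  have sub: "?h ` ?S \<subseteq> splits lam"
  proof clarify
    fix m i assume "m \<in> parts lam" "i \<in> {1..mult m lam}"
    then show "(upd 0 m i, upd lam m (mult m lam - i)) \<in> splits lam"
      using parts_pos [of m lam] by (auto simp: splits_def mult_upd intro!: partition_eqI)
  qed
  have zero: "F a * G b = 0" if "(a, b) \<in> splits lam" "(a, b) \<notin> ?h ` ?S" for a b
  proof (rule ccontr)
    assume "F a * G b \<noteq> 0"
    then obtain m i where mi: "m > 0" "i > 0" "a = upd 0 m i" using assms [of a] by auto
    have lam: "a + b = lam" using that by (simp add: splits_def)
    then have m: "mult m lam = i + mult m b" using mi by (auto simp: mult_upd)
    have "b = upd lam m (mult m lam - i)"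
      using mi by (intro partition_eqI) (auto simp: mult_upd m simp flip: lam)
    moreover have "(m, i) \<in> ?S" using mi m by (auto simp: in_parts_iff)
    ultimately show False using mi(3) that(2) by (metis (no_types, lifting) case_prod_conv imageI)
  qed
  have "(\<Sum>(a, b)\<in>splits lam. F a * G b) = (\<Sum>(a, b)\<in>?h ` ?S. F a * G b)"
    using sub zero by (intro sum.mono_neutral_right) auto
  also have "\<dots> = (\<Sum>(m, i)\<in>?S. F (upd 0 m i) * G (upd lam m (mult m lam - i)))"
    by (subst sum.reindex [OF inj]) (simp add: case_prod_beta')
  also have "\<dots> = (\<Sum>m\<in>parts lam. \<Sum>i=1..mult m lam. F (upd 0 m i) * G (upd lam m (mult m lam - i)))"
    by (rule sum.Sigma [symmetric]) auto
  finally show ?thesis .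
qed

definition prim :: "nat \<Rightarrow> nat \<Rightarrow> pser" where
  "prim k j = Pser (\<lambda>lam. if card (parts lam) = 1
     then of_nat (the_elem (parts lam)) ^ k * of_nat (mult (the_elem (parts lam)) lam) ^ j else 0)"

lemma card_parts_1:
  assumes "card (parts a) = 1"
  shows "\<exists>m. parts a = {m} \<and> m > 0 \<and> mult m a > 0 \<and> upd 0 m (mult m a) = a"
proof -
  obtain m where m: "parts a = {m}" using assms by (rule card_1_singletonE)
  have m0: "m > 0" using parts_pos [of m a] m by simp
  have "upd 0 m (mult m a) = a"
  proof (rule partition_eqI)
    fix m' show "mult m' (upd 0 m (mult m a)) = mult m' a"
      using m m0 in_parts_iff [of m' a] by (auto simp: mult_upd)
  qed
  moreover have "mult m a > 0" using m in_parts_iff [of m a] by simp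
  ultimately show ?thesis using m m0 by blast
qed

lemma coeffs_prim_upd: "m > 0 \<Longrightarrow> i > 0 \<Longrightarrow> coeffs (prim k j) (upd 0 m i) = of_nat m ^ k * of_nat i ^ j"
  by (simp add: prim_def parts_upd mult_upd)

lemma coeffs_prim_mult:
  "coeffs (prim k j * g) lam
    = (\<Sum>m\<in>parts lam. \<Sum>i=1..mult m lam. of_nat m ^ k * of_nat i ^ j * coeffs g (upd lam m (mult m lam - i)))"
proof -
  have "\<exists>m i. m > 0 \<and> i > 0 \<and> a = upd 0 m i" if "coeffs (prim k j) a \<noteq> 0" for a
  proof -
    from that have "card (parts a) = 1" by (auto simp: prim_def split: if_splits)
    then show ?thesis using card_parts_1 by metis
  qed
  then have "coeffs (prim k j * g) lam = (\<Sum>m\<in>parts lam. \<Sum>i=1..mult m lam. coeffs (prim k j) (upd 0 m i) * coeffs g (upd lam m (mult m lam - i)))"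
    unfolding coeffs_mult by (intro conv_upd) blast
  also have "\<dots> = (\<Sum>m\<in>parts lam. \<Sum>i=1..mult m lam. of_nat m ^ k * of_nat i ^ j * coeffs g (upd lam m (mult m lam - i)))"
    by (intro sum.cong refl) (simp add: coeffs_prim_upd parts_pos)
  finally show ?thesis .
qed

definition Agen :: "nat \<Rightarrow> nat \<Rightarrow> partition \<Rightarrow> complex" where
  "Agen k j lam = (\<Sum>m\<in>parts lam. of_nat m ^ k * power_sum j (mult m lam))"

text \<open>All coefficients of \<open>Zser\<close> are 1, so multiplying by it sums
  \<open>m^k i^j\<close> over the parts \<open>m\<close> and over all \<open>i\<close> from 1 to the
  multiplicity of \<open>m\<close>.\<close>

lemma ub_Agen: "ub (Agen k j) = prim k j"
proof (rule ub_eqI, subst mult.commute, rule pser_eqI)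
  fix lam
  show "coeffs (prim k j * Zser) lam = coeffs (Pser (Agen k j)) lam"
    by (simp add: coeffs_prim_mult Zser_def uZ_def Agen_def power_sum_def sum_distrib_left)
qed

section \<open>Operators acting on one multiplicity at a time\<close>

definition slot :: "seq_op \<Rightarrow> nat \<Rightarrow> (partition \<Rightarrow> complex) \<Rightarrow> partition \<Rightarrow> complex" where
  "slot U m f lam = U (\<lambda>r. f (upd lam m r)) (mult m lam)"

definition slot_sum :: "nat \<Rightarrow> seq_op \<Rightarrow> (partition \<Rightarrow> complex) \<Rightarrow> partition \<Rightarrow> complex" where
  "slot_sum k U f lam = (\<Sum>m\<in>parts lam. of_nat m ^ k * slot U m f lam)"

text \<open>\<open>U g 0 = 0\<close> says that an absent part contributes nothing, so the range may
  be enlarged to one independent of the partition.\<close>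

lemma slot_sum_superset:
  assumes "\<And>g. U g 0 = 0" "finite N" "parts lam \<subseteq> N"
  shows "slot_sum k U f lam = (\<Sum>m\<in>N. of_nat m ^ k * slot U m f lam)"
  unfolding slot_sum_def
  by (rule sum.mono_neutral_left) (use assms in \<open>auto simp: slot_def in_parts_iff\<close>)

lemma slot_sum_add:
  assumes "triangular U"
  shows "slot_sum k U (\<lambda>x. f x + g x) lam = slot_sum k U f lam + slot_sum k U g lam"
  by (simp add: slot_sum_def slot_def triangular_add [OF assms] distrib_left sum.distrib)

lemma slot_sum_smult:
  assumes "triangular U"
  shows "slot_sum k U (\<lambda>x. c * f x) lam = c * slot_sum k U f lam"
  by (simp add: slot_sum_def slot_def triangular_scale [OF assms] sum_distrib_left mult.left_commute)

lemma slot_commute: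
  assumes "triangular U" "triangular V" "m > 0" "m' > 0" "m \<noteq> m'"
  shows "slot U m (slot V m' f) lam = slot V m' (slot U m f) lam"
proof -
  from assms obtain K L where K: "\<And>f r. U f r = (\<Sum>s\<le>r. K r s * f s)" and L: "\<And>f r. V f r = (\<Sum>s\<le>r. L r s * f s)"
    unfolding triangular_def by blast
  show ?thesis
    using assms(3-5) unfolding slot_def K L sum_distrib_left
    by (simp add: mult_upd) (subst sum.swap, simp add: upd_commute [of m m'] mult.left_commute)
qed

text \<open>The outer operator evaluates the inner sum at altered partitions, among them
  \<open>upd lam m 0\<close>, which has lost the part \<open>m\<close>; by \<open>V0\<close> the
  inner sum may still run over \<open>parts lam\<close>.\<close>

lemma slot_sum_slot_sum:
  assumes U: "triangular U" and V: "triangular V" and V0: "\<And>g. V g 0 = 0"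
  shows "slot_sum k U (slot_sum l V f) lam
    = (\<Sum>m\<in>parts lam. \<Sum>m'\<in>parts lam. of_nat m ^ k * of_nat m' ^ l * slot U m (slot V m' f) lam)"
proof -
  have "slot U m (slot_sum l V f) lam = (\<Sum>m'\<in>parts lam. of_nat m' ^ l * slot U m (slot V m' f) lam)"
    if "m \<in> parts lam" for m
  proof -
    have "slot_sum l V f (upd lam m r) = (\<Sum>m'\<in>parts lam. of_nat m' ^ l * slot V m' f (upd lam m r))" for r
      using that parts_pos [OF that] by (intro slot_sum_superset V0) (auto simp: parts_upd)
    then have "slot U m (slot_sum l V f) lam
        = U (\<lambda>r. \<Sum>m'\<in>parts lam. of_nat m' ^ l * slot V m' f (upd lam m r)) (mult m lam)"
      by (simp add: slot_def [of U])
    then show ?thesis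
      by (simp add: triangular_sum [OF U] triangular_scale [OF U] slot_def [of U])
  qed
  then show ?thesis
    by (simp add: slot_sum_def [of _ U] sum_distrib_left mult.assoc)
qed

text \<open>Operators on different multiplicities commute, so only the terms with
  \<open>m = m'\<close> survive, and there \<open>m^k * m^l = m^(k + l)\<close>.\<close>

lemma slot_sum_commutator:
  assumes U: "triangular U" and V: "triangular V" and U0: "\<And>g. U g 0 = 0" and V0: "\<And>g. V g 0 = 0"
  shows "slot_sum k U (slot_sum l V f) lam
    = slot_sum l V (slot_sum k U f) lam + slot_sum (k + l) (commutator U V) f lam"
proof -
  let ?P = "parts lam"
  have "slot_sum l V (slot_sum k U f) lam
    = (\<Sum>m\<in>?P. \<Sum>m'\<in>?P. of_nat m ^ k * of_nat m' ^ l * slot V m' (slot U m f) lam)"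
    unfolding slot_sum_slot_sum [OF V U U0] by (subst sum.swap) (simp add: mult_ac)
  then have "slot_sum k U (slot_sum l V f) lam - slot_sum l V (slot_sum k U f) lam
    = (\<Sum>m\<in>?P. \<Sum>m'\<in>?P. of_nat m ^ k * of_nat m' ^ l * (slot U m (slot V m' f) lam - slot V m' (slot U m f) lam))"
    unfolding slot_sum_slot_sum [OF U V V0] by (simp add: sum_subtractf right_diff_distrib)
  also have "\<dots> = (\<Sum>m\<in>?P. \<Sum>m'\<in>?P. if m' = m then of_nat m ^ (k + l) * slot (commutator U V) m f lam else 0)"
  proof (intro sum.cong refl)
    fix m m' assume m: "m \<in> ?P" "m' \<in> ?P"
    show "of_nat m ^ k * of_nat m' ^ l * (slot U m (slot V m' f) lam - slot V m' (slot U m f) lam)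
      = (if m' = m then of_nat m ^ (k + l) * slot (commutator U V) m f lam else 0)"
    proof (cases "m' = m")
      case True
      have "slot U m (slot V m f) lam = U (V (\<lambda>r. f (upd lam m r))) (mult m lam)"
        and "slot V m (slot U m f) lam = V (U (\<lambda>r. f (upd lam m r))) (mult m lam)"
        using m parts_pos by (simp_all add: slot_def mult_upd)
      then show ?thesis using True by (simp add: commutator_def slot_def power_add)
    next
      case False
      then show ?thesis
        using slot_commute [OF U V, of m m' f lam] m parts_pos by simp
    qed
  qed
  also have "\<dots> = slot_sum (k + l) (commutator U V) f lam"
    by (simp add: slot_sum_def)
  finally show ?thesis by (simp add: algebra_simps)
qed

section \<open>The pointwise and the induced algebra coincide\<close>

lemma slot_sum_mult_op: "slot_sum k (mult_op (power_sum j)) f lam = Agen k j lam * f lam"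
  by (simp add: slot_sum_def slot_def mult_op_def Agen_def sum_distrib_right mult.assoc parts_pos)

lemma mult_op_power_sum_one: "mult_op (power_sum j) (\<lambda>_. 1) r = power_sum j r"
  by (simp add: mult_op_def)

text \<open>Multiplication by \<open>prim k j\<close> removes \<open>i\<close> copies of a part
  \<open>m\<close> with weight \<open>m^k i^j\<close>, which is \<open>conv_op j\<close> acting on
  the multiplicity of \<open>m\<close>.\<close>

lemma slot_sum_conv_op: "slot_sum k (conv_op j) f = odot (Agen k j) f"
proof
  fix lam
  have "Zser * (prim k j * ub f) = prim k j * (Zser * ub f)"
    by (simp only: mult.left_commute)
  then have "odot (Agen k j) f lam = coeffs (prim k j * Pser f) lam"
    by (simp add: odot_eq ub_Agen)
  also have "\<dots> = (\<Sum>m\<in>parts lam. of_nat m ^ k * (\<Sum>i=1..mult m lam. of_nat i ^ j * f (upd lam m (mult m lam - i))))"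
    by (simp add: coeffs_prim_mult sum_distrib_left mult.assoc)
  also have "\<dots> = slot_sum k (conv_op j) f lam"
    unfolding slot_sum_def slot_def conv_op_def
  proof (rule sum.cong [OF refl])
    fix m
    have "(\<Sum>i=1..mult m lam. of_nat i ^ j * f (upd lam m (mult m lam - i)))
      = (\<Sum>s<mult m lam. of_nat (mult m lam - s) ^ j * f (upd lam m s))"
      by (rule sum.reindex_bij_witness [where i = "\<lambda>s. mult m lam - s" and j = "\<lambda>i. mult m lam - i"]) auto
    then show "of_nat m ^ k * (\<Sum>i=1..mult m lam. of_nat i ^ j * f (upd lam m (mult m lam - i)))
      = of_nat m ^ k * (\<Sum>s<mult m lam. of_nat (mult m lam - s) ^ j * f (upd lam m s))"
      by simp
  qed
  finally show "slot_sum k (conv_op j) f lam = odot (Agen k j) f lam" by simp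
qed

text \<open>Closure is demanded under application of one generator, not under products. With
  \<open>conv_op\<close> this application is \<open>odot\<close>-multiplication, with
  \<open>mult_op (power_sum j)\<close> it is pointwise multiplication, so that one induction serves
  both algebras.\<close>

inductive_set gen_alg :: "(nat \<Rightarrow> seq_op) \<Rightarrow> (partition \<Rightarrow> complex) set" for B where
  const: "(\<lambda>_. c) \<in> gen_alg B"
| add: "f \<in> gen_alg B \<Longrightarrow> g \<in> gen_alg B \<Longrightarrow> (\<lambda>x. f x + g x) \<in> gen_alg B"
| gen: "odd (k + j) \<Longrightarrow> f \<in> gen_alg B \<Longrightarrow> slot_sum k (B j) f \<in> gen_alg B"

context
  fixes B :: "nat \<Rightarrow> seq_op"
  assumes B: "\<And>j. graded_op (Suc j) (B j)" and B1: "\<And>j r. B j (\<lambda>_. 1) r = power_sum j r"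
begin

lemma gen_alg_smult: "f \<in> gen_alg B \<Longrightarrow> (\<lambda>x. c * f x) \<in> gen_alg B"
proof (induction rule: gen_alg.induct)
  case (gen k j f)
  have "slot_sum k (B j) (\<lambda>x. c * f x) = (\<lambda>x. c * slot_sum k (B j) f x)"
    using B [of j] by (auto simp: slot_sum_smult graded_op_def)
  then show ?case using gen_alg.gen [OF gen.hyps(1) gen.IH] by simp
qed (auto simp: distrib_left intro: gen_alg.intros)

lemma gen_alg_sum: "finite J \<Longrightarrow> (\<And>j. j \<in> J \<Longrightarrow> f j \<in> gen_alg B) \<Longrightarrow> (\<lambda>x. \<Sum>j\<in>J. f j x) \<in> gen_alg B"
  by (induction J rule: finite_induct) (auto intro: gen_alg.intros)

lemma gen_alg_Agen: "odd (k + j) \<Longrightarrow> Agen k j \<in> gen_alg B"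
proof -
  assume "odd (k + j)"
  then have "slot_sum k (B j) (\<lambda>_. 1) \<in> gen_alg B" by (intro gen_alg.intros)
  moreover have "slot_sum k (B j) (\<lambda>_. 1) = Agen k j"
    by (rule ext) (simp add: slot_sum_def slot_def B1 Agen_def)
  ultimately show ?thesis by simp
qed

text \<open>Stability under every slot sum of the right parity, not only under the generators, is
  what links the two products. \<open>U\<close> must stay arbitrary in the induction: moving it past
  a generator produces the commutator of \<open>U\<close> and \<open>B j\<close>, graded of degree
  \<open>n + Suc j\<close>, to which the hypothesis is applied. On constants, \<open>U\<close>
  yields power sums of the admissible parity.\<close>

lemma gen_alg_slot_sum:
  assumes "f \<in> gen_alg B" "graded_op n U" "even (k + n)"
  shows "slot_sum k U f \<in> gen_alg B"
  using assms
proof (induction arbitrary: k n U rule: gen_alg.induct)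
  case (const c)
  then have tri: "triangular U" by (simp add: graded_op_def)
  obtain a J where J: "finite J" "\<forall>j\<in>J. odd (n + j)" "\<forall>r. U (\<lambda>_. 1) r = (\<Sum>j\<in>J. a j * power_sum j r)"
    using graded_op_one_power_sums [OF const(1)] by blast
  have "slot_sum k U (\<lambda>_. c) lam = (\<Sum>j\<in>J. c * a j * Agen k j lam)" for lam
  proof -
    have "slot_sum k U (\<lambda>_. c) lam = c * slot_sum k U (\<lambda>_. 1) lam"
      using slot_sum_smult [OF tri, of k c "\<lambda>_. 1"] by simp
    also have "slot_sum k U (\<lambda>_. 1) lam = (\<Sum>m\<in>parts lam. \<Sum>j\<in>J. a j * (of_nat m ^ k * power_sum j (mult m lam)))"
      by (simp add: slot_sum_def slot_def J(3) sum_distrib_left mult_ac)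
    also have "\<dots> = (\<Sum>j\<in>J. a j * Agen k j lam)"
      by (subst sum.swap) (simp add: Agen_def sum_distrib_left)
    finally show ?thesis by (simp add: sum_distrib_left mult.assoc)
  qed
  then have "slot_sum k U (\<lambda>_. c) = (\<lambda>lam. \<Sum>j\<in>J. c * a j * Agen k j lam)" by blast
  moreover have "odd (k + j)" if "j \<in> J" for j using J(2) that const(2) by auto
  ultimately show ?case using J(1) by (auto intro!: gen_alg_sum gen_alg_smult gen_alg_Agen)
next
  case (add f g)
  then have "slot_sum k U (\<lambda>x. f x + g x) = (\<lambda>x. slot_sum k U f x + slot_sum k U g x)"
    by (auto simp: slot_sum_add graded_op_def)
  with add show ?case by (simp add: gen_alg.add)
next
  case (gen l j f)
  have "slot_sum k U (slot_sum l (B j) f)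
      = (\<lambda>lam. slot_sum l (B j) (slot_sum k U f) lam + slot_sum (k + l) (commutator U (B j)) f lam)"
    using B [of j] gen.prems(1) by (intro ext slot_sum_commutator) (auto simp: graded_op_def)
  moreover have "slot_sum (k + l) (commutator U (B j)) f \<in> gen_alg B"
    using gen by (intro gen.IH [OF graded_op_commutator [OF gen.prems(1) B]]) simp
  ultimately show ?case
    using gen by (simp add: gen_alg.intros)
qed

end

abbreviation odot_alg :: "(partition \<Rightarrow> complex) set" where
  "odot_alg \<equiv> gen_alg conv_op"

abbreviation pt_alg :: "(partition \<Rightarrow> complex) set" where
  "pt_alg \<equiv> gen_alg (\<lambda>j. mult_op (power_sum j))"

lemmas odot_alg_slot_sum = gen_alg_slot_sum [OF graded_op_conv_op conv_op_one]

lemmas pt_alg_slot_sum = gen_alg_slot_sum [OF graded_op_mult_power_sum mult_op_power_sum_one]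

text \<open>As \<open>odd (k + j)\<close> makes \<open>k + Suc j\<close> even, the generators of
  either algebra are slot sums under which the other one is stable.\<close>

lemma odot_alg_eq_pt_alg: "odot_alg = pt_alg"
proof (intro subset_antisym subsetI)
  fix f assume "f \<in> odot_alg"
  then show "f \<in> pt_alg"
    by induction (auto intro!: gen_alg.const gen_alg.add pt_alg_slot_sum [OF _ graded_op_conv_op])
next
  fix f assume "f \<in> pt_alg"
  then show "f \<in> odot_alg"
    by induction (auto intro!: gen_alg.const gen_alg.add odot_alg_slot_sum [OF _ graded_op_mult_power_sum])
qed

lemma pt_alg_mult: "f \<in> pt_alg \<Longrightarrow> g \<in> pt_alg \<Longrightarrow> (\<lambda>x. f x * g x) \<in> pt_alg"
proof (induction rule: gen_alg.induct)
  case (const c)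
  then show ?case by (rule gen_alg_smult [OF graded_op_mult_power_sum mult_op_power_sum_one])
next
  case (gen k j f)
  have "(\<lambda>x. slot_sum k (mult_op (power_sum j)) f x * g x) = slot_sum k (mult_op (power_sum j)) (\<lambda>x. f x * g x)"
    by (simp add: slot_sum_mult_op fun_eq_iff)
  with gen gen_alg.gen [of k j "\<lambda>x. f x * g x" "\<lambda>j. mult_op (power_sum j)"]
  show ?case by simp
qed (auto simp: distrib_right intro: gen_alg.add)

definition Tconst :: "nat \<Rightarrow> nat \<Rightarrow> complex" where
  "Tconst k j = - bern (k + j + 1) / (2 * of_nat (k + j + 1)) * ((if j = 0 then 1 else 0) + (if k = 0 then 1 else 0))"

lemma Tkl_eq: "Tkl (int k) (int j + 1) = (\<lambda>x. Tconst k j + Agen k j x)"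
  by (rule ext) (auto simp: Tkl_def Tconst_def Agen_def bern_def faulhaber_def power_sum_def parts_def nat_add_distrib)

lemma Tkl_index_cases:
  assumes "k \<ge> 0" "l \<ge> 1" "even (k + l :: int)"
  obtains k' j where "k = int k'" "l = int j + 1" "odd (k' + j)"
proof
  show "k = int (nat k)" "l = int (nat (l - 1)) + 1" using assms by auto
  have "int (nat k + nat (l - 1)) = k + l - 1" using assms by auto
  moreover have "odd (k + l - 1)" using assms(3) by simp
  ultimately show "odd (nat k + nat (l - 1))" by (metis even_of_nat)
qed

lemma Agen_in_Talg: "odd (k + j) \<Longrightarrow> Agen k j \<in> Talg"
proof -
  assume "odd (k + j)"
  then have "Tkl (int k) (int j + 1) \<in> Talg" by (intro Talg.gen) auto
  from Talg.add [OF this Talg.const [of "- Tconst k j"]] show ?thesis by (simp add: Tkl_eq)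
qed

lemma Talg_eq_pt_alg: "Talg = pt_alg"
proof (intro subset_antisym subsetI)
  fix f assume "f \<in> Talg"
  then show "f \<in> pt_alg"
  proof induction
    case (gen k l)
    then obtain k' j where *: "k = int k'" "l = int j + 1" "odd (k' + j)" by (rule Tkl_index_cases)
    have "Agen k' j \<in> pt_alg"
      by (rule gen_alg_Agen [OF graded_op_mult_power_sum mult_op_power_sum_one *(3)])
    then show ?case unfolding * Tkl_eq by (intro gen_alg.intros)
  qed (auto intro: gen_alg.intros pt_alg_mult)
next
  fix f assume "f \<in> pt_alg"
  then show "f \<in> Talg"
  proof induction
    case (gen k j f)
    then show ?case
      using Talg.mul [OF Agen_in_Talg] by (simp add: slot_sum_mult_op [abs_def])
  qed (auto intro: Talg.intros)
qed

lemma Talg_eq_odot_alg: "Talg = odot_alg"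
  by (simp add: Talg_eq_pt_alg odot_alg_eq_pt_alg)

text \<open>Although \<open>Talg\<close> is generated pointwise, its elements can be peeled by
  \<open>odot\<close>; claims about derivations and brackets are proved by this induction.\<close>

lemma Talg_odot_induct [consumes 1, case_names const add odot]:
  assumes "f \<in> Talg"
    and "\<And>c. P (\<lambda>_. c)"
    and "\<And>f g. f \<in> Talg \<Longrightarrow> P f \<Longrightarrow> g \<in> Talg \<Longrightarrow> P g \<Longrightarrow> P (\<lambda>x. f x + g x)"
    and "\<And>k j f. odd (k + j) \<Longrightarrow> f \<in> Talg \<Longrightarrow> P f \<Longrightarrow> P (odot (Agen k j) f)"
  shows "P f"
  using assms(1) unfolding Talg_eq_odot_alg
  by (induction rule: gen_alg.induct) (use assms(2-) in \<open>auto simp: slot_sum_conv_op Talg_eq_odot_alg\<close>)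

section \<open>The q-bracket\<close>

lemma size_le_sum_mset: "0 \<notin># M \<Longrightarrow> size M \<le> sum_mset (M :: nat multiset)"
  by (induction M) auto

lemma finite_psize [simp]: "finite {lam. psize lam = n}"
proof -
  have "Rep_partition ` {lam. psize lam = n} \<subseteq> (\<Union>k\<le>n. multisets_of_size {..n} k)"
  proof clarify
    fix lam assume n: "n = psize lam"
    have "size (Rep_partition lam) \<le> psize lam"
      unfolding psize_def by (rule size_le_sum_mset) simp
    moreover have "m \<le> psize lam" if "m \<in># Rep_partition lam" for m
      unfolding psize_def using multi_member_split [OF that] by auto
    ultimately show "Rep_partition lam \<in> (\<Union>k\<le>psize lam. multisets_of_size {..psize lam} k)"
      by (auto simp: multisets_of_size_def)
  qed
  then have "finite (Rep_partition ` {lam. psize lam = n})"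
    by (rule finite_subset) auto
  then show ?thesis
    by (rule finite_imageD) (simp add: inj_on_def Rep_partition_inject)
qed

text \<open>The substitution \<open>u_m = q^m\<close>, a ring homomorphism because
  \<open>psize\<close> is additive.\<close>

definition qseries :: "pser \<Rightarrow> complex fps" where
  "qseries f = Abs_fps (\<lambda>n. \<Sum>lam | psize lam = n. coeffs f lam)"

lemma qseries_add: "qseries (f + g) = qseries f + qseries g"
  by (rule fps_ext) (simp add: qseries_def sum.distrib)

lemma qseries_cser_mult: "qseries (cser c * f) = fps_const c * qseries f"
  by (rule fps_ext) (simp add: qseries_def sum_distrib_left)

lemma psize_0: "{lam. psize lam = 0} = {0}"
  using psize_eq_0 by auto

lemma qseries_1: "qseries 1 = 1"
proof (rule fps_ext)
  fix n
  show "qseries 1 $ n = 1 $ n"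
  proof (cases "n = 0")
    case False
    have "(\<Sum>lam | psize lam = n. coeffs 1 lam) = 0"
      by (rule sum.neutral) (use False psize_eq_0 [of 0] in \<open>auto simp: coeffs_1\<close>)
    then show ?thesis using False by (simp add: qseries_def)
  qed (simp add: qseries_def psize_eq_0 coeffs_1)
qed

lemma qseries_cser: "qseries (cser c) = fps_const c"
  using qseries_cser_mult [of c 1] by (simp add: qseries_1)

lemma qseries_mult: "qseries (f * g) = qseries f * qseries g"
proof (rule fps_ext)
  fix n
  have "(qseries f * qseries g) $ n
      = (\<Sum>i\<in>{0..n}. \<Sum>(a, b)\<in>{a. psize a = i} \<times> {b. psize b = n - i}. coeffs f a * coeffs g b)"
    by (simp add: fps_mult_nth qseries_def sum_product sum.cartesian_product)
  also have "\<dots> = (\<Sum>(i, (a, b))\<in>Sigma {0..n} (\<lambda>i. {a. psize a = i} \<times> {b. psize b = n - i}). coeffs f a * coeffs g b)"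
    by (subst sum.Sigma) (auto simp: case_prod_beta')
  also have "\<dots> = (\<Sum>(lam, (a, b))\<in>Sigma {lam. psize lam = n} splits. coeffs f a * coeffs g b)"
    by (rule sum.reindex_bij_witness
        [where i = "\<lambda>(lam, (a, b)). (psize a, (a, b))" and j = "\<lambda>(i, (a, b)). (a + b, (a, b))"])
      (auto simp: splits_iff psize_plus)
  also have "\<dots> = (\<Sum>lam | psize lam = n. \<Sum>(a, b)\<in>splits lam. coeffs f a * coeffs g b)"
    by (subst sum.Sigma) (auto simp: case_prod_beta')
  also have "\<dots> = qseries (f * g) $ n"
    by (simp add: qseries_def coeffs_mult)
  finally show "qseries (f * g) $ n = (qseries f * qseries g) $ n" by simp
qed

lemma qbracket_eq: "qbracket f = qseries (ub f)"
proof -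
  have "qnum f = qseries Zser * qseries (ub f)"
    unfolding qseries_mult [symmetric] Zser_ub by (simp add: qnum_def qseries_def)
  moreover have "qnum (\<lambda>_. 1) = qseries Zser"
    by (simp add: qnum_def qseries_def Zser_def uZ_def)
  moreover have "qseries Zser $ 0 = 1"
    by (simp add: qseries_def psize_0 Zser_def uZ_def)
  then have "qseries Zser \<noteq> 0" by auto
  ultimately show ?thesis by (simp add: qbracket_def qseries_mult)
qed

lemma psize_upd_0: "m > 0 \<Longrightarrow> psize (upd 0 m i) = m * i"
  unfolding psize_def upd_def by (subst Rep_Abs_partition) (auto simp: sum_mset_replicate_mset)

lemma qseries_prim: "qseries (prim k j) = dsum k j"
proof (rule fps_ext)
  fix n
  have "qseries (prim k j) $ n = (\<Sum>lam | psize lam = n \<and> card (parts lam) = 1. coeffs (prim k j) lam)"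
    unfolding qseries_def fps_nth_Abs_fps
    by (rule sum.mono_neutral_right) (auto simp: prim_def)
  also have "\<dots> = (\<Sum>(m, i)\<in>divs n. of_nat m ^ k * of_nat i ^ j)"
  proof (rule sum.reindex_bij_witness [where i = "\<lambda>(m, i). upd 0 m i"
        and j = "\<lambda>lam. (the_elem (parts lam), mult (the_elem (parts lam)) lam)"], goal_cases)
    case (1 lam)
    then obtain m where "parts lam = {m}" "upd 0 m (mult m lam) = lam" using card_parts_1 by blast
    then show ?case by simp
  next
    case (2 lam)
    then obtain m where m: "parts lam = {m}" "m > 0" "mult m lam > 0" "upd 0 m (mult m lam) = lam"
      using card_parts_1 by blast
    moreover have "m * mult m lam = n" using m 2 psize_upd_0 [of m "mult m lam"] by simp
    ultimately show ?case by (simp add: divs_def)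
  qed (auto simp: divs_def parts_upd mult_upd psize_upd_0 prim_def)
  finally show "qseries (prim k j) $ n = dsum k j $ n" by (simp add: dsum_def)
qed

lemma qbracket_add: "qbracket (\<lambda>x. f x + g x) = qbracket f + qbracket g"
  and qbracket_smult: "qbracket (\<lambda>x. c * f x) = fps_const c * qbracket f"
  and qbracket_const: "qbracket (\<lambda>_. c) = fps_const c"
  and qbracket_odot: "qbracket (odot f g) = qbracket f * qbracket g"
  by (simp_all add: qbracket_eq ub_add ub_smult ub_const ub_odot qseries_add qseries_cser_mult
      qseries_cser qseries_mult)

lemma qbracket_Agen: "qbracket (Agen k j) = dsum k j"
  by (simp add: qbracket_eq ub_Agen qseries_prim)

lemma qbracket_Tkl: "qbracket (Tkl (int k) (int j + 1)) = eis_gen k j"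
  unfolding Tkl_eq qbracket_add qbracket_const qbracket_Agen
  by (simp add: eis_gen_def Tconst_def eis_const_def)

section \<open>Coefficients of products of generators\<close>

lemma sum_sum_mset_swap: "(\<Sum>m\<in>A. \<Sum>c\<in>#M. f m c) = (\<Sum>c\<in>#M. \<Sum>m\<in>A. f m c :: 'a :: comm_monoid_add)"
  by (induction M) (simp_all add: sum.distrib)

definition monom_ser :: "(nat \<times> nat) multiset \<Rightarrow> pser" where
  "monom_ser M = (\<Prod>(k, j)\<in>#M. prim k j)"

lemma monom_ser_simps [simp]:
  "monom_ser {#} = 1" "monom_ser (add_mset (k, j) M) = prim k j * monom_ser M"
  by (simp_all add: monom_ser_def)

lemma card_parts_upd_0: "m \<in> parts lam \<Longrightarrow> card (parts (upd lam m 0)) = card (parts lam) - 1"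
  using parts_pos [of m lam] by (simp add: parts_upd)

text \<open>Each factor \<open>prim k j\<close> involves a single part size, so
  \<open>size M\<close> factors reach at most \<open>size M\<close> distinct parts.\<close>

lemma monom_ser_vanish: "size M < card (parts lam) \<Longrightarrow> coeffs (monom_ser M) lam = 0"
proof (induction M arbitrary: lam)
  case empty
  then have "lam \<noteq> 0" by auto
  then show ?case by (simp add: coeffs_1)
next
  case (add b M)
  obtain k j where b: "b = (k, j)" by fastforce
  have "coeffs (monom_ser M) (upd lam m (mult m lam - i)) = 0" if m: "m \<in> parts lam" for m i
  proof (rule add.IH)
    have "card (parts lam) - 1 \<le> card (parts (upd lam m (mult m lam - i)))"
      using m parts_pos [OF m] by (auto simp: parts_upd insert_absorb)
    then show "size M < card (parts (upd lam m (mult m lam - i)))" using add.prems by simp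
  qed
  then show ?case by (simp add: b coeffs_prim_mult)
qed

text \<open>With as many distinct parts as factors, each factor must use up all copies of one part,
  and the coefficient is the permanent of the matrix with entries \<open>m^k r^j\<close>,
  \<open>r\<close> being the multiplicity of \<open>m\<close>. This is its expansion along the row
  of the factor \<open>(k, j)\<close>.\<close>

lemma monom_ser_row:
  assumes "card (parts lam) = Suc (size M)"
  shows "coeffs (prim k j * monom_ser M) lam
    = (\<Sum>m\<in>parts lam. of_nat m ^ k * of_nat (mult m lam) ^ j * coeffs (monom_ser M) (upd lam m 0))"
  unfolding coeffs_prim_mult
proof (rule sum.cong [OF refl])
  fix m assume m: "m \<in> parts lam"
  have "(\<Sum>i=1..mult m lam. of_nat m ^ k * of_nat i ^ j * coeffs (monom_ser M) (upd lam m (mult m lam - i)))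
    = (\<Sum>i\<in>{mult m lam}. of_nat m ^ k * of_nat i ^ j * coeffs (monom_ser M) (upd lam m (mult m lam - i)))"
  proof (rule sum.mono_neutral_right)
    show "\<forall>i\<in>{1..mult m lam} - {mult m lam}. of_nat m ^ k * of_nat i ^ j * coeffs (monom_ser M) (upd lam m (mult m lam - i)) = 0"
    proof
      fix i assume "i \<in> {1..mult m lam} - {mult m lam}"
      then have "parts (upd lam m (mult m lam - i)) = parts lam"
        using m parts_pos [OF m] by (auto simp: parts_upd)
      then show "of_nat m ^ k * of_nat i ^ j * coeffs (monom_ser M) (upd lam m (mult m lam - i)) = 0"
        using assms by (simp add: monom_ser_vanish)
    qed
  qed (use m in \<open>auto simp: in_parts_iff\<close>)
  then show "(\<Sum>i=1..mult m lam. of_nat m ^ k * of_nat i ^ j * coeffs (monom_ser M) (upd lam m (mult m lam - i)))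
    = of_nat m ^ k * of_nat (mult m lam) ^ j * coeffs (monom_ser M) (upd lam m 0)" by simp
qed

text \<open>The same permanent expanded along the column of the new part \<open>t\<close> with
  multiplicity \<open>i\<close>: a row is expanded first, the smaller permanents along their column
  by induction, and the two sums are exchanged.\<close>

lemma monom_ser_column:
  assumes "t > 0" "i > 0" "t \<notin> parts lam" "size M = Suc (card (parts lam))"
  shows "coeffs (monom_ser M) (upd lam t i)
    = (\<Sum>(k, j)\<in>#M. of_nat t ^ k * of_nat i ^ j * coeffs (monom_ser (M - {#(k, j)#})) lam)"
  using assms(3,4)
proof (induction M arbitrary: lam)
  case (add b M)
  obtain k0 j0 where b: "b = (k0, j0)" by fastforce
  let ?w = "\<lambda>m. of_nat m ^ k0 * of_nat (mult m lam) ^ j0 :: complex"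
  let ?v = "\<lambda>(k, j). of_nat t ^ k * of_nat i ^ j :: complex"
  have sz: "size M = card (parts lam)" using add.prems by simp
  have mt0: "mult t lam = 0" using add.prems(1) by (simp add: in_parts_iff)
  have upd_back: "upd (upd lam t i) t 0 = lam" using assms(1) upd_same [of t lam] mt0 by simp
  have parts': "parts (upd lam t i) = insert t (parts lam)" using assms(1,2) by (simp add: parts_upd)
  have "coeffs (monom_ser (add_mset b M)) (upd lam t i)
    = (\<Sum>m\<in>insert t (parts lam). of_nat m ^ k0 * of_nat (mult m (upd lam t i)) ^ j0 * coeffs (monom_ser M) (upd (upd lam t i) m 0))"
    unfolding b monom_ser_simps
    by (subst monom_ser_row) (use parts' add.prems sz in \<open>simp_all\<close>)
  also have "\<dots> = ?v b * coeffs (monom_ser M) lam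
     + (\<Sum>m\<in>parts lam. of_nat m ^ k0 * of_nat (mult m (upd lam t i)) ^ j0 * coeffs (monom_ser M) (upd (upd lam t i) m 0))"
    using add.prems(1) assms(1) upd_back by (simp add: b mult_upd)
  also have "(\<Sum>m\<in>parts lam. of_nat m ^ k0 * of_nat (mult m (upd lam t i)) ^ j0 * coeffs (monom_ser M) (upd (upd lam t i) m 0))
    = (\<Sum>m\<in>parts lam. ?w m * (\<Sum>c\<in>#M. ?v c * coeffs (monom_ser (M - {#c#})) (upd lam m 0)))"
  proof (rule sum.cong [OF refl])
    fix m assume m: "m \<in> parts lam"
    then have mt: "m \<noteq> t" "m > 0" using add.prems(1) parts_pos by auto
    have "coeffs (monom_ser M) (upd (upd lam m 0) t i)
      = (\<Sum>(k, j)\<in>#M. of_nat t ^ k * of_nat i ^ j * coeffs (monom_ser (M - {#(k, j)#})) (upd lam m 0))"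
    proof (rule add.IH)
      show "t \<notin> parts (upd lam m 0)" using add.prems(1) mt by (simp add: parts_upd)
      have "card (parts lam) > 0" using m by (auto simp: card_gt_0_iff)
      then show "size M = Suc (card (parts (upd lam m 0)))" using sz m by (simp add: card_parts_upd_0)
    qed
    then show "of_nat m ^ k0 * of_nat (mult m (upd lam t i)) ^ j0 * coeffs (monom_ser M) (upd (upd lam t i) m 0)
      = ?w m * (\<Sum>c\<in>#M. ?v c * coeffs (monom_ser (M - {#c#})) (upd lam m 0))"
      using mt assms(1) by (simp add: mult_upd upd_commute [of t m] case_prod_beta')
  qed
  also have "\<dots> = (\<Sum>c\<in>#M. \<Sum>m\<in>parts lam. ?w m * (?v c * coeffs (monom_ser (M - {#c#})) (upd lam m 0)))"
    by (simp add: sum_mset_distrib_left sum_sum_mset_swap)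
  also have "\<dots> = (\<Sum>c\<in>#M. ?v c * coeffs (monom_ser (add_mset b M - {#c#})) lam)"
  proof (rule arg_cong [of _ _ sum_mset], rule image_mset_cong)
    fix c assume c: "c \<in># M"
    then have "size M = Suc (size (M - {#c#}))" by (simp add: size_Suc_Diff1)
    then have "coeffs (prim k0 j0 * monom_ser (M - {#c#})) lam
        = (\<Sum>m\<in>parts lam. ?w m * coeffs (monom_ser (M - {#c#})) (upd lam m 0))"
      using sz by (intro monom_ser_row) simp
    then show "(\<Sum>m\<in>parts lam. ?w m * (?v c * coeffs (monom_ser (M - {#c#})) (upd lam m 0)))
      = ?v c * coeffs (monom_ser (add_mset b M - {#c#})) lam"
      using c by (simp add: b sum_distrib_left mult_ac flip: monom_ser_simps(2))
  qed
  finally show ?case by (simp add: case_prod_beta')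
qed simp

section \<open>Derivations\<close>

text \<open>Vanishing for large \<open>n\<close> is enough, which leaves room to choose a part that
  is not yet present.\<close>

lemma power_combination_zero:
  assumes "finite J" "\<And>n. n > T \<Longrightarrow> (\<Sum>j\<in>J. a j * of_nat n ^ j) = (0 :: complex)" "j \<in> J"
  shows "a j = 0"
proof -
  define p where "p = (\<Sum>j\<in>J. monom (a j) j)"
  have "p = 0"
  proof (rule ccontr)
    assume "p \<noteq> 0"
    then have "finite {x. poly p x = 0}" by (rule poly_roots_finite)
    moreover have "of_nat ` {T<..} \<subseteq> {x. poly p x = 0}"
      using assms(2) by (auto simp: p_def poly_sum poly_monom)
    ultimately have "finite (of_nat ` {T<..} :: complex set)" by (rule rev_finite_subset)
    then have "finite {T<..}" by (rule finite_imageD) (simp add: inj_on_def)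
    then show False by (simp add: infinite_Ioi)
  qed
  then have "coeff p j = 0" by simp
  then show ?thesis using assms(1,3) by (simp add: p_def coeff_sum)
qed

lemma two_power_combination_zero:
  assumes B: "finite B" and b: "(k0, j0) \<in> B"
    and zero: "\<And>t i. t > T \<Longrightarrow> i > 0 \<Longrightarrow> (\<Sum>(k, j)\<in>B. C (k, j) * of_nat t ^ k * of_nat i ^ j) = (0 :: complex)"
  shows "C (k0, j0) = 0"
proof -
  define C' where "C' k j = (if (k, j) \<in> B then C (k, j) else 0)" for k j
  have fin: "finite (fst ` B)" "finite (snd ` B)" using B by auto
  have eq: "(\<Sum>j\<in>snd ` B. (\<Sum>k\<in>fst ` B. C' k j * of_nat t ^ k) * of_nat i ^ j) = (\<Sum>(k, j)\<in>B. C (k, j) * of_nat t ^ k * of_nat i ^ j)"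
    for t i :: nat
  proof -
    have "(\<Sum>j\<in>snd ` B. (\<Sum>k\<in>fst ` B. C' k j * of_nat t ^ k) * of_nat i ^ j)
        = (\<Sum>k\<in>fst ` B. \<Sum>j\<in>snd ` B. C' k j * of_nat t ^ k * of_nat i ^ j)"
      unfolding sum_distrib_right by (rule sum.swap)
    also have "\<dots> = (\<Sum>(k, j)\<in>fst ` B \<times> snd ` B. C' k j * of_nat t ^ k * of_nat i ^ j)"
      by (rule sum.cartesian_product)
    also have "\<dots> = (\<Sum>(k, j)\<in>B. C (k, j) * of_nat t ^ k * of_nat i ^ j)"
      by (rule sum.mono_neutral_cong_right) (use fin in \<open>force simp: C'_def\<close>)+
    finally show ?thesis .
  qed
  have in_B: "k0 \<in> fst ` B" "j0 \<in> snd ` B" using b by force+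
  have "(\<Sum>k\<in>fst ` B. C' k j0 * of_nat t ^ k) = 0" if t: "t > T" for t
  proof (rule power_combination_zero [OF fin(2) _ in_B(2), where a = "\<lambda>j. \<Sum>k\<in>fst ` B. C' k j * of_nat t ^ k"])
    fix n :: nat assume "n > 0"
    then show "(\<Sum>j\<in>snd ` B. (\<Sum>k\<in>fst ` B. C' k j * of_nat t ^ k) * of_nat n ^ j) = 0"
      unfolding eq by (rule zero [OF t])
  qed
  then have "C' k0 j0 = 0"
    by (rule power_combination_zero [OF fin(1) _ in_B(1), where a = "\<lambda>k. C' k j0"])
  then show ?thesis using b by (simp add: C'_def)
qed

lemma sum_mset_eq_sum_count:
  assumes "finite B" "set_mset M \<subseteq> B"
  shows "(\<Sum>b\<in>#M. f b) = (\<Sum>b\<in>B. of_nat (count M b) * f b :: 'a :: comm_semiring_1)"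
  using assms(2)
proof (induction M)
  case (add a M)
  have "(\<Sum>b\<in>B. of_nat (count (add_mset a M) b) * f b)
      = (\<Sum>b\<in>B. (if b = a then f b else 0) + of_nat (count M b) * f b)"
    by (rule sum.cong) (auto simp: algebra_simps)
  also have "\<dots> = f a + (\<Sum>b\<in>B. of_nat (count M b) * f b)"
    using add.prems assms(1) by (simp add: sum.distrib)
  finally show ?case using add by simp
qed simp

text \<open>A large new part \<open>t\<close> with multiplicity \<open>i\<close> is added to a
  partition with \<open>N\<close> distinct parts. By the column expansion the relation becomes a
  polynomial in \<open>t\<close> and \<open>i\<close>, and its coefficient belonging to
  \<open>b0\<close> is a relation between the monomials with one factor \<open>b0\<close> removed.
  There the coefficients are multiplied by \<open>count M b0\<close>, which is nonzero for
  \<open>M0\<close>.\<close>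

lemma monom_ser_independent_homogeneous:
  assumes "finite F" "\<And>M. M \<in> F \<Longrightarrow> size M = N"
    and "\<And>lam. card (parts lam) = N \<Longrightarrow> (\<Sum>M\<in>F. c M * coeffs (monom_ser M) lam) = 0"
    and "M0 \<in> F"
  shows "c M0 = 0"
  using assms
proof (induction N arbitrary: F c M0)
  case 0
  then have F: "F = {{#}}" by auto
  show ?case using 0(3) [of 0] 0(4) unfolding F by (simp add: coeffs_1)
next
  case (Suc N)
  define B where "B = (\<Union>M\<in>F. set_mset M)"
  have B: "finite B" using Suc.prems(1) by (simp add: B_def)
  have "size M0 = Suc N" using Suc.prems by blast
  then obtain b0 where b0: "b0 \<in># M0" by (metis multiset_nonemptyE size_empty Zero_not_Suc)
  then have b0B: "b0 \<in> B" using Suc.prems(4) by (auto simp: B_def)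
  have zero: "(\<Sum>M\<in>F. c M * of_nat (count M b0) * coeffs (monom_ser (M - {#b0#})) lam) = 0"
    if lam: "card (parts lam) = N" for lam
  proof -
    define C where "C b = (\<Sum>M\<in>F. c M * of_nat (count M b) * coeffs (monom_ser (M - {#b#})) lam)" for b
    obtain T where T: "\<And>t. t > T \<Longrightarrow> t \<notin> parts lam"
      by (metis finite_parts finite_nat_set_iff_bounded_le not_le)
    have "(\<Sum>(k, j)\<in>B. C (k, j) * of_nat t ^ k * of_nat i ^ j) = 0" if t: "t > T" and i: "i > 0" for t i
    proof -
      have t': "t > 0" "t \<notin> parts lam" using t T [OF t] by auto
      have "(\<Sum>(k, j)\<in>B. C (k, j) * of_nat t ^ k * of_nat i ^ j)
        = (\<Sum>M\<in>F. c M * (\<Sum>b\<in>B. of_nat (count M b) * (case b of (k, j) \<Rightarrow> of_nat t ^ k * of_nat i ^ j * coeffs (monom_ser (M - {#(k, j)#})) lam)))"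
        unfolding C_def sum_distrib_left sum_distrib_right
        by (subst sum.swap) (simp add: case_prod_beta' mult_ac sum_distrib_right)
      also have "\<dots> = (\<Sum>M\<in>F. c M * coeffs (monom_ser M) (upd lam t i))"
      proof (rule sum.cong [OF refl])
        fix M assume M: "M \<in> F"
        then have "set_mset M \<subseteq> B" by (auto simp: B_def)
        note sum_mset_eq_sum_count [OF B this,
            of "\<lambda>(k, j). of_nat t ^ k * of_nat i ^ j * coeffs (monom_ser (M - {#(k, j)#})) lam"]
        moreover have "size M = Suc (card (parts lam))" using Suc.prems(2) M lam by simp
        ultimately show "c M * (\<Sum>b\<in>B. of_nat (count M b) * (case b of (k, j) \<Rightarrow> of_nat t ^ k * of_nat i ^ j * coeffs (monom_ser (M - {#(k, j)#})) lam))
          = c M * coeffs (monom_ser M) (upd lam t i)"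
          using monom_ser_column [OF t'(1) i t'(2), of M] by simp
      qed
      also have "\<dots> = 0"
      proof (rule Suc.prems(3))
        show "card (parts (upd lam t i)) = Suc N" using lam t' i by (simp add: parts_upd)
      qed
      finally show ?thesis .
    qed
    then have "C b0 = 0" using two_power_combination_zero [OF B, of "fst b0" "snd b0" T C] b0B by simp
    then show ?thesis by (simp add: C_def)
  qed
  define F0 where "F0 = {M \<in> F. b0 \<in># M}"
  have inj: "inj_on (\<lambda>M. M - {#b0#}) F0"
    by (rule inj_onI) (metis (mono_tags, lifting) F0_def insert_DiffM mem_Collect_eq)
  have "c (add_mset b0 (M0 - {#b0#})) * of_nat (count (add_mset b0 (M0 - {#b0#})) b0) = 0"
  proof (rule Suc.IH [of "(\<lambda>M. M - {#b0#}) ` F0" "\<lambda>M. c (add_mset b0 M) * of_nat (count (add_mset b0 M) b0)"])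
    show "finite ((\<lambda>M. M - {#b0#}) ` F0)" using Suc.prems(1) by (simp add: F0_def)
    show "size M = N" if "M \<in> (\<lambda>M. M - {#b0#}) ` F0" for M
      using that Suc.prems(2) by (auto simp: F0_def size_Diff_singleton)
    show "M0 - {#b0#} \<in> (\<lambda>M. M - {#b0#}) ` F0" using b0 Suc.prems(4) by (auto simp: F0_def)
    fix lam assume lam: "card (parts lam) = N"
    have "(\<Sum>M\<in>(\<lambda>M. M - {#b0#}) ` F0. c (add_mset b0 M) * of_nat (count (add_mset b0 M) b0) * coeffs (monom_ser M) lam)
      = (\<Sum>M\<in>F0. c M * of_nat (count M b0) * coeffs (monom_ser (M - {#b0#})) lam)"
      by (subst sum.reindex [OF inj]) (auto simp: F0_def intro!: sum.cong)
    also have "\<dots> = (\<Sum>M\<in>F. c M * of_nat (count M b0) * coeffs (monom_ser (M - {#b0#})) lam)"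
      by (rule sum.mono_neutral_left) (use Suc.prems(1) in \<open>auto simp: F0_def not_in_iff\<close>)
    finally show "(\<Sum>M\<in>(\<lambda>M. M - {#b0#}) ` F0. c (add_mset b0 M) * of_nat (count (add_mset b0 M) b0) * coeffs (monom_ser M) lam) = 0"
      using zero [OF lam] by simp
  qed
  then show ?case using b0 by (simp add: count_eq_zero_iff)
qed

lemma coeffs_sum: "coeffs (\<Sum>i\<in>A. f i) lam = (\<Sum>i\<in>A. coeffs (f i) lam)"
  by (induction A rule: infinite_finite_induct) auto

text \<open>Among the monomials with nonzero coefficient those of maximal size \<open>N\<close> are
  isolated by evaluating at partitions with \<open>N\<close> distinct parts, where all shorter
  monomials vanish.\<close>

lemma monom_ser_independent:
  assumes F: "finite F" and zero: "(\<Sum>M\<in>F. cser (c M) * monom_ser M) = 0" and "M0 \<in> F"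
  shows "c M0 = 0"
proof (rule ccontr)
  assume "c M0 \<noteq> 0"
  define F1 where "F1 = {M \<in> F. c M \<noteq> 0}"
  have F1: "finite F1" "F1 \<noteq> {}" using F \<open>M0 \<in> F\<close> \<open>c M0 \<noteq> 0\<close> by (auto simp: F1_def)
  define N where "N = Max (size ` F1)"
  define F2 where "F2 = {M \<in> F1. size M = N}"
  have "N \<in> size ` F1" using F1 unfolding N_def by (intro Max_in) auto
  then obtain M1 where M1: "M1 \<in> F2" by (auto simp: F2_def)
  have "c M1 = 0"
  proof (rule monom_ser_independent_homogeneous [OF _ _ _ M1])
    show "finite F2" "\<And>M. M \<in> F2 \<Longrightarrow> size M = N" using F1 by (auto simp: F2_def)
    fix lam assume lam: "card (parts lam) = N"
    have "(\<Sum>M\<in>F2. c M * coeffs (monom_ser M) lam) = (\<Sum>M\<in>F. c M * coeffs (monom_ser M) lam)"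
    proof (rule sum.mono_neutral_left [OF F])
      show "\<forall>M\<in>F - F2. c M * coeffs (monom_ser M) lam = 0"
      proof
        fix M assume M: "M \<in> F - F2"
        show "c M * coeffs (monom_ser M) lam = 0"
        proof (cases "c M = 0")
          case False
          then have "M \<in> F1" "size M \<noteq> N" using M by (auto simp: F1_def F2_def)
          moreover have "size M \<le> N"
            unfolding N_def using F1 \<open>M \<in> F1\<close> by (intro Max_ge) auto
          ultimately have "size M < N" by simp
          then show ?thesis using monom_ser_vanish [of M lam] lam by simp
        qed simp
      qed
    qed (auto simp: F1_def F2_def)
    also have "\<dots> = coeffs (\<Sum>M\<in>F. cser (c M) * monom_ser M) lam"
      by (simp add: coeffs_sum)
    finally show "(\<Sum>M\<in>F2. c M * coeffs (monom_ser M) lam) = 0" by (simp add: zero)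
  qed
  then show False using M1 by (auto simp: F1_def F2_def)
qed

section \<open>Derivations with prescribed values on the generators\<close>

lemma cser_simps [simp]:
  "cser 0 = 0" "cser 1 = 1" "cser (a + b) = cser a + cser b" "cser (a * b) = cser a * cser b"
  "cser (- a) = - cser a"
proof -
  show "cser 0 = 0" "cser 1 = 1" "cser (- a) = - cser a" "cser (a + b) = cser a + cser b"
    by (rule pser_eqI; simp add: cser_def coeffs_1)+
  show "cser (a * b) = cser a * cser b"
    by (rule pser_eqI) (simp, simp add: cser_def)
qed

text \<open>A derivation is first introduced as a relation, so that Leibniz' rule is immediate and
  single-valuedness is where the independence of the monomials enters.\<close>
inductive deriv_pair :: "(nat \<times> nat \<Rightarrow> pser) \<Rightarrow> pser \<Rightarrow> pser \<Rightarrow> bool" for y where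
  const: "deriv_pair y (cser c) 0"
| add: "deriv_pair y f f' \<Longrightarrow> deriv_pair y g g' \<Longrightarrow> deriv_pair y (f + g) (f' + g')"
| gen: "odd (k + j) \<Longrightarrow> deriv_pair y f f' \<Longrightarrow> deriv_pair y (prim k j * f) (y (k, j) * f + prim k j * f')"

lemma deriv_pair_smult: "deriv_pair y f f' \<Longrightarrow> deriv_pair y (cser c * f) (cser c * f')"
proof (induction rule: deriv_pair.induct)
  case (const d)
  then show ?case using deriv_pair.const [of y "c * d"] by simp
next
  case (gen k j f f')
  then show ?case using deriv_pair.gen [OF gen.hyps(1) gen.IH] by (simp add: algebra_simps)
qed (auto simp: distrib_left intro: deriv_pair.intros)

lemma deriv_pair_mult:
  assumes "deriv_pair y f f'" "deriv_pair y g g'"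
  shows "deriv_pair y (f * g) (f' * g + f * g')"
  using assms(1)
proof (induction rule: deriv_pair.induct)
  case (const c)
  then show ?case using deriv_pair_smult [OF assms(2)] by simp
next
  case (add f f' h h')
  then show ?case using deriv_pair.add [OF add.IH] by (simp add: algebra_simps)
next
  case (gen k j f f')
  then show ?case using deriv_pair.gen [OF gen.hyps(1) gen.IH] by (simp add: algebra_simps)
qed

definition monom_deriv :: "(nat \<times> nat \<Rightarrow> pser) \<Rightarrow> (nat \<times> nat) multiset \<Rightarrow> pser" where
  "monom_deriv y M = (\<Sum>b\<in>#M. y b * monom_ser (M - {#b#}))"

lemma monom_deriv_add:
  "monom_deriv y (add_mset (k, j) M) = y (k, j) * monom_ser M + prim k j * monom_deriv y M"
proof -
  have "(\<Sum>b\<in>#M. y b * monom_ser (add_mset (k, j) M - {#b#})) = (\<Sum>b\<in>#M. prim k j * (y b * monom_ser (M - {#b#})))"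
    by (rule arg_cong [of _ _ sum_mset], rule image_mset_cong) (simp add: mult_ac flip: monom_ser_simps(2))
  then show ?thesis by (simp add: monom_deriv_def sum_mset_distrib_left)
qed

text \<open>Both components of a pair have the same coefficients: an expression of \<open>f\<close>
  in monomials determines \<open>f'\<close> by Leibniz' rule. With independence of the monomials,
  \<open>f = 0\<close> then forces \<open>f' = 0\<close>.\<close>

lemma deriv_pair_rep:
  assumes "deriv_pair y f f'"
  shows "\<exists>F c. finite F \<and> f = (\<Sum>M\<in>F. cser (c M) * monom_ser M) \<and> f' = (\<Sum>M\<in>F. cser (c M) * monom_deriv y M)"
  using assms
proof (induction rule: deriv_pair.induct)
  case (const c)
  show ?case by (rule exI [of _ "{{#}}"], rule exI [of _ "\<lambda>_. c"]) (simp add: monom_deriv_def)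
next
  case (add f f' g g')
  then obtain F c G d where
    F: "finite F" "f = (\<Sum>M\<in>F. cser (c M) * monom_ser M)" "f' = (\<Sum>M\<in>F. cser (c M) * monom_deriv y M)" and
    G: "finite G" "g = (\<Sum>M\<in>G. cser (d M) * monom_ser M)" "g' = (\<Sum>M\<in>G. cser (d M) * monom_deriv y M)"
    by blast
  let ?e = "\<lambda>M. (if M \<in> F then c M else 0) + (if M \<in> G then d M else 0)"
  have "(\<Sum>M\<in>F. cser (c M) * h M) + (\<Sum>M\<in>G. cser (d M) * h M) = (\<Sum>M\<in>F \<union> G. cser (?e M) * h M)" for h
  proof -
    have "(\<Sum>M\<in>F. cser (c M) * h M) = (\<Sum>M\<in>F \<union> G. cser (if M \<in> F then c M else 0) * h M)"
      by (rule sum.mono_neutral_cong_left) (use F G in auto)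
    moreover have "(\<Sum>M\<in>G. cser (d M) * h M) = (\<Sum>M\<in>F \<union> G. cser (if M \<in> G then d M else 0) * h M)"
      by (rule sum.mono_neutral_cong_left) (use F G in auto)
    ultimately show ?thesis by (simp add: distrib_right sum.distrib)
  qed
  then show ?case using F G by (intro exI [of _ "F \<union> G"] exI [of _ ?e]) simp
next
  case (gen k j f f')
  then obtain F c where
    F: "finite F" "f = (\<Sum>M\<in>F. cser (c M) * monom_ser M)" "f' = (\<Sum>M\<in>F. cser (c M) * monom_deriv y M)"
    by blast
  let ?G = "add_mset (k, j) ` F" and ?d = "\<lambda>M. c (M - {#(k, j)#})"
  have inj: "inj_on (add_mset (k, j)) F" by (simp add: inj_on_def)
  have "prim k j * f = (\<Sum>M\<in>?G. cser (?d M) * monom_ser M)"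
    by (subst sum.reindex [OF inj]) (simp add: F sum_distrib_left mult.left_commute)
  moreover have "y (k, j) * f + prim k j * f' = (\<Sum>M\<in>?G. cser (?d M) * monom_deriv y M)"
    by (subst sum.reindex [OF inj])
      (simp add: F sum_distrib_left mult.left_commute monom_deriv_add distrib_left sum.distrib)
  ultimately show ?case using F(1) by (intro exI [of _ ?G] exI [of _ ?d]) simp
qed

lemma deriv_pair_unique:
  assumes "deriv_pair y f f'" "deriv_pair y f f''"
  shows "f' = f''"
proof -
  have "deriv_pair y (f + cser (- 1) * f) (f' + cser (- 1) * f'')"
    by (intro deriv_pair.add deriv_pair_smult assms)
  then have "deriv_pair y 0 (f' - f'')" by simp
  then obtain F c where F: "finite F" "0 = (\<Sum>M\<in>F. cser (c M) * monom_ser M)"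
      "f' - f'' = (\<Sum>M\<in>F. cser (c M) * monom_deriv y M)"
    using deriv_pair_rep by blast
  have "c M = 0" if "M \<in> F" for M
    using monom_ser_independent [OF F(1) F(2) [symmetric] that] .
  then have "f' - f'' = 0" unfolding F(3) by simp
  then show ?thesis by simp
qed

lemma odot_add_left: "odot (\<lambda>x. f x + f' x) g = (\<lambda>x. odot f g x + odot f' g x)"
  and odot_assoc: "odot (odot f g) h = odot f (odot g h)"
  and odot_const: "odot (\<lambda>_. c) g = (\<lambda>x. c * g x)"
  by (simp_all add: ub_odot ub_smult ub_add ub_const algebra_simps flip: ub_inject)

lemma Talg_smult: "f \<in> Talg \<Longrightarrow> (\<lambda>x. c * f x) \<in> Talg"
  by (rule Talg.mul [OF Talg.const])

lemma Talg_odot_Agen: "odd (k + j) \<Longrightarrow> f \<in> Talg \<Longrightarrow> odot (Agen k j) f \<in> Talg"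
  unfolding Talg_eq_odot_alg slot_sum_conv_op [symmetric] by (rule gen_alg.gen)

lemma Talg_odot:
  assumes "f \<in> Talg" "g \<in> Talg"
  shows "odot f g \<in> Talg"
  using assms(1)
  by (induction rule: Talg_odot_induct)
    (use assms(2) in \<open>auto simp: odot_const odot_add_left odot_assoc intro: Talg_smult Talg.add Talg_odot_Agen\<close>)

lemma ub_coeffs [simp]: "ub (coeffs (Zser * f)) = f"
  by (rule ub_eqI) simp

lemma deriv_pair_total: "f \<in> Talg \<Longrightarrow> \<exists>f'. deriv_pair y (ub f) f'"
proof (induction rule: Talg_odot_induct)
  case (odot k j f)
  then show ?case using deriv_pair.gen [OF odot.hyps(1)] by (auto simp: ub_odot ub_Agen)
qed (auto simp: ub_const ub_add intro: deriv_pair.intros)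

lemma deriv_pair_Talg:
  assumes "deriv_pair y f f'" "\<And>k j. odd (k + j) \<Longrightarrow> coeffs (Zser * y (k, j)) \<in> Talg"
  shows "coeffs (Zser * f) \<in> Talg \<and> coeffs (Zser * f') \<in> Talg"
  using assms(1)
proof (induction rule: deriv_pair.induct)
  case (const c)
  have "coeffs (Zser * cser c) = (\<lambda>_. c)"
    by (simp add: ub_const flip: ub_inject)
  moreover have "coeffs (Zser * 0) = (\<lambda>_. 0)"
    by (rule ext) simp
  ultimately show ?case by (simp add: Talg.const)
next
  case (add f f' g g')
  have "coeffs (Zser * (f + g)) = (\<lambda>x. coeffs (Zser * f) x + coeffs (Zser * g) x)" for f g
    by (simp add: ub_add flip: ub_inject)
  with add show ?case by (auto intro: Talg.add)
next
  case (gen k j f f')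
  have "coeffs (Zser * (prim k j * f)) = odot (Agen k j) (coeffs (Zser * f))"
    by (simp add: ub_odot ub_Agen flip: ub_inject)
  moreover have "coeffs (Zser * (y (k, j) * f + prim k j * f'))
     = (\<lambda>x. odot (coeffs (Zser * y (k, j))) (coeffs (Zser * f)) x + odot (Agen k j) (coeffs (Zser * f')) x)"
    by (simp add: ub_odot ub_Agen ub_add flip: ub_inject)
  moreover note Talg_odot_Agen [OF gen.hyps(1) conjunct1 [OF gen.IH]]
    Talg.add [OF Talg_odot [OF assms(2) [OF gen.hyps(1)] conjunct1 [OF gen.IH]]
      Talg_odot_Agen [OF gen.hyps(1) conjunct2 [OF gen.IH]]]
  ultimately show ?case by simp
qed

text \<open>\<open>X\<close> is read off from the relation \<open>deriv_pair\<close> by a definite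
  description, which is justified on \<open>Talg\<close> by totality and uniqueness.\<close>

lemma exists_odot_derivation:
  assumes Y: "\<And>k j. odd (k + j) \<Longrightarrow> Y k j \<in> Talg"
  shows "\<exists>X. odot_derivation_on_T X \<and> (\<forall>k j. odd (k + j) \<longrightarrow> X (Tkl (int k) (int j + 1)) = Y k j)"
proof -
  define y where "y = (\<lambda>(k, j). ub (Y k j))"
  define X where "X f = coeffs (Zser * (THE f'. deriv_pair y (ub f) f'))" for f
  have pair: "deriv_pair y (ub f) (ub (X f))" if "f \<in> Talg" for f
  proof -
    have "\<exists>!f'. deriv_pair y (ub f) f'"
      using deriv_pair_total [OF that] deriv_pair_unique by blast
    then show ?thesis unfolding X_def ub_coeffs by (rule theI')
  qed
  have eqI: "X f = g" if "f \<in> Talg" "deriv_pair y (ub f) (ub g)" for f g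
    using deriv_pair_unique [OF pair [OF that(1)] that(2)] by (simp add: ub_inject)
  have "odot_derivation_on_T X"
    unfolding odot_derivation_on_T_def
  proof (intro conjI ballI allI)
    fix f assume f: "f \<in> Talg"
    show "X f \<in> Talg"
      using deriv_pair_Talg [OF pair [OF f]] Y by (simp add: y_def)
    show "X (\<lambda>x. c * f x) = (\<lambda>x. c * X f x)" for c
      by (rule eqI) (auto simp: ub_smult f pair intro: Talg_smult deriv_pair_smult)
    fix g assume g: "g \<in> Talg"
    show "X (\<lambda>x. f x + g x) = (\<lambda>x. X f x + X g x)"
      by (rule eqI) (auto simp: ub_add f g pair intro: Talg.add deriv_pair.add)
    show "X (odot f g) = (\<lambda>x. odot (X f) g x + odot f (X g) x)"
      by (rule eqI) (auto simp: ub_add ub_odot f g pair intro: Talg_odot deriv_pair_mult)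
  qed
  moreover have "X (Tkl (int k) (int j + 1)) = Y k j" if kj: "odd (k + j)" for k j
  proof (rule eqI)
    show "Tkl (int k) (int j + 1) \<in> Talg" using kj by (intro Talg.gen) auto
    \<comment> \<open>Up to the constant \<open>Tconst k j\<close>, which has derivative 0, the
      series of the generator is \<open>prim k j\<close>.\<close>
    have "deriv_pair y (cser (Tconst k j) + prim k j * cser 1) (0 + (y (k, j) * cser 1 + prim k j * 0))"
      using kj by (intro deriv_pair.intros)
    then show "deriv_pair y (ub (Tkl (int k) (int j + 1))) (ub (Y k j))"
      by (simp add: Tkl_eq ub_add ub_const ub_Agen y_def)
  qed
  ultimately show ?thesis by blast
qed

section \<open>The action of sl2\<close>

context
  fixes X :: "(partition \<Rightarrow> complex) \<Rightarrow> partition \<Rightarrow> complex"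
  assumes X: "odot_derivation_on_T X"
begin

lemma derivation_Talg: "f \<in> Talg \<Longrightarrow> X f \<in> Talg"
  and derivation_add: "f \<in> Talg \<Longrightarrow> g \<in> Talg \<Longrightarrow> X (\<lambda>x. f x + g x) = (\<lambda>x. X f x + X g x)"
  and derivation_smult: "f \<in> Talg \<Longrightarrow> X (\<lambda>x. c * f x) = (\<lambda>x. c * X f x)"
  and derivation_odot: "f \<in> Talg \<Longrightarrow> g \<in> Talg \<Longrightarrow> X (odot f g) = (\<lambda>x. odot (X f) g x + odot f (X g) x)"
  using X unfolding odot_derivation_on_T_def by blast+

text \<open>The constant 1 is the unit of \<open>odot\<close>, and Leibniz' rule gives
  \<open>X 1 = X 1 + X 1\<close>.\<close>

lemma derivation_const: "X (\<lambda>_. c) = (\<lambda>_. 0)"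
proof -
  have "odot (\<lambda>_. 1) (\<lambda>_. 1) = (\<lambda>_. 1)" by (simp add: odot_const)
  then have "ub (X (\<lambda>_. 1)) = ub (X (\<lambda>_. 1)) + ub (X (\<lambda>_. 1))"
    using arg_cong [OF derivation_odot [OF Talg.const [of 1] Talg.const [of 1]], of ub]
    by (simp add: ub_add ub_odot ub_const)
  then have "ub (X (\<lambda>_. 1)) = ub (\<lambda>_. 0)" by (simp add: ub_const)
  then have "X (\<lambda>_. 1) = (\<lambda>_. 0)" by (simp add: ub_inject)
  then show ?thesis using derivation_smult [OF Talg.const [of 1], of c] by simp
qed

lemma derivation_Agen:
  assumes "odd (k + j)"
  shows "X (Agen k j) = X (Tkl (int k) (int j + 1))"
  unfolding Tkl_eq derivation_add [OF Talg.const Agen_in_Talg [OF assms]] derivation_const by simp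

end

text \<open>The commutator of two derivations is a derivation, the mixed terms cancelling, and so is
  \<open>c\<close> times \<open>Z\<close>; agreement on generators suffices. The scalar
  \<open>c\<close> covers all three sl2 relations.\<close>

lemma Talg_odot_derivation_commutator:
  assumes X: "odot_derivation_on_T X" and Y: "odot_derivation_on_T Y" and Z: "odot_derivation_on_T Z"
    and gen: "\<And>k j. odd (k + j) \<Longrightarrow> X (Y (Tkl (int k) (int j + 1)))
        = (\<lambda>x. Y (X (Tkl (int k) (int j + 1))) x + c * Z (Tkl (int k) (int j + 1)) x)"
    and "f \<in> Talg"
  shows "X (Y f) = (\<lambda>x. Y (X f) x + c * Z f x)"
  using \<open>f \<in> Talg\<close>
proof (induction rule: Talg_odot_induct)
  case (const d)
  then show ?case by (simp add: derivation_const [OF X] derivation_const [OF Y] derivation_const [OF Z])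
next
  case (add f g)
  then show ?case
    by (simp add: derivation_add X Y Z derivation_Talg algebra_simps)
next
  case (odot k j f)
  let ?A = "Agen k j"
  have A: "?A \<in> Talg" using odot.hyps(1) by (rule Agen_in_Talg)
  have genA: "X (Y ?A) = (\<lambda>x. Y (X ?A) x + c * Z ?A x)"
    using gen [OF odot.hyps(1)] odot.hyps(1) by (simp add: derivation_Agen X Y Z)
  note T = A odot.hyps(2) derivation_Talg [OF X A] derivation_Talg [OF X odot.hyps(2)]
    derivation_Talg [OF Y A] derivation_Talg [OF Y odot.hyps(2)]
  have "ub (X (Y (odot ?A f))) = ub (X (Y ?A)) * ub f + ub (Y ?A) * ub (X f) + ub (X ?A) * ub (Y f) + ub ?A * ub (X (Y f))"
    using T by (simp add: derivation_odot X Y derivation_add Talg_odot ub_add ub_odot)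
  also have "\<dots> = ub (\<lambda>x. Y (X (odot ?A f)) x + c * Z (odot ?A f) x)"
    using T unfolding genA odot.IH
    by (simp add: derivation_odot X Y Z derivation_add Talg_odot ub_add ub_odot ub_smult algebra_simps)
  finally show ?case by (simp add: ub_inject)
qed

lemma qbracket_QMF: "f \<in> Talg \<Longrightarrow> qbracket f \<in> QMF"
proof (induction rule: Talg_odot_induct)
  case (odot k j f)
  have "qbracket (Agen k j) = qbracket (Tkl (int k) (int j + 1)) + fps_const (- Tconst k j)"
    unfolding Tkl_eq qbracket_add qbracket_const by (simp add: fps_ext)
  then have "qbracket (Agen k j) \<in> QMF"
    using eis_gen_QMF_wt [OF odot.hyps(1)] by (auto simp: qbracket_Tkl intro: QMF.intros QMF_wt_imp_QMF)
  with odot show ?case by (simp add: qbracket_odot QMF.mul)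
qed (auto simp: qbracket_const qbracket_add intro: QMF.intros)

text \<open>The bracket is multiplicative for \<open>odot\<close>, so both sides obey Leibniz' rule
  along it and only generators have to be compared. Constants are killed on both sides, so
  \<open>eis_gen\<close> can stand for the bracket of \<open>Agen\<close>.\<close>

lemma qbracket_equivariant:
  assumes X: "odot_derivation_on_T X"
    and add: "\<And>\<phi> \<psi>. \<phi> \<in> QMF \<Longrightarrow> \<psi> \<in> QMF \<Longrightarrow> \<Delta> (\<phi> + \<psi>) = \<Delta> \<phi> + \<Delta> \<psi>"
    and mult: "\<And>\<phi> \<psi>. \<phi> \<in> QMF \<Longrightarrow> \<psi> \<in> QMF \<Longrightarrow> \<Delta> (\<phi> * \<psi>) = \<Delta> \<phi> * \<psi> + \<phi> * \<Delta> \<psi>"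
    and const: "\<And>c. \<Delta> (fps_const c) = 0"
    and gen: "\<And>k j. odd (k + j) \<Longrightarrow> \<Delta> (eis_gen k j) = qbracket (X (Tkl (int k) (int j + 1)))"
    and "f \<in> Talg"
  shows "\<Delta> (qbracket f) = qbracket (X f)"
  using \<open>f \<in> Talg\<close>
proof (induction rule: Talg_odot_induct)
  case (const c)
  then show ?case by (simp add: qbracket_const derivation_const [OF X] assms(4))
next
  case (add f g)
  then show ?case by (simp add: qbracket_add derivation_add [OF X] assms(2) qbracket_QMF)
next
  case (odot k j f)
  let ?A = "Agen k j"
  have A: "?A \<in> Talg" using odot.hyps(1) by (rule Agen_in_Talg)
  have "eis_gen k j = fps_const (Tconst k j) + qbracket ?A"
    unfolding qbracket_Tkl [symmetric] Tkl_eq qbracket_add qbracket_const ..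
  then have "\<Delta> (qbracket ?A) = \<Delta> (eis_gen k j)"
    by (simp add: assms(2,4) QMF.const qbracket_QMF [OF A])
  then have "\<Delta> (qbracket ?A) = qbracket (X ?A)"
    unfolding gen [OF odot.hyps(1)] derivation_Agen [OF X odot.hyps(1)] .
  then show ?case
    using odot A
    by (simp add: qbracket_odot derivation_odot [OF X] mult qbracket_QMF qbracket_add)
qed

lemma exists_T_operators: "\<exists>D W d. T_operators D W d"
proof -
  let ?d = "\<lambda>k l x. of_int (k * (l - 1)) * Tkl (k - 1) (l - 1) x - (if k + l = 2 then 1 / 2 else 0)"
  have "\<exists>D. odot_derivation_on_T D \<and> (\<forall>k j. odd (k + j) \<longrightarrow> D (Tkl (int k) (int j + 1)) = Tkl (int k + 1) (int j + 1 + 1))"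
    by (rule exists_odot_derivation) (auto intro: Talg.gen)
  then obtain D where D: "odot_derivation_on_T D"
      "\<And>k j. odd (k + j) \<Longrightarrow> D (Tkl (int k) (int j + 1)) = Tkl (int k + 1) (int j + 1 + 1)" by blast
  have "\<exists>W. odot_derivation_on_T W \<and> (\<forall>k j. odd (k + j) \<longrightarrow> W (Tkl (int k) (int j + 1))
      = (\<lambda>x. of_int (int k + (int j + 1)) * Tkl (int k) (int j + 1) x))"
    by (rule exists_odot_derivation) (auto intro!: Talg.gen Talg_smult)
  then obtain W where W: "odot_derivation_on_T W"
      "\<And>k j. odd (k + j) \<Longrightarrow> W (Tkl (int k) (int j + 1)) = (\<lambda>x. of_int (int k + (int j + 1)) * Tkl (int k) (int j + 1) x)"
    by blast
  have "\<exists>d. odot_derivation_on_T d \<and> (\<forall>k j. odd (k + j) \<longrightarrow> d (Tkl (int k) (int j + 1)) = ?d (int k) (int j + 1))"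
  proof (rule exists_odot_derivation)
    fix k j :: nat assume kj: "odd (k + j)"
    have "(\<lambda>x. of_int (int k * (int j + 1 - 1)) * Tkl (int k - 1) (int j + 1 - 1) x) \<in> Talg"
    \<comment> \<open>On the boundary one of the lowered indices leaves the admissible range, but
      the factor in front is 0.\<close>
    proof (cases "k = 0 \<or> j = 0")
      case True
      then show ?thesis using Talg.const [of 0] by auto
    next
      case False
      then have "Tkl (int k - 1) (int j + 1 - 1) \<in> Talg"
        using kj by (intro Talg.gen) auto
      then show ?thesis by (rule Talg_smult)
    qed
    from Talg.add [OF this Talg.const] show "?d (int k) (int j + 1) \<in> Talg"
      by (simp only: diff_conv_add_uminus)
  qed
  then obtain d where d: "odot_derivation_on_T d"
      "\<And>k j. odd (k + j) \<Longrightarrow> d (Tkl (int k) (int j + 1)) = ?d (int k) (int j + 1)" by blast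
  have "T_operators D W d"
    unfolding T_operators_def
  proof (intro conjI allI impI D(1) W(1) d(1))
    fix k l :: int assume "k \<ge> 0" "l \<ge> 1" "even (k + l)"
    then obtain k' j where kl: "k = int k'" "l = int j + 1" "odd (k' + j)" by (rule Tkl_index_cases)
    show "D (Tkl k l) = Tkl (k + 1) (l + 1)" unfolding kl(1,2) by (rule D(2) [OF kl(3)])
    show "W (Tkl k l) = (\<lambda>x. of_int (k + l) * Tkl k l x)" unfolding kl(1,2) by (rule W(2) [OF kl(3)])
    show "d (Tkl k l) = ?d k l" unfolding kl(1,2) by (rule d(2) [OF kl(3)])
  qed
  then show ?thesis by blast
qed

section \<open>The three operators on generators, their relations and equivariance\<close>

context
  fixes D W d
  assumes ops: "T_operators D W d"
begin

lemma T_operators_derivations: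
  "odot_derivation_on_T D" "odot_derivation_on_T W" "odot_derivation_on_T d"
  using ops by (simp_all add: T_operators_def)

text \<open>The prescribed values in natural-number indices with \<open>j = l - 1\<close>. The
  truncated differences deviate from the integer ones only where the factor \<open>k * j\<close> is
  0.\<close>

lemma T_operators_gen:
  assumes "odd (k + j)"
  shows "D (Tkl (int k) (int j + 1)) = Tkl (int k + 1) (int j + 1 + 1)"
    and "W (Tkl (int k) (int j + 1)) = (\<lambda>x. of_nat (k + j + 1) * Tkl (int k) (int j + 1) x)"
    and "d (Tkl (int k) (int j + 1)) = (\<lambda>x. of_nat (k * j) * Tkl (int (k - 1)) (int (j - 1) + 1) x - (if k + j = 1 then 1/2 else 0))"
proof -
  have *: "int k \<ge> 0" "int j + 1 \<ge> 1" "even (int k + (int j + 1))" using assms by auto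
  show "D (Tkl (int k) (int j + 1)) = Tkl (int k + 1) (int j + 1 + 1)"
    using ops * unfolding T_operators_def by blast
  have "W (Tkl (int k) (int j + 1)) = (\<lambda>x. of_int (int k + (int j + 1)) * Tkl (int k) (int j + 1) x)"
    using ops * unfolding T_operators_def by blast
  then show "W (Tkl (int k) (int j + 1)) = (\<lambda>x. of_nat (k + j + 1) * Tkl (int k) (int j + 1) x)"
    by (simp add: add_ac)
  have "d (Tkl (int k) (int j + 1)) = (\<lambda>x. of_int (int k * (int j + 1 - 1)) * Tkl (int k - 1) (int j + 1 - 1) x
      - (if int k + (int j + 1) = 2 then 1/2 else 0))"
    using ops * unfolding T_operators_def by blast
  moreover have "int k + (int j + 1) = 2 \<longleftrightarrow> k + j = 1" by linarith
  ultimately show "d (Tkl (int k) (int j + 1)) = (\<lambda>x. of_nat (k * j) * Tkl (int (k - 1)) (int (j - 1) + 1) x - (if k + j = 1 then 1/2 else 0))"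
    by (cases "k = 0 \<or> j = 0") (auto simp: of_nat_diff)
qed

lemma Tkl_in_Talg: "odd (k + j) \<Longrightarrow> Tkl (int k) (int j + 1) \<in> Talg"
  by (intro Talg.gen) auto

lemma d_gen:
  assumes "odd (k + j)"
  obtains "k = 0 \<or> j = 0" "d (Tkl (int k) (int j + 1)) = (\<lambda>x. - (if k + j = 1 then 1/2 else 0))"
  | k' j' where "k = Suc k'" "j = Suc j'" "odd (k' + j')"
      "d (Tkl (int k) (int j + 1)) = (\<lambda>x. of_nat (k * j) * Tkl (int k') (int j' + 1) x)"
proof (cases "k = 0 \<or> j = 0")
  case True
  then show ?thesis using that(1) T_operators_gen(3) [OF assms] by auto
next
  case False
  then obtain k' j' where "k = Suc k'" "j = Suc j'" by (metis not0_implies_Suc)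
  then show ?thesis using that(2) [of k' j'] T_operators_gen(3) [OF assms] assms by simp
qed

lemma T_operators_W_D:
  assumes "f \<in> Talg"
  shows "W (D f) = (\<lambda>x. D (W f) x + 2 * D f x)"
proof (rule Talg_odot_derivation_commutator [OF T_operators_derivations(2,1,1) _ assms])
  fix k j :: nat assume kj: "odd (k + j)"
  then have "odd (Suc k + Suc j)" by simp
  note T_operators_gen(2) [OF this]
  then have "W (Tkl (int k + 1) (int j + 1 + 1)) = (\<lambda>x. of_nat (k + j + 3) * Tkl (int k + 1) (int j + 1 + 1) x)"
    by (simp add: add_ac)
  moreover have "D (\<lambda>x. of_nat (k + j + 1) * Tkl (int k) (int j + 1) x) = (\<lambda>x. of_nat (k + j + 1) * Tkl (int k + 1) (int j + 1 + 1) x)"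
    unfolding derivation_smult [OF T_operators_derivations(1) Tkl_in_Talg [OF kj]] T_operators_gen(1) [OF kj] ..
  ultimately show "W (D (Tkl (int k) (int j + 1))) = (\<lambda>x. D (W (Tkl (int k) (int j + 1))) x + 2 * D (Tkl (int k) (int j + 1)) x)"
    unfolding T_operators_gen(1,2) [OF kj] by (simp add: algebra_simps)
qed

text \<open>If \<open>k\<close> and \<open>j\<close> are positive, the degree
  \<open>k + j + 1\<close> drops by 2. At \<open>k + j = 1\<close> the value \<open>-1/2\<close> is
  a constant killed by \<open>W\<close>, and the right-hand side vanishes as the degree is
  2.\<close>

lemma T_operators_W_d:
  assumes "f \<in> Talg"
  shows "W (d f) = (\<lambda>x. d (W f) x + (- 2) * d f x)"
proof (rule Talg_odot_derivation_commutator [OF T_operators_derivations(2,3,3) _ assms])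
  fix k j :: nat assume kj: "odd (k + j)"
  let ?T = "Tkl (int k) (int j + 1)"
  have dW: "d (W ?T) = (\<lambda>x. of_nat (k + j + 1) * d ?T x)"
    unfolding T_operators_gen(2) [OF kj] derivation_smult [OF T_operators_derivations(3) Tkl_in_Talg [OF kj]] ..
  show "W (d ?T) = (\<lambda>x. d (W ?T) x + (- 2) * d ?T x)"
  proof (rule d_gen [OF kj])
    assume d: "d ?T = (\<lambda>x. - (if k + j = 1 then 1/2 else 0))"
    have "of_nat k + of_nat j = (1 :: complex)" if "k + j = 1"
      using that by (metis of_nat_1 of_nat_add)
    then show ?thesis
      unfolding dW unfolding d derivation_const [OF T_operators_derivations(2)] by auto
  next
    fix k' j' assume k'j': "k = Suc k'" "j = Suc j'" "odd (k' + j')"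
      and d: "d ?T = (\<lambda>x. of_nat (k * j) * Tkl (int k') (int j' + 1) x)"
    show ?thesis
      unfolding dW unfolding d derivation_smult [OF T_operators_derivations(2) Tkl_in_Talg [OF k'j'(3)]]
        T_operators_gen(2) [OF k'j'(3)] using k'j' by (auto simp: algebra_simps)
  qed
qed

text \<open>On a generator this is \<open>(k + 1) (j + 1) = k j + (k + j + 1)\<close>; for
  \<open>k j = 0\<close> the first summand is absent because \<open>d\<close> gives a constant,
  which \<open>D\<close> kills.\<close>

lemma T_operators_d_D:
  assumes "f \<in> Talg"
  shows "d (D f) = (\<lambda>x. D (d f) x + 1 * W f x)"
proof (rule Talg_odot_derivation_commutator [OF T_operators_derivations(3,1,2) _ assms])
  fix k j :: nat assume kj: "odd (k + j)"
  let ?T = "Tkl (int k) (int j + 1)"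
  from kj have "odd (Suc k + Suc j)" by simp
  note T_operators_gen(3) [OF this]
  then have dD: "d (D ?T) = (\<lambda>x. of_nat (Suc k * Suc j) * ?T x)"
    unfolding T_operators_gen(1) [OF kj] by (simp add: add_ac)
  show "d (D ?T) = (\<lambda>x. D (d ?T) x + 1 * W ?T x)"
  proof (rule d_gen [OF kj])
    assume d: "d ?T = (\<lambda>x. - (if k + j = 1 then 1/2 else 0))" and "k = 0 \<or> j = 0"
    then show ?thesis
      unfolding dD T_operators_gen(2) [OF kj] unfolding d derivation_const [OF T_operators_derivations(1)]
      by auto
  next
    fix k' j' assume k'j': "k = Suc k'" "j = Suc j'" "odd (k' + j')"
      and d: "d ?T = (\<lambda>x. of_nat (k * j) * Tkl (int k') (int j' + 1) x)"
    show ?thesis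
      unfolding dD T_operators_gen(2) [OF kj]
      unfolding d derivation_smult [OF T_operators_derivations(1) Tkl_in_Talg [OF k'j'(3)]]
        T_operators_gen(1) [OF k'j'(3)] using k'j' by (auto simp: algebra_simps)
  qed
qed

lemma qD_qbracket:
  assumes "f \<in> Talg"
  shows "qD (qbracket f) = qbracket (D f)"
proof (rule qbracket_equivariant [OF T_operators_derivations(1) _ _ _ _ assms])
  fix k j :: nat assume kj: "odd (k + j)"
  show "qD (eis_gen k j) = qbracket (D (Tkl (int k) (int j + 1)))"
    unfolding T_operators_gen(1) [OF kj]
    using qbracket_Tkl [of "Suc k" "Suc j"] by (simp add: eis_gen_Suc add_ac)
qed (simp_all add: qD_mult)

lemma weight_operator_qbracket:
  assumes Wm: "is_weight_operator Wm" and "f \<in> Talg"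
  shows "Wm (qbracket f) = qbracket (W f)"
proof (rule qbracket_equivariant [OF T_operators_derivations(2) _ weight_operator_mult [OF Wm] _ _ assms(2)])
  have wt: "Wm \<phi> = fps_const (of_nat k) * \<phi>" if "\<phi> \<in> QMF_wt k" for k \<phi>
    using Wm that unfolding is_weight_operator_def by blast
  show "Wm (fps_const c) = 0" for c
    using wt [OF QMF_wt_const] by simp
  show "Wm (eis_gen k j) = qbracket (W (Tkl (int k) (int j + 1)))" if "odd (k + j)" for k j
    using wt [OF eis_gen_QMF_wt [OF that]] unfolding T_operators_gen(2) [OF that] qbracket_smult qbracket_Tkl .
qed (use Wm in \<open>auto simp: is_weight_operator_def\<close>)

lemma frak_d_operator_qbracket:
  assumes dm: "is_frak_d_operator dm" and "f \<in> Talg"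
  shows "dm (qbracket f) = qbracket (d f)"
proof (rule qbracket_equivariant [OF T_operators_derivations(3) frak_d_add [OF dm] frak_d_mult [OF dm] _ _ assms(2)])
  show "dm (fps_const c) = 0" for c
    by (rule frak_d_MF [OF dm MF.const])
  fix k j :: nat assume kj: "odd (k + j)"
  have "d (Tkl (int k) (int j + 1)) = (\<lambda>x. of_nat (k * j) * Tkl (int (k - 1)) (int (j - 1) + 1) x + - (if k + j = 1 then 1/2 else 0))"
    using T_operators_gen(3) [OF kj] by simp
  then have "qbracket (d (Tkl (int k) (int j + 1)))
      = fps_const (of_nat (k * j)) * eis_gen (k - 1) (j - 1) + fps_const (- (if k + j = 1 then 1/2 else 0))"
    by (simp only: qbracket_add qbracket_smult qbracket_const qbracket_Tkl)
  also have "\<dots> = dm (eis_gen k j)"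
    unfolding frak_d_eis_gen [OF dm kj] by (simp add: diff_conv_add_uminus del: add_uminus_conv_diff)
  finally show "dm (eis_gen k j) = qbracket (d (Tkl (int k) (int j + 1)))" by simp
qed

end

text \<open>The existential part rests on the linear independence of the monomials; it also keeps
  the universal part from being vacuous.\<close>

theorem theorem5p2p2:
  fixes Wm dm :: "complex fps \<Rightarrow> complex fps"
  assumes "is_weight_operator Wm" and "is_frak_d_operator dm"
  shows "(\<exists>D W d. T_operators D W d) \<and>
    (\<forall>D W d. T_operators D W d \<longrightarrow>
       (\<forall>f\<in>Talg.
          W (D f) = (\<lambda>x. D (W f) x + 2 * D f x) \<and>
          W (d f) = (\<lambda>x. d (W f) x - 2 * d f x) \<and>
          d (D f) = (\<lambda>x. D (d f) x + W f x) \<and>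
          qbracket f \<in> QMF \<and>
          qD (qbracket f) = qbracket (D f) \<and>
          Wm (qbracket f) = qbracket (W f) \<and>
          dm (qbracket f) = qbracket (d f)))"
  using exists_T_operators T_operators_W_D T_operators_W_d T_operators_d_D qbracket_QMF qD_qbracket
    weight_operator_qbracket [OF _ assms(1)] frak_d_operator_qbracket [OF _ assms(2)]
  by simp

end
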